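(* Let $M$ be a space-like surface in the Robertson-Walker space-time $L^4_1(f,0)$. Then $M$ has positive relative nullity if and only if it is locally congruent to a surface of the following type: the space-like surface parametrized by $$\phi(u,v)=\left(u,\ \phi_1(v)\alpha_1(v)+\left(\int_{u_0}^u\frac{a}{f(\bar u)\sqrt{a^2-f(\bar u)^2}}\,d\bar u+\phi_2(v)\right)\alpha_2(v)+\phi_3(v)\alpha_3(v)\right),\qquad (u,v)\in I_u\times I_v,$$ where $I_u\subset I$ and $I_v$ are open intervals, $u_0\in I_u$, $a\in\mathbb R$ is a constant with $a^2-f(u)^2>0$ for all $u\in I_u$, $a_1,a_2,\phi_1:I_v\to\mathbb R$ are smooth functions, $\phi_2,\phi_3:I_v\to\mathbb R$ are smooth functions satisfying $$\phi_2'=-a_1\phi_1,\qquad \phi_3'=-a_2\phi_1,$$ and $\alpha_1,\alpha_2,\alpha_3:I_v\to\mathbb R^3$ are smooth functions satisfying $$\alpha_1'=a_1\alpha_2+a_2\alpha_3,\quad \alpha_2'=-a_1\alpha_1,\quad \alpha_3'=-a_2\alpha_1,\qquad \alpha_i(v_0)=C_i\ (i=1,2,3),$$ for some $v_0\in I_v$ and constant orthonormal vectors $C_1,C_2,C_3$ in $\mathbb E^3$.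
   Context: Let $I$ be an open interval and $f:I\to\mathbb R$ a smooth nowhere vanishing function. The Robertson-Walker space-time $L^4_1(f,0)$ is $I\times\mathbb E^3$ with metric $\langle\cdot,\cdot\rangle=-dt^2+f(t)^2g_0$, where $g_0$ is the Euclidean metric of $\mathbb E^3$. A surface $M$ in $L^4_1(f,0)$ is space-like if its induced metric is Riemannian; $h$ is its second fundamental form. Write $\frac{\partial}{\partial t}|_M=T+\eta$ with $T$ tangent and $\eta$ normal to $M$. The relative null space at $p\in M$ is $\mathcal N_p=\{X\in T_pM: h_p(X,Y)=0\ \text{for all } Y\in T_pM\}$; $M$ has positive relative nullity if $\dim\mathcal N_p>0$ for all $p\in M$. "Locally congruent" means that every point of $M$ has a neighbourhood which is mapped by an isometry of the ambient space onto an open part of a surface of the given type; parametrizations are understood on domains where they are immersions. Standing assumptions: (i) $\frac{f''(t)}{f(t)}-\frac{f'(t)^2}{f(t)^2}\neq0$ for all $t\in I$; (ii) $T$ does not vanish on $M$; (iii) when $M$ has positive relative nullity, the spaces $\mathcal N_p$ form a smooth 1-dimensional distribution; (iv) $M$ is connected and no open part of $M$ lies in a 3-dimensional totally geodesic hypersurface of $L^4_1(f,0)$. *)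

theory Defs
  imports "HOL-Analysis.Analysis"
begin

text \<open>The first component is the time coordinate \<open>t\<close>.\<close>

type_synonym spacetime = "real \<times> (real^3)"


section \<open>Smooth maps\<close>

text \<open>Continuous partial derivatives of all orders up to \<open>n\<close>; only used for open \<open>S\<close>.\<close>

primrec Ck_on :: "nat \<Rightarrow> 'a::real_normed_vector set \<Rightarrow> ('a \<Rightarrow> 'b::real_normed_vector) \<Rightarrow> bool"
  where
    "Ck_on 0 S f \<longleftrightarrow> continuous_on S f"
  | "Ck_on (Suc n) S f \<longleftrightarrow>
       (\<forall>x\<in>S. f differentiable (at x)) \<and> (\<forall>v. Ck_on n S (\<lambda>x. frechet_derivative f (at x) v))"

definition smooth_on :: "'a::real_normed_vector set \<Rightarrow> ('a \<Rightarrow> 'b::real_normed_vector) \<Rightarrow> bool"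
  where "smooth_on S f \<longleftrightarrow> (\<forall>n. Ck_on n S f)"

definition open_interval :: "real set \<Rightarrow> bool"
  where "open_interval J \<longleftrightarrow> open J \<and> is_interval J \<and> J \<noteq> {}"


section \<open>Pseudo-Riemannian metrics on open subsets of a vector space\<close>

text \<open>
  A metric \<open>g\<close> assigns to a point \<open>p\<close> the scalar product \<open>g p\<close> on the ambient
  vector space, which is the tangent space at every point.

  The Levi-Civita connection is \<open>\<nabla>\<^sub>v Y = D\<^sub>v Y + \<Gamma>\<^sub>p(v, Y)\<close>, where \<open>\<Gamma>\<^sub>p(v, w)\<close> is the
  covariant derivative of the constant field \<open>w\<close> in direction \<open>v\<close>. It is given by the Koszul
  formula, whose bracket terms vanish for constant fields.
\<close>

definition christoffel ::
  "('v::real_normed_vector \<Rightarrow> 'v \<Rightarrow> 'v \<Rightarrow> real) \<Rightarrow> 'v \<Rightarrow> 'v \<Rightarrow> 'v \<Rightarrow> 'v"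
  where "christoffel g p v w = (THE c. \<forall>z.
     2 * g p c z = frechet_derivative (\<lambda>q. g q w z) (at p) v
                 + frechet_derivative (\<lambda>q. g q v z) (at p) w
                 - frechet_derivative (\<lambda>q. g q v w) (at p) z)"

definition isometry_of ::
  "('v::real_normed_vector \<Rightarrow> 'v \<Rightarrow> 'v \<Rightarrow> real) \<Rightarrow> 'v set \<Rightarrow> ('v \<Rightarrow> 'v) \<Rightarrow> bool"
  where "isometry_of g L F \<longleftrightarrow>
     bij_betw F L L \<and> smooth_on L F \<and> smooth_on L (inv_into L F) \<and>
     (\<forall>p\<in>L. \<forall>v w. g (F p) (frechet_derivative F (at p) v) (frechet_derivative F (at p) w) = g p v w)"

text \<open>For a scalar product \<open>b\<close> that is nondegenerate on the subspace \<open>S\<close>, every vector is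
  uniquely the sum of a vector in \<open>S\<close> and a vector \<open>b\<close>-orthogonal to \<open>S\<close>.\<close>

definition nondegenerate_on :: "('v::real_normed_vector \<Rightarrow> 'v \<Rightarrow> real) \<Rightarrow> 'v set \<Rightarrow> bool"
  where "nondegenerate_on b S \<longleftrightarrow> (\<forall>v\<in>S. (\<forall>w\<in>S. b v w = 0) \<longrightarrow> v = 0)"

definition pos_def_on :: "('v::real_normed_vector \<Rightarrow> 'v \<Rightarrow> real) \<Rightarrow> 'v set \<Rightarrow> bool"
  where "pos_def_on b S \<longleftrightarrow> (\<forall>v\<in>S. v \<noteq> 0 \<longrightarrow> b v v > 0)"

definition tangential_part :: "('v::real_normed_vector \<Rightarrow> 'v \<Rightarrow> real) \<Rightarrow> 'v set \<Rightarrow> 'v \<Rightarrow> 'v"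
  where "tangential_part b S v = (THE w. w \<in> S \<and> (\<forall>z\<in>S. b (v - w) z = 0))"

definition normal_part :: "('v::real_normed_vector \<Rightarrow> 'v \<Rightarrow> real) \<Rightarrow> 'v set \<Rightarrow> 'v \<Rightarrow> 'v"
  where "normal_part b S v = v - tangential_part b S v"


section \<open>Immersions and immersed submanifolds\<close>

definition immersion_on ::
  "'e::real_normed_vector set \<Rightarrow> ('e \<Rightarrow> 'v::real_normed_vector) \<Rightarrow> bool"
  where "immersion_on W X \<longleftrightarrow>
     open W \<and> smooth_on W X \<and> (\<forall>x\<in>W. inj (frechet_derivative X (at x)))"

text \<open>
  The second fundamental form at \<open>X x\<close> of an immersion \<open>X\<close>, on the tangent vectors
  \<open>dX\<^sub>x w\<close> and \<open>dX\<^sub>x w'\<close>: the normal part of \<open>\<nabla>\<^bsub>dX w\<^esub> Y\<close>, where \<open>Y = dX w'\<close> is the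
  tangent field along \<open>X\<close> with constant coordinates \<open>w'\<close>.
\<close>

definition second_fundamental_form ::
  "('v::real_normed_vector \<Rightarrow> 'v \<Rightarrow> 'v \<Rightarrow> real) \<Rightarrow> ('e::real_normed_vector \<Rightarrow> 'v) \<Rightarrow> 'e \<Rightarrow> 'e \<Rightarrow> 'e \<Rightarrow> 'v"
  where "second_fundamental_form g X x w w' =
     normal_part (g (X x)) (range (frechet_derivative X (at x)))
       (frechet_derivative (\<lambda>y. frechet_derivative X (at y) w') (at x) w
        + christoffel g (X x) (frechet_derivative X (at x) w) (frechet_derivative X (at x) w'))"

text \<open>
  An immersed submanifold is a topological space \<open>M\<close> (a set with its subspace topology)
  together with a map \<open>\<psi>\<close> into the ambient vector space. The smooth structure of \<open>M\<close> is the unique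
  one that makes \<open>\<psi>\<close> an immersion, so a local parametrization of \<open>M\<close> is a
  homeomorphism \<open>\<sigma>\<close> from an open set of the model space onto an open subset of \<open>M\<close> such that
  \<open>\<psi> \<circ> \<sigma>\<close> is an immersion. Embedded submanifolds are the case of the inclusion \<open>\<psi> = id\<close>.
\<close>

definition local_param ::
  "'m::topological_space set \<Rightarrow> ('m \<Rightarrow> 'v::real_normed_vector) \<Rightarrow>
   'e::real_normed_vector set \<Rightarrow> ('e \<Rightarrow> 'm) \<Rightarrow> bool"
  where "local_param M \<psi> W \<sigma> \<longleftrightarrow>
     openin (top_of_set M) (\<sigma> ` W) \<and> (\<exists>\<tau>. homeomorphism W (\<sigma> ` W) \<sigma> \<tau>) \<and> immersion_on W (\<psi> \<circ> \<sigma>)"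

definition immersed_surface ::
  "'v::real_normed_vector set \<Rightarrow> 'm::topological_space set \<Rightarrow> ('m \<Rightarrow> 'v) \<Rightarrow> bool"
  where "immersed_surface L M \<psi> \<longleftrightarrow>
     \<psi> ` M \<subseteq> L \<and>
     (\<forall>p\<in>M. \<exists>(W :: (real \<times> real) set) \<sigma>. local_param M \<psi> W \<sigma> \<and> p \<in> \<sigma> ` W)"

text \<open>Tangent planes are regarded as subspaces of the ambient vector space; they do not depend
  on the local parametrization, and neither do the relative null spaces below.\<close>

definition tangent_plane ::
  "'m::topological_space set \<Rightarrow> ('m \<Rightarrow> 'v::real_normed_vector) \<Rightarrow> 'm \<Rightarrow> 'v set"
  where "tangent_plane M \<psi> p =
     {frechet_derivative (\<psi> \<circ> \<sigma>) (at x) w | (W :: (real \<times> real) set) \<sigma> x w.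
        local_param M \<psi> W \<sigma> \<and> x \<in> W \<and> \<sigma> x = p}"

definition spacelike_surface ::
  "('v::real_normed_vector \<Rightarrow> 'v \<Rightarrow> 'v \<Rightarrow> real) \<Rightarrow> 'v set \<Rightarrow> 'm::topological_space set \<Rightarrow> ('m \<Rightarrow> 'v) \<Rightarrow> bool"
  where "spacelike_surface g L M \<psi> \<longleftrightarrow>
     immersed_surface L M \<psi> \<and> (\<forall>p\<in>M. pos_def_on (g (\<psi> p)) (tangent_plane M \<psi> p))"

definition relative_null_space ::
  "('v::real_normed_vector \<Rightarrow> 'v \<Rightarrow> 'v \<Rightarrow> real) \<Rightarrow> 'm::topological_space set \<Rightarrow> ('m \<Rightarrow> 'v) \<Rightarrow> 'm \<Rightarrow> 'v set"
  where "relative_null_space g M \<psi> p =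
     {frechet_derivative (\<psi> \<circ> \<sigma>) (at x) w | (W :: (real \<times> real) set) \<sigma> x w.
        local_param M \<psi> W \<sigma> \<and> x \<in> W \<and> \<sigma> x = p \<and>
        (\<forall>w'. second_fundamental_form g (\<psi> \<circ> \<sigma>) x w w' = 0)}"

definition positive_relative_nullity ::
  "('v::real_normed_vector \<Rightarrow> 'v \<Rightarrow> 'v \<Rightarrow> real) \<Rightarrow> 'm::topological_space set \<Rightarrow> ('m \<Rightarrow> 'v) \<Rightarrow> bool"
  where "positive_relative_nullity g M \<psi> \<longleftrightarrow> (\<forall>p\<in>M. dim (relative_null_space g M \<psi> p) > 0)"

definition smooth_line_distribution ::
  "'m::topological_space set \<Rightarrow> ('m \<Rightarrow> 'v::real_normed_vector) \<Rightarrow> ('m \<Rightarrow> 'v set) \<Rightarrow> bool"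
  where "smooth_line_distribution M \<psi> N \<longleftrightarrow>
     (\<forall>p\<in>M. \<exists>(W :: (real \<times> real) set) \<sigma> Z.
        local_param M \<psi> W \<sigma> \<and> p \<in> \<sigma> ` W \<and> smooth_on W Z \<and>
        (\<forall>x\<in>W. Z x \<noteq> 0 \<and> Z x \<in> tangent_plane M \<psi> (\<sigma> x) \<and> N (\<sigma> x) = span {Z x}))"

definition totally_geodesic_hypersurface ::
  "(spacetime \<Rightarrow> spacetime \<Rightarrow> spacetime \<Rightarrow> real) \<Rightarrow> spacetime set \<Rightarrow> spacetime set \<Rightarrow> bool"
  where "totally_geodesic_hypersurface g L H \<longleftrightarrow>
     H \<subseteq> L \<and>
     (\<forall>q\<in>H. \<exists>(W :: (real^3) set) \<sigma>. local_param H id W \<sigma> \<and> q \<in> \<sigma> ` W \<and>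
        (\<forall>x\<in>W. nondegenerate_on (g (\<sigma> x)) (range (frechet_derivative \<sigma> (at x))) \<and>
               (\<forall>w w'. second_fundamental_form g \<sigma> x w w' = 0)))"

text \<open>
  \<open>P D \<phi>\<close> says that the parametrized surface \<open>\<phi>\<close> with domain \<open>D\<close> is of the given
  type. Its open parts are the restrictions of \<open>\<phi>\<close> to open subsets \<open>W\<close> of \<open>D\<close>. As \<open>\<psi>\<close> and \<open>\<phi>\<close>
  need not be injective, that \<open>F\<close> maps \<open>U\<close> onto such a part is witnessed by a homeomorphism of
  the parameter spaces; it is automatically a local parametrization of \<open>M\<close>.
\<close>

definition locally_congruent ::
  "('v::real_normed_vector \<Rightarrow> 'v \<Rightarrow> 'v \<Rightarrow> real) \<Rightarrow> 'v set \<Rightarrow> 'm::topological_space set \<Rightarrow> ('m \<Rightarrow> 'v) \<Rightarrow>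
   ((real \<times> real) set \<Rightarrow> (real \<times> real \<Rightarrow> 'v) \<Rightarrow> bool) \<Rightarrow> bool"
  where "locally_congruent g L M \<psi> P \<longleftrightarrow>
     (\<forall>p\<in>M. \<exists>U F D \<phi> W \<sigma> \<tau>.
        openin (top_of_set M) U \<and> p \<in> U \<and> isometry_of g L F \<and>
        P D \<phi> \<and> open W \<and> W \<subseteq> D \<and>
        homeomorphism W U \<sigma> \<tau> \<and> (\<forall>x\<in>W. F (\<psi> (\<sigma> x)) = \<phi> x))"


section \<open>Robertson-Walker space-times with flat fibre\<close>

definition rw_space :: "real set \<Rightarrow> spacetime set"
  where "rw_space I = I \<times> UNIV"

definition rw_metric ::
  "(real \<Rightarrow> real) \<Rightarrow> spacetime \<Rightarrow> spacetime \<Rightarrow> spacetime \<Rightarrow> real"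
  where "rw_metric f p v w = - (fst v * fst w) + (f (fst p))\<^sup>2 * (snd v \<bullet> snd w)"

definition time_field :: "spacetime"
  where "time_field = (1, 0)"

text \<open>The tangential part \<open>T\<close> of the vector field \<open>\<partial>/\<partial>t\<close> along \<open>M\<close>.\<close>

definition time_tangential ::
  "(real \<Rightarrow> real) \<Rightarrow> 'm::topological_space set \<Rightarrow> ('m \<Rightarrow> spacetime) \<Rightarrow> 'm \<Rightarrow> spacetime"
  where "time_tangential f M \<psi> p =
     tangential_part (rw_metric f (\<psi> p)) (tangent_plane M \<psi> p) time_field"

text \<open>The domain \<open>D\<close> is an open part of \<open>Iu \<times> Iv\<close> on which the parametrization is an
  immersion. The interval integral is oriented, so \<open>u < u0\<close> is allowed.\<close>

definition nullity_surface ::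
  "(real \<Rightarrow> real) \<Rightarrow> real set \<Rightarrow> (real \<times> real) set \<Rightarrow> (real \<times> real \<Rightarrow> spacetime) \<Rightarrow> bool"
  where "nullity_surface f I D \<phi> \<longleftrightarrow>
    (\<exists>Iu Iv u0 v0 a
       (a1 :: real \<Rightarrow> real) (a2 :: real \<Rightarrow> real)
       (\<phi>1 :: real \<Rightarrow> real) (\<phi>2 :: real \<Rightarrow> real) (\<phi>3 :: real \<Rightarrow> real)
       (\<alpha>1 :: real \<Rightarrow> real^3) (\<alpha>2 :: real \<Rightarrow> real^3) (\<alpha>3 :: real \<Rightarrow> real^3)
       (C1 :: real^3) (C2 :: real^3) (C3 :: real^3).
       open_interval Iu \<and> Iu \<subseteq> I \<and> open_interval Iv \<and> u0 \<in> Iu \<and> v0 \<in> Iv \<and>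
       (\<forall>u\<in>Iu. a\<^sup>2 - (f u)\<^sup>2 > 0) \<and>
       smooth_on Iv a1 \<and> smooth_on Iv a2 \<and>
       smooth_on Iv \<phi>1 \<and> smooth_on Iv \<phi>2 \<and> smooth_on Iv \<phi>3 \<and>
       smooth_on Iv \<alpha>1 \<and> smooth_on Iv \<alpha>2 \<and> smooth_on Iv \<alpha>3 \<and>
       (\<forall>v\<in>Iv. (\<phi>2 has_real_derivative - a1 v * \<phi>1 v) (at v)) \<and>
       (\<forall>v\<in>Iv. (\<phi>3 has_real_derivative - a2 v * \<phi>1 v) (at v)) \<and>
       (\<forall>v\<in>Iv. (\<alpha>1 has_vector_derivative a1 v *\<^sub>R \<alpha>2 v + a2 v *\<^sub>R \<alpha>3 v) (at v)) \<and>
       (\<forall>v\<in>Iv. (\<alpha>2 has_vector_derivative - a1 v *\<^sub>R \<alpha>1 v) (at v)) \<and>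
       (\<forall>v\<in>Iv. (\<alpha>3 has_vector_derivative - a2 v *\<^sub>R \<alpha>1 v) (at v)) \<and>
       \<alpha>1 v0 = C1 \<and> \<alpha>2 v0 = C2 \<and> \<alpha>3 v0 = C3 \<and>
       norm C1 = 1 \<and> norm C2 = 1 \<and> norm C3 = 1 \<and>
       C1 \<bullet> C2 = 0 \<and> C1 \<bullet> C3 = 0 \<and> C2 \<bullet> C3 = 0 \<and>
       D \<subseteq> Iu \<times> Iv \<and>
       (\<forall>(u, v)\<in>D. \<phi> (u, v) =
          (u, \<phi>1 v *\<^sub>R \<alpha>1 v
              + ((LBINT s=u0..u. a / (f s * sqrt (a\<^sup>2 - (f s)\<^sup>2))) + \<phi>2 v) *\<^sub>R \<alpha>2 v
              + \<phi>3 v *\<^sub>R \<alpha>3 v)) \<and>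
       immersion_on D \<phi> \<and>
       (\<forall>x\<in>D. pos_def_on (rw_metric f (\<phi> x)) (range (frechet_derivative \<phi> (at x)))))"

end

theory Submission
  imports Defs
begin

text \<open>
  Write the surface as \<open>X = (t, x)\<close> with \<open>x\<close> in Euclidean 3-space. The components of the second
  fundamental form of \<open>X\<close> orthogonal to \<open>\<partial>\<^sub>t\<close> are those of the Euclidean surface \<open>x\<close>, so a null field
  makes \<open>x\<close> flat, and by the Codazzi equation its integral curves are straight lines in Euclidean
  space unless an open part of \<open>M\<close> lies in a totally geodesic \<open>I \<times> plane\<close>. Hence
  \<open>x = r \<zeta>(v) + \<beta>(v)\<close> with \<open>\<partial>\<^sub>r\<close> null. The remaining equations say that
  \<open>t\<^sub>r\<^sub>r = 2 (f'/f) t\<^sub>r\<^sup>2 - f f'\<close> and, for the derivative \<open>s\<close> of \<open>t\<close> in the direction orthogonal to the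
  lines, that \<open>s\<^sub>r\<close> is a known multiple of \<open>s\<close>. The integrability condition is
  \<open>s (f f'' - f'\<^sup>2) = 0\<close>, so \<open>s = 0\<close>. Then \<open>t\<^sub>r\<^sup>2 / f\<^sup>4 - 1 / f\<^sup>2\<close> is a negative constant \<open>- 1 / a\<^sup>2\<close>, and
  in the coordinates \<open>(t, v)\<close> the surface has the required form without any isometry being applied.
  Conversely \<open>\<partial>\<^sub>u\<close> is a null direction of the given parametrization, and isometries preserve null
  directions by the Koszul formula.
\<close>

section \<open>Calculus of smooth maps\<close>

text \<open>The geometric notions quantify over all local parametrizations and use definite
  descriptions. A null direction is therefore recast as \<open>null_dir\<close>: every covariant
  derivative in that direction is tangent. This involves no projection, survives a change of
  parameters and is reflected by isometries. Where the direction of the null lines turns along them,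
  the Codazzi equation makes its derivative a second null direction of the Euclidean surface,
  orthogonal to the first. The Euclidean second fundamental form then vanishes there, which produces
  the excluded plane. The integrability condition comes from computing the second r-derivative of s
  twice: from its own linear equation, and by differentiating the equation for t_rr across the
  lines. The first integral comes from w = t_r / f^2: the equation becomes w_r = - f' / f, hence
  (w^2)_r = (1 / f^2)_r. Its value is negative because the null lines are space-like, and the sign
  of a is that of f t_r. Since s = 0, level curves of the time are orthogonal to the null lines.
  Their unit tangent is \<alpha>1 and the line direction is \<alpha>2, which gives the structure
  equations their special form.\<close>

abbreviation dd :: "('a::real_normed_vector \<Rightarrow> 'b::real_normed_vector) \<Rightarrow> 'a \<Rightarrow> 'a \<Rightarrow> 'b"
  where "dd f x \<equiv> frechet_derivative f (at x)"

lemma dd_eqI: "(f has_derivative f') (at x) \<Longrightarrow> dd f x = f'"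
  by (rule frechet_derivative_at[symmetric])

lemma dd_works: "f differentiable (at x) \<Longrightarrow> (f has_derivative dd f x) (at x)"
  by (simp add: frechet_derivative_works)

lemma dd_cong:
  assumes "open S" "x \<in> S" "\<And>y. y \<in> S \<Longrightarrow> f y = g y" "f differentiable (at x)"
  shows "dd f x = dd g x" "g differentiable (at x)"
proof -
  show "dd f x = dd g x"
    using assms by (intro frechet_derivative_transform_within_open) auto
  show "g differentiable (at x)"
    using has_derivative_transform_within_open[OF dd_works[OF assms(4)] assms(1,2), of g] assms(3)
    unfolding differentiable_def by blast
qed

lemma Ck_on_cong:
  assumes "open S" "\<And>x. x \<in> S \<Longrightarrow> f x = g x" "Ck_on n S f"
  shows "Ck_on n S g"
  using assms(2,3)
proof (induction n arbitrary: f g)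
  case 0
  then show ?case using continuous_on_eq[of S f g] by simp
next
  case (Suc n)
  have d: "f differentiable (at x)" if "x \<in> S" for x
    using Suc.prems that by simp
  show ?case
    unfolding Ck_on.simps
  proof (intro conjI ballI allI)
    show "g differentiable (at x)" if "x \<in> S" for x
      by (rule dd_cong(2)[OF assms(1) that, of f]) (use Suc.prems(1) d that in simp_all)
    show "Ck_on n S (\<lambda>x. dd g x v)" for v
    proof (rule Suc.IH)
      show "dd f x v = dd g x v" if "x \<in> S" for x
        by (subst dd_cong(1)[OF assms(1) that, of f g]) (use Suc.prems(1) d that in simp_all)
      show "Ck_on n S (\<lambda>x. dd f x v)" using Suc.prems by simp
    qed
  qed
qed

lemma Ck_on_subset: "Ck_on n S f \<Longrightarrow> T \<subseteq> S \<Longrightarrow> Ck_on n T f"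
  by (induction n arbitrary: f) (auto intro: continuous_on_subset)

lemma Ck_on_SucD: "Ck_on (Suc n) S f \<Longrightarrow> Ck_on n S f"
proof (induction n arbitrary: f)
  case 0
  then show ?case
    by (auto intro!: continuous_at_imp_continuous_on differentiable_imp_continuous_within)
next
  case (Suc n)
  then show ?case by (subst Ck_on.simps) (auto simp del: Ck_on.simps(1) simp: Ck_on.simps(2)[of "Suc n"])
qed

lemma Ck_on_const: "Ck_on n S (\<lambda>x. c)"
  by (induction n arbitrary: c) (auto simp: frechet_derivative_const)

lemma Ck_on_bounded_linear_apply:
  assumes "bounded_linear L"
  shows "Ck_on n S L"
proof (cases n)
  case 0
  then show ?thesis using assms by (simp add: linear_continuous_on)
next
  case (Suc m)
  have "dd L x = L" for x
    using assms by (intro dd_eqI) (rule bounded_linear_imp_has_derivative)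
  then show ?thesis
    using Suc assms by (auto simp: Ck_on_const bounded_linear_imp_differentiable)
qed

lemma dd_bounded_linear:
  assumes "bounded_linear L" "f differentiable (at x)"
  shows "dd (\<lambda>x. L (f x)) x = (\<lambda>v. L (dd f x v))" "(\<lambda>x. L (f x)) differentiable (at x)"
proof -
  have "((\<lambda>x. L (f x)) has_derivative (\<lambda>v. L (dd f x v))) (at x)"
    by (rule bounded_linear.has_derivative[OF assms(1) dd_works[OF assms(2)]])
  then show "dd (\<lambda>x. L (f x)) x = (\<lambda>v. L (dd f x v))" "(\<lambda>x. L (f x)) differentiable (at x)"
    by (auto intro: dd_eqI simp: differentiable_def)
qed

lemma Ck_on_bounded_linear:
  assumes "bounded_linear L" "open S"
  shows "Ck_on n S f \<Longrightarrow> Ck_on n S (\<lambda>x. L (f x))"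
proof (induction n arbitrary: f)
  case 0
  then show ?case using bounded_linear.continuous_on[OF assms(1)] by simp
next
  case (Suc n)
  show ?case
    unfolding Ck_on.simps
  proof (intro conjI ballI allI)
    show "(\<lambda>x. L (f x)) differentiable (at x)" if "x \<in> S" for x
      using dd_bounded_linear(2)[OF assms(1), of f x] Suc.prems that by simp
    show "Ck_on n S (\<lambda>x. dd (\<lambda>x. L (f x)) x v)" for v
    proof (rule Ck_on_cong[OF assms(2)])
      show "L (dd f x v) = dd (\<lambda>x. L (f x)) x v" if "x \<in> S" for x
        using dd_bounded_linear(1)[OF assms(1), of f x] Suc.prems that by simp
      show "Ck_on n S (\<lambda>x. L (dd f x v))"
        using Suc.prems by (intro Suc.IH) simp
    qed
  qed
qed

lemma dd_add:
  assumes "f differentiable (at x)" "g differentiable (at x)"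
  shows "dd (\<lambda>x. f x + g x) x = (\<lambda>v. dd f x v + dd g x v)"
  by (intro dd_eqI has_derivative_add dd_works assms)

lemma dd_diff:
  assumes "f differentiable (at x)" "g differentiable (at x)"
  shows "dd (\<lambda>x. f x - g x) x = (\<lambda>v. dd f x v - dd g x v)"
  by (intro dd_eqI has_derivative_diff dd_works assms)

lemma Ck_on_add:
  assumes "open S"
  shows "Ck_on n S f \<Longrightarrow> Ck_on n S g \<Longrightarrow> Ck_on n S (\<lambda>x. f x + g x)"
proof (induction n arbitrary: f g)
  case 0
  then show ?case by (simp add: continuous_on_add)
next
  case (Suc n)
  show ?case
    unfolding Ck_on.simps
  proof (intro conjI ballI allI)
    show "(\<lambda>x. f x + g x) differentiable (at x)" if "x \<in> S" for x
      using Suc.prems that by auto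
    show "Ck_on n S (\<lambda>x. dd (\<lambda>x. f x + g x) x v)" for v
    proof (rule Ck_on_cong[OF assms])
      show "dd f x v + dd g x v = dd (\<lambda>x. f x + g x) x v" if "x \<in> S" for x
        using dd_add[of f x g] Suc.prems that by simp
      show "Ck_on n S (\<lambda>x. dd f x v + dd g x v)"
        using Suc.prems by (intro Suc.IH) auto
    qed
  qed
qed

lemma dd_bounded_bilinear:
  assumes "bounded_bilinear B" "f differentiable (at x)" "g differentiable (at x)"
  shows "dd (\<lambda>x. B (f x) (g x)) x = (\<lambda>v. B (f x) (dd g x v) + B (dd f x v) (g x))"
    "(\<lambda>x. B (f x) (g x)) differentiable (at x)"
proof -
  have "((\<lambda>x. B (f x) (g x)) has_derivative (\<lambda>v. B (f x) (dd g x v) + B (dd f x v) (g x))) (at x)"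
    by (rule bounded_bilinear.FDERIV[OF assms(1) dd_works[OF assms(2)] dd_works[OF assms(3)]])
  then show "dd (\<lambda>x. B (f x) (g x)) x = (\<lambda>v. B (f x) (dd g x v) + B (dd f x v) (g x))"
    "(\<lambda>x. B (f x) (g x)) differentiable (at x)"
    by (auto intro: dd_eqI simp: differentiable_def)
qed

lemma Ck_on_bounded_bilinear:
  assumes "bounded_bilinear B" "open S"
  shows "Ck_on n S f \<Longrightarrow> Ck_on n S g \<Longrightarrow> Ck_on n S (\<lambda>x. B (f x) (g x))"
proof (induction n arbitrary: f g)
  case 0
  then show ?case using bounded_bilinear.continuous_on[OF assms(1)] by simp
next
  case (Suc n)
  have n: "Ck_on n S f" "Ck_on n S g"
    using Suc.prems Ck_on_SucD by blast+
  show ?case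
    unfolding Ck_on.simps
  proof (intro conjI ballI allI)
    show "(\<lambda>x. B (f x) (g x)) differentiable (at x)" if "x \<in> S" for x
      using dd_bounded_bilinear(2)[OF assms(1), of f x g] Suc.prems that by simp
    show "Ck_on n S (\<lambda>x. dd (\<lambda>x. B (f x) (g x)) x v)" for v
    proof (rule Ck_on_cong[OF assms(2)])
      show "B (f x) (dd g x v) + B (dd f x v) (g x) = dd (\<lambda>x. B (f x) (g x)) x v" if "x \<in> S" for x
        using dd_bounded_bilinear(1)[OF assms(1), of f x g] Suc.prems that by simp
      show "Ck_on n S (\<lambda>x. B (f x) (dd g x v) + B (dd f x v) (g x))"
        using Suc n by (intro Ck_on_add assms Suc.IH) auto
    qed
  qed
qed

lemma dd_compose:
  assumes "f differentiable (at x)" "g differentiable (at (f x))"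
  shows "dd (\<lambda>x. g (f x)) x = (\<lambda>v. dd g (f x) (dd f x v))" "(\<lambda>x. g (f x)) differentiable (at x)"
proof -
  have "((\<lambda>x. g (f x)) has_derivative (\<lambda>v. dd g (f x) (dd f x v))) (at x)"
    by (rule has_derivative_compose[OF dd_works[OF assms(1)] dd_works[OF assms(2)]])
  then show "dd (\<lambda>x. g (f x)) x = (\<lambda>v. dd g (f x) (dd f x v))" "(\<lambda>x. g (f x)) differentiable (at x)"
    by (auto intro: dd_eqI simp: differentiable_def)
qed

lemma dd_linear: "f differentiable (at x) \<Longrightarrow> linear (dd f x)"
  by (rule linear_frechet_derivative)

lemma Ck_on_sum:
  assumes "open S"
  shows "finite A \<Longrightarrow> (\<And>i. i \<in> A \<Longrightarrow> Ck_on n S (f i)) \<Longrightarrow> Ck_on n S (\<lambda>x. \<Sum>i\<in>A. f i x)"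
  by (induction rule: finite_induct) (auto intro: Ck_on_const Ck_on_add[OF assms])

text \<open>The chain rule evaluates the derivative of \<open>g\<close> in the direction
  \<open>dd f x v\<close>, which moves with \<open>x\<close>, whereas \<open>Ck_on\<close> speaks of
  fixed directions. Expanding the moving direction in \<open>Basis\<close> restores fixed ones;
  hence the Euclidean space in the middle.\<close>

lemma Ck_on_compose:
  fixes f :: "'a::real_normed_vector \<Rightarrow> 'b::euclidean_space" and g :: "'b \<Rightarrow> 'c::real_normed_vector"
  assumes "open S" "f ` S \<subseteq> T"
  shows "Ck_on n S f \<Longrightarrow> Ck_on n T g \<Longrightarrow> Ck_on n S (\<lambda>x. g (f x))"
proof (induction n arbitrary: g)
  case 0
  then show ?case using continuous_on_compose2[of T g S f] assms(2) by simp
next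
  case (Suc n)
  have n: "Ck_on n S f"
    using Suc.prems Ck_on_SucD by blast
  have d: "f differentiable (at x)" "g differentiable (at (f x))" if "x \<in> S" for x
    using Suc.prems assms(2) that by auto
  show ?case
    unfolding Ck_on.simps
  proof (intro conjI ballI allI)
    show "(\<lambda>x. g (f x)) differentiable (at x)" if "x \<in> S" for x
      using dd_compose(2) d that by blast
    show "Ck_on n S (\<lambda>x. dd (\<lambda>x. g (f x)) x v)" for v
    proof (rule Ck_on_cong[OF assms(1)])
      show "(\<Sum>b\<in>Basis. (dd f x v \<bullet> b) *\<^sub>R dd g (f x) b) = dd (\<lambda>x. g (f x)) x v" if "x \<in> S" for x
      proof -
        have "dd g (f x) (dd f x v) = dd g (f x) (\<Sum>b\<in>Basis. (dd f x v \<bullet> b) *\<^sub>R b)"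
          by (simp add: euclidean_representation)
        also have "\<dots> = (\<Sum>b\<in>Basis. (dd f x v \<bullet> b) *\<^sub>R dd g (f x) b)"
          using dd_linear[OF d(2)[OF that]] by (simp add: linear_sum linear_cmul o_def)
        finally show ?thesis using dd_compose(1)[OF d[OF that]] by simp
      qed
      show "Ck_on n S (\<lambda>x. \<Sum>b\<in>Basis. (dd f x v \<bullet> b) *\<^sub>R dd g (f x) b)"
        using Suc n
        by (intro Ck_on_sum assms(1) Ck_on_bounded_bilinear[OF bounded_bilinear_scaleR]
            Ck_on_bounded_linear[OF bounded_linear_inner_left] Suc.IH) auto
    qed
  qed
qed

text \<open>The derivative is a polynomial in \<open>inverse\<close> itself, so the induction
  hypothesis already controls it.\<close>

lemma Ck_on_inverse_real: "Ck_on n (- {0::real}) inverse"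
proof (induction n)
  case 0
  then show ?case by (simp add: continuous_on_inverse continuous_on_id)
next
  case (Suc n)
  have d: "(inverse has_derivative (\<lambda>v. - (inverse x * v * inverse x))) (at x)" if "x \<noteq> 0" for x :: real
    using that by (rule has_derivative_inverse')
  show ?case
    unfolding Ck_on.simps
  proof (intro conjI ballI allI)
    show "(inverse :: real \<Rightarrow> real) differentiable (at x)" if "x \<in> - {0}" for x
      using that d by (auto simp: differentiable_def)
    show "Ck_on n (- {0}) (\<lambda>x. dd inverse x v)" for v :: real
    proof (rule Ck_on_cong)
      show "(- v) * (inverse x * inverse x) = dd inverse x v" if "x \<in> - {0}" for x
        using that d dd_eqI[OF d, of x] by auto
      show "Ck_on n (- {0}) (\<lambda>x. (- v) * (inverse x * inverse x))"
        using Suc by (intro Ck_on_bounded_bilinear[OF bounded_bilinear_mult] Ck_on_const) auto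
    qed auto
  qed
qed

lemma Ck_on_sqrt: "Ck_on n {0::real<..} sqrt"
proof (induction n)
  case 0
  then show ?case by (simp add: continuous_on_real_sqrt continuous_on_id)
next
  case (Suc n)
  have d: "(sqrt has_derivative (\<lambda>v. v * (inverse (sqrt x) / 2))) (at x)" if "x > 0" for x :: real
    using DERIV_real_sqrt[OF that] unfolding has_field_derivative_def
    by (rule has_derivative_eq_rhs) (simp add: fun_eq_iff)
  show ?case
    unfolding Ck_on.simps
  proof (intro conjI ballI allI)
    show "sqrt differentiable (at x)" if "x \<in> {0<..}" for x
      using that d by (auto simp: differentiable_def)
    show "Ck_on n {0<..} (\<lambda>x. dd sqrt x v)" for v :: real
    proof (rule Ck_on_cong)
      show "(v / 2) * inverse (sqrt x) = dd sqrt x v" if "x \<in> {0<..}" for x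
        using that d dd_eqI[OF d, of x] by auto
      show "Ck_on n {0<..} (\<lambda>x. (v / 2) * inverse (sqrt x))"
        by (intro Ck_on_bounded_bilinear[OF bounded_bilinear_mult] Ck_on_const
            Ck_on_compose[OF _ _ Suc Ck_on_inverse_real]) auto
    qed auto
  qed
qed

lemma smooth_on_subset: "smooth_on S f \<Longrightarrow> T \<subseteq> S \<Longrightarrow> smooth_on T f"
  unfolding smooth_on_def using Ck_on_subset by blast

lemma smooth_on_cong: "open S \<Longrightarrow> (\<And>x. x \<in> S \<Longrightarrow> f x = g x) \<Longrightarrow> smooth_on S f \<Longrightarrow> smooth_on S g"
  unfolding smooth_on_def using Ck_on_cong by blast

lemma smooth_on_differentiable: "smooth_on S f \<Longrightarrow> x \<in> S \<Longrightarrow> f differentiable (at x)"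
  unfolding smooth_on_def using Ck_on.simps(2) by blast

lemma smooth_on_continuous: "smooth_on S f \<Longrightarrow> continuous_on S f"
  unfolding smooth_on_def using Ck_on.simps(1) by blast

lemma smooth_on_dd: "smooth_on S f \<Longrightarrow> smooth_on S (\<lambda>x. dd f x v)"
  unfolding smooth_on_def using Ck_on.simps(2) by blast

lemma smooth_on_const: "smooth_on S (\<lambda>x. c)"
  unfolding smooth_on_def by (simp add: Ck_on_const)

lemma smooth_on_ident: "smooth_on S (\<lambda>x. x)"
  unfolding smooth_on_def using Ck_on_bounded_linear_apply[OF bounded_linear_ident] by blast

lemma smooth_on_bounded_linear:
  "bounded_linear L \<Longrightarrow> open S \<Longrightarrow> smooth_on S f \<Longrightarrow> smooth_on S (\<lambda>x. L (f x))"
  unfolding smooth_on_def using Ck_on_bounded_linear by blast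

lemma smooth_on_bounded_bilinear:
  "bounded_bilinear B \<Longrightarrow> open S \<Longrightarrow> smooth_on S f \<Longrightarrow> smooth_on S g \<Longrightarrow> smooth_on S (\<lambda>x. B (f x) (g x))"
  unfolding smooth_on_def using Ck_on_bounded_bilinear by blast

lemma smooth_on_add: "open S \<Longrightarrow> smooth_on S f \<Longrightarrow> smooth_on S g \<Longrightarrow> smooth_on S (\<lambda>x. f x + g x)"
  unfolding smooth_on_def using Ck_on_add by blast

lemma smooth_on_minus: "open S \<Longrightarrow> smooth_on S f \<Longrightarrow> smooth_on S (\<lambda>x. - f x)"
  by (rule smooth_on_bounded_linear[OF bounded_linear_minus[OF bounded_linear_ident]])

lemma smooth_on_diff: "open S \<Longrightarrow> smooth_on S f \<Longrightarrow> smooth_on S g \<Longrightarrow> smooth_on S (\<lambda>x. f x - g x)"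
  using smooth_on_add[of S f "\<lambda>x. - g x"] smooth_on_minus by auto

lemmas smooth_on_scaleR = smooth_on_bounded_bilinear[OF bounded_bilinear_scaleR]
lemmas smooth_on_inner = smooth_on_bounded_bilinear[OF bounded_bilinear_inner]
lemmas smooth_on_mult = smooth_on_bounded_bilinear[OF bounded_bilinear_mult]
lemmas smooth_on_fst = smooth_on_bounded_linear[OF bounded_linear_fst]
lemmas smooth_on_snd = smooth_on_bounded_linear[OF bounded_linear_snd]

lemma smooth_on_Pair:
  assumes "open S" "smooth_on S f" "smooth_on S g"
  shows "smooth_on S (\<lambda>x. (f x, g x))"
proof -
  have "bounded_linear (\<lambda>x. (x, 0))" "bounded_linear (\<lambda>x. (0, x))"
    by (auto intro!: bounded_linear_Pair bounded_linear_ident bounded_linear_zero)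
  from smooth_on_bounded_linear[OF this(1) assms(1,2)] smooth_on_bounded_linear[OF this(2) assms(1,3)]
  show ?thesis using smooth_on_add[OF assms(1)] by fastforce
qed

lemma smooth_on_compose:
  fixes f :: "'a::real_normed_vector \<Rightarrow> 'b::euclidean_space" and g :: "'b \<Rightarrow> 'c::real_normed_vector"
  shows "open S \<Longrightarrow> f ` S \<subseteq> T \<Longrightarrow> smooth_on S f \<Longrightarrow> smooth_on T g \<Longrightarrow> smooth_on S (\<lambda>x. g (f x))"
  unfolding smooth_on_def using Ck_on_compose by blast

lemma smooth_on_inverse:
  assumes "open S" "\<And>x. x \<in> S \<Longrightarrow> f x \<noteq> 0" "smooth_on S f"
  shows "smooth_on S (\<lambda>x. inverse (f x :: real))"
  by (rule smooth_on_compose[OF assms(1) _ assms(3), of "- {0}"])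
     (use assms(2) in \<open>auto simp: smooth_on_def Ck_on_inverse_real\<close>)

lemma smooth_on_divide:
  assumes "open S" "\<And>x. x \<in> S \<Longrightarrow> g x \<noteq> 0" "smooth_on S f" "smooth_on S g"
  shows "smooth_on S (\<lambda>x. f x / g x :: real)"
  unfolding divide_inverse by (intro smooth_on_mult smooth_on_inverse assms)

lemma smooth_on_norm:
  fixes f :: "'a::real_normed_vector \<Rightarrow> 'b::real_inner"
  assumes "open S" "\<And>x. x \<in> S \<Longrightarrow> f x \<noteq> 0" "smooth_on S f"
  shows "smooth_on S (\<lambda>x. norm (f x))"
  unfolding norm_eq_sqrt_inner
  by (rule smooth_on_compose[OF assms(1), of _ "{0<..}" sqrt])
     (use assms in \<open>auto simp: smooth_on_def Ck_on_sqrt intro!: Ck_on_bounded_bilinear[OF bounded_bilinear_inner]\<close>)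

section \<open>Symmetry of second derivatives\<close>

lemma second_difference:
  fixes f :: "'a::real_normed_vector \<Rightarrow> real"
  assumes "Ck_on 2 S f" "0 < h" "cball x (h * (norm v + norm w)) \<subseteq> S"
  shows "\<exists>y\<in>cball x (h * (norm v + norm w)).
    f (x + h *\<^sub>R v + h *\<^sub>R w) - f (x + h *\<^sub>R v) - f (x + h *\<^sub>R w) + f x = h\<^sup>2 * dd (\<lambda>y. dd f y v) y w"
proof -
  let ?C = "cball x (h * (norm v + norm w))"
  have mem: "x + a *\<^sub>R v + b *\<^sub>R w \<in> ?C" if "0 \<le> a" "a \<le> h" "0 \<le> b" "b \<le> h" for a b
  proof -
    have "norm (a *\<^sub>R v + b *\<^sub>R w) \<le> a * norm v + b * norm w"
      using that norm_triangle_ineq[of "a *\<^sub>R v" "b *\<^sub>R w"] by simp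
    also have "\<dots> \<le> h * norm v + h * norm w"
      using that by (intro add_mono mult_right_mono) auto
    finally show ?thesis
      by (simp add: dist_norm algebra_simps norm_minus_commute)
  qed
  have d: "f differentiable (at y)" "(\<lambda>y. dd f y v) differentiable (at y)" if "y \<in> ?C" for y
    using assms(1,3) that by (auto simp: numeral_2_eq_2)
  have 1: "((\<lambda>a. f (x + a *\<^sub>R v + b *\<^sub>R w)) has_real_derivative dd f (x + a *\<^sub>R v + b *\<^sub>R w) v) (at a)"
    if "0 \<le> a" "a \<le> h" "0 \<le> b" "b \<le> h" for a b
  proof -
    have "((\<lambda>a. x + a *\<^sub>R v + b *\<^sub>R w) has_derivative (\<lambda>k. k *\<^sub>R v)) (at a)"
      by (auto intro!: derivative_eq_intros)
    from has_derivative_compose[OF this dd_works[OF d(1)[OF mem[OF that]]]]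
    show ?thesis
      using linear_cmul[OF dd_linear[OF d(1)[OF mem[OF that]]]]
      by (simp add: has_field_derivative_def mult_commute_abs)
  qed
  have 2: "((\<lambda>b. dd f (x + a *\<^sub>R v + b *\<^sub>R w) v) has_real_derivative dd (\<lambda>y. dd f y v) (x + a *\<^sub>R v + b *\<^sub>R w) w) (at b)"
    if "0 \<le> a" "a \<le> h" "0 \<le> b" "b \<le> h" for a b
  proof -
    have "((\<lambda>b. x + a *\<^sub>R v + b *\<^sub>R w) has_derivative (\<lambda>k. k *\<^sub>R w)) (at b)"
      by (auto intro!: derivative_eq_intros)
    from has_derivative_compose[OF this dd_works[OF d(2)[OF mem[OF that]]]]
    show ?thesis
      using linear_cmul[OF dd_linear[OF d(2)[OF mem[OF that]]]]
      by (simp add: has_field_derivative_def mult_commute_abs)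
  qed
  \<comment> \<open>The mean value theorem is used twice: in the direction \<open>v\<close> for the
    difference \<open>?p\<close>, then in the direction \<open>w\<close> for its derivative. The
    second difference is symmetric in \<open>v\<close> and \<open>w\<close>, so exchanging them
    gives the mixed derivative in the other order.\<close>
  let ?p = "\<lambda>a. f (x + a *\<^sub>R v + h *\<^sub>R w) - f (x + a *\<^sub>R v + 0 *\<^sub>R w)"
  have "\<exists>a. 0 < a \<and> a < h \<and> ?p h - ?p 0 =
    (h - 0) * (dd f (x + a *\<^sub>R v + h *\<^sub>R w) v - dd f (x + a *\<^sub>R v + 0 *\<^sub>R w) v)"
    using assms(2) by (intro MVT2 DERIV_diff 1) auto
  then obtain a where a: "0 < a" "a < h" and
    ea: "?p h - ?p 0 = h * (dd f (x + a *\<^sub>R v + h *\<^sub>R w) v - dd f (x + a *\<^sub>R v + 0 *\<^sub>R w) v)"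
    by auto
  have "\<exists>b. 0 < b \<and> b < h \<and> dd f (x + a *\<^sub>R v + h *\<^sub>R w) v - dd f (x + a *\<^sub>R v + 0 *\<^sub>R w) v =
    (h - 0) * dd (\<lambda>y. dd f y v) (x + a *\<^sub>R v + b *\<^sub>R w) w"
    using assms(2) a by (intro MVT2 2) auto
  then obtain b where b: "0 < b" "b < h" and
    eb: "dd f (x + a *\<^sub>R v + h *\<^sub>R w) v - dd f (x + a *\<^sub>R v + 0 *\<^sub>R w) v =
    h * dd (\<lambda>y. dd f y v) (x + a *\<^sub>R v + b *\<^sub>R w) w"
    by auto
  show ?thesis
  proof
    show "x + a *\<^sub>R v + b *\<^sub>R w \<in> ?C" using mem a b by simp
    show "f (x + h *\<^sub>R v + h *\<^sub>R w) - f (x + h *\<^sub>R v) - f (x + h *\<^sub>R w) + f x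
      = h\<^sup>2 * dd (\<lambda>y. dd f y v) (x + a *\<^sub>R v + b *\<^sub>R w) w"
      using ea eb by (simp add: power2_eq_square)
  qed
qed

lemma dd_symmetric_real:
  fixes f :: "'a::real_normed_vector \<Rightarrow> real"
  assumes "open S" "Ck_on 2 S f" "x \<in> S"
  shows "dd (\<lambda>y. dd f y v) x w = dd (\<lambda>y. dd f y w) x v"
proof (rule ccontr)
  let ?A = "\<lambda>x. dd (\<lambda>y. dd f y v) x w" and ?B = "\<lambda>x. dd (\<lambda>y. dd f y w) x v"
  assume ne: "?A x \<noteq> ?B x"
  define e where "e = \<bar>?A x - ?B x\<bar> / 2"
  have e: "e > 0" using ne by (simp add: e_def)
  have c: "continuous_on S ?A" "continuous_on S ?B"
    using assms(2) by (auto simp: numeral_2_eq_2)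
  obtain d1 where d1: "d1 > 0" "\<And>y. y \<in> S \<Longrightarrow> dist y x < d1 \<Longrightarrow> dist (?A y) (?A x) < e"
    using continuous_on_iff[THEN iffD1, OF c(1), rule_format, OF assms(3) e] by blast
  obtain d2 where d2: "d2 > 0" "\<And>y. y \<in> S \<Longrightarrow> dist y x < d2 \<Longrightarrow> dist (?B y) (?B x) < e"
    using continuous_on_iff[THEN iffD1, OF c(2), rule_format, OF assms(3) e] by blast
  note d = d1(1) d2(1) d1(2) d2(2)
  obtain d0 where d0: "d0 > 0" "ball x d0 \<subseteq> S"
    using assms(1,3) openE by blast
  \<comment> \<open>The step \<open>h\<close> is chosen so that the parallelogram spanned by
    \<open>h v\<close> and \<open>h w\<close> stays in a ball on which both mixed derivatives move
    by less than half of the assumed gap. The summand 1 in the denominator of \<open>h\<close>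
    covers \<open>v = w = 0\<close>.\<close>
  define m where "m = Min {d0, d1, d2} / 2"
  have m: "m > 0" "m < d0" "m < d1" "m < d2" using d d0 by (auto simp: m_def)
  define h where "h = m / (norm v + norm w + 1)"
  have h: "h > 0" using m by (simp add: h_def add_nonneg_pos)
  have nn: "norm v + norm w + 1 > 0" by (simp add: add_nonneg_pos)
  have "h * (norm v + norm w) \<le> h * (norm v + norm w + 1)" using h by (intro mult_left_mono) auto
  also have "\<dots> = m" unfolding h_def using nn by (metis less_irrefl nonzero_eq_divide_eq)
  finally have hm: "h * (norm v + norm w) \<le> m" .
  then have sub: "cball x (h * (norm v + norm w)) \<subseteq> S"
    using m d0 by (auto simp: subset_eq)
  obtain y where y: "y \<in> cball x (h * (norm v + norm w))"
    "f (x + h *\<^sub>R v + h *\<^sub>R w) - f (x + h *\<^sub>R v) - f (x + h *\<^sub>R w) + f x = h\<^sup>2 * ?A y"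
    using second_difference[OF assms(2) h sub] by blast
  obtain z where z: "z \<in> cball x (h * (norm v + norm w))"
    "f (x + h *\<^sub>R w + h *\<^sub>R v) - f (x + h *\<^sub>R w) - f (x + h *\<^sub>R v) + f x = h\<^sup>2 * ?B z"
    using second_difference[OF assms(2) h, of x w v] sub by (auto simp: add.commute)
  have "h\<^sup>2 * ?A y = h\<^sup>2 * ?B z" using y(2) z(2) by (simp add: algebra_simps)
  then have AB: "?A y = ?B z" using h by simp
  have "dist (?A y) (?A x) < e" using y(1) hm m sub by (intro d(3)) (auto simp: dist_commute)
  moreover have "dist (?B z) (?B x) < e" using z(1) hm m sub by (intro d(4)) (auto simp: dist_commute)
  ultimately show False unfolding AB dist_real_def e_def by (auto simp: abs_if split: if_splits)
qed

lemma dd_symmetric: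
  fixes f :: "'a::real_normed_vector \<Rightarrow> 'b::euclidean_space"
  assumes "open S" "smooth_on S f" "x \<in> S"
  shows "dd (\<lambda>y. dd f y v) x w = dd (\<lambda>y. dd f y w) x v"
proof (rule euclidean_eqI)
  fix b :: 'b
  assume "b \<in> Basis"
  have "dd (\<lambda>y. dd f y v) x w \<bullet> b = dd (\<lambda>y. dd (\<lambda>z. f z \<bullet> b) y v) x w" for v w
  proof -
    have bl: "bounded_linear (\<lambda>u. u \<bullet> b)" by (rule bounded_linear_inner_left)
    have "dd (\<lambda>y. dd f y v \<bullet> b) x w = dd (\<lambda>y. dd (\<lambda>z. f z \<bullet> b) y v) x w"
    proof (rule dd_cong(1)[OF assms(1,3), THEN fun_cong])
      show "dd f y v \<bullet> b = dd (\<lambda>z. f z \<bullet> b) y v" if "y \<in> S" for y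
        using dd_bounded_linear(1)[OF bl smooth_on_differentiable[OF assms(2) that]] by simp
      show "(\<lambda>y. dd f y v \<bullet> b) differentiable (at x)"
        by (rule dd_bounded_linear(2)[OF bl smooth_on_differentiable[OF smooth_on_dd[OF assms(2)] assms(3)]])
    qed
    moreover have "dd (\<lambda>y. dd f y v \<bullet> b) x w = dd (\<lambda>y. dd f y v) x w \<bullet> b"
      using dd_bounded_linear(1)[OF bl smooth_on_differentiable[OF smooth_on_dd[OF assms(2)] assms(3)]]
      by simp
    ultimately show ?thesis by simp
  qed
  moreover have "dd (\<lambda>y. dd (\<lambda>z. f z \<bullet> b) y v) x w = dd (\<lambda>y. dd (\<lambda>z. f z \<bullet> b) y w) x v"
    using assms smooth_on_bounded_linear[OF bounded_linear_inner_left assms(1,2)]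
    by (intro dd_symmetric_real) (auto simp: smooth_on_def)
  ultimately show "dd (\<lambda>y. dd f y v) x w \<bullet> b = dd (\<lambda>y. dd f y w) x v \<bullet> b" by simp
qed

section \<open>Linear maps of the plane and smooth inverse functions\<close>

lemma plane_linear_apply:
  fixes L :: "real \<times> real \<Rightarrow> 'b::real_vector"
  assumes "linear L"
  shows "L v = fst v *\<^sub>R L (1, 0) + snd v *\<^sub>R L (0, 1)"
proof -
  have "v = fst v *\<^sub>R (1, 0) + snd v *\<^sub>R (0, 1)" by (simp add: prod_eq_iff)
  then have "L v = L (fst v *\<^sub>R (1, 0) + snd v *\<^sub>R (0, 1))" by simp
  then show ?thesis by (simp only: linear_add[OF assms] linear_cmul[OF assms])
qed

lemma plane_linear_det:
  fixes L :: "real \<times> real \<Rightarrow> real \<times> real"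
  assumes L: "linear L" and "inj L"
  shows "fst (L (1, 0)) * snd (L (0, 1)) - fst (L (0, 1)) * snd (L (1, 0)) \<noteq> 0"
proof
  let ?a = "L (1, 0)" and ?b = "L (0, 1)"
  assume det: "fst ?a * snd ?b - fst ?b * snd ?a = 0"
  have z: "v = 0" if "L v = 0" for v
    using that assms linear_injective_0 by blast
  \<comment> \<open>Up to sign these are the columns of the adjugate matrix; for determinant zero
    they lie in the kernel.\<close>
  have "L (snd ?b, - snd ?a) = 0" "L (fst ?b, - fst ?a) = 0"
    using det plane_linear_apply[OF L, of "(snd ?b, - snd ?a)"] plane_linear_apply[OF L, of "(fst ?b, - fst ?a)"]
    by (simp_all add: prod_eq_iff mult.commute)
  then have "(snd ?b, - snd ?a) = 0" "(fst ?b, - fst ?a) = 0" using z by blast+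
  then have "?a = 0" by (simp add: prod_eq_iff)
  then show False using z[of "(1, 0)"] by (simp add: zero_prod_def)
qed

text \<open>Cramer's rule. The explicit quotients show that an inverse depends smoothly on the
  entries of the matrix, which \<open>inv\<close> hides.\<close>

lemma plane_linear_inv:
  fixes L :: "real \<times> real \<Rightarrow> real \<times> real"
  assumes L: "linear L" and "bij L"
  defines "d \<equiv> fst (L (1, 0)) * snd (L (0, 1)) - fst (L (0, 1)) * snd (L (1, 0))"
  shows "inv L v = ((fst v * snd (L (0, 1)) - fst (L (0, 1)) * snd v) / d,
                    (fst (L (1, 0)) * snd v - snd (L (1, 0)) * fst v) / d)" (is "_ = ?w")
proof -
  have d: "d \<noteq> 0" unfolding d_def using assms plane_linear_det by (simp add: bij_is_inj)
  obtain a1 a2 b1 b2 where ab: "L (1, 0) = (a1, a2)" "L (0, 1) = (b1, b2)" by fastforce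
  have dd: "d = a1 * b2 - b1 * a2" by (simp add: d_def ab)
  define p q where "p = (fst v * b2 - b1 * snd v) / d" and "q = (a1 * snd v - a2 * fst v) / d"
  have "p * a1 + q * b1 = (fst v * d) / d" "p * a2 + q * b2 = (snd v * d) / d"
    unfolding p_def q_def dd by (simp_all add: add_divide_distrib[symmetric] algebra_simps)
  then have "L (p, q) = v"
    using d plane_linear_apply[OF L, of "(p, q)"] ab by (simp add: prod_eq_iff)
  then have "L ?w = v"
    by (simp add: p_def q_def ab)
  then show ?thesis using assms(2) by (metis bij_inv_eq_iff)
qed

text \<open>Bootstrapping: the local inverse satisfies \<open>dd G y = inv (dd F (G y))\<close>. If
  \<open>G\<close> is of class C^n, then by Cramer's rule so is this derivative, hence
  \<open>G\<close> is of class C^(n+1).\<close>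

lemma smooth_inverse_function:
  fixes F :: "real \<times> real \<Rightarrow> real \<times> real"
  assumes "open U" "smooth_on U F" "x0 \<in> U" "inj (dd F x0)"
  obtains U' V G where "open U'" "U' \<subseteq> U" "x0 \<in> U'" "open V" "F x0 \<in> V" "homeomorphism U' V F G"
    "smooth_on V G" "\<And>x. x \<in> U' \<Longrightarrow> inj (dd F x)"
proof -
  let ?f = "\<lambda>x. Blinfun (dd F x)"
  have dF: "F differentiable (at x)" if "x \<in> U" for x
    using assms that smooth_on_differentiable by blast
  have bl: "bounded_linear (dd F x)" if "x \<in> U" for x
    using dF[OF that] frechet_derivative_works has_derivative_bounded_linear by blast
  have ap: "blinfun_apply (?f x) = dd F x" if "x \<in> U" for x
    using bl[OF that] by (rule bounded_linear_Blinfun_apply)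
  have cont: "continuous_on U ?f"
  proof (rule continuous_on_blinfun_componentwise)
    fix i
    show "continuous_on U (\<lambda>x. blinfun_apply (?f x) i)"
      using smooth_on_continuous[OF smooth_on_dd[OF assms(2), of i]]
      by (rule continuous_on_eq) (simp add: ap)
  qed
  obtain g where g: "linear g" "g \<circ> dd F x0 = id"
    using assms dd_linear[OF dF] linear_injective_left_inverse by metis
  have "g (dd F x0 i) = i" for i
    using g(2) by (metis comp_apply id_apply)
  then have inv: "Blinfun g o\<^sub>L ?f x0 = id_blinfun"
    by (intro blinfun_eqI)
       (use g(1) assms(3) in \<open>simp add: ap bounded_linear_Blinfun_apply linear_conv_bounded_linear[symmetric]\<close>)
  have der: "(F has_derivative blinfun_apply (?f x)) (at x)" if "x \<in> U" for x
    using dd_works[OF dF[OF that]] that by (simp add: ap)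
  obtain U' V G G' where U': "open U'" "U' \<subseteq> U" "x0 \<in> U'" and V: "open V" "F x0 \<in> V"
    and h: "homeomorphism U' V F G"
    and dG: "\<And>y. y \<in> V \<Longrightarrow> (G has_derivative G' y) (at y)"
    and G': "\<And>y. y \<in> V \<Longrightarrow> G' y = inv (blinfun_apply (?f (G y)))"
    and bij: "\<And>y. y \<in> V \<Longrightarrow> bij (blinfun_apply (?f (G y)))"
    using inverse_function_theorem[OF assms(1) der cont assms(3) inv] by blast
  have GU: "G y \<in> U'" if "y \<in> V" for y
    using h that by (auto simp: homeomorphism_def)
  have bij': "bij (dd F (G y))" if "y \<in> V" for y
    using bij[OF that] GU[OF that] U' by (simp add: ap subsetD)
  have G'': "dd G y = inv (dd F (G y))" if "y \<in> V" for y
    using dd_eqI[OF dG[OF that]] G'[OF that] GU[OF that] U' by (simp add: ap subsetD)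
  let ?a = "\<lambda>y. dd F (G y) (1, 0)" and ?b = "\<lambda>y. dd F (G y) (0, 1)"
  let ?d = "\<lambda>y. fst (?a y) * snd (?b y) - fst (?b y) * snd (?a y)"
  have L: "linear (dd F (G y))" if "y \<in> V" for y
    using GU[OF that] U' dd_linear[OF dF] by blast
  have dn: "?d y \<noteq> 0" if "y \<in> V" for y
    using plane_linear_det[OF L[OF that]] bij'[OF that] bij_is_inj by blast
  have "Ck_on n V G" for n
  proof (induction n)
    case 0
    then show ?case using h by (simp add: homeomorphism_def)
  next
    case (Suc n)
    show ?case
      unfolding Ck_on.simps
    proof (intro conjI ballI allI)
      show "G differentiable (at y)" if "y \<in> V" for y
        using dG[OF that] by (auto simp: differentiable_def)
      show "Ck_on n V (\<lambda>y. dd G y v)" for v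
      proof (rule Ck_on_cong[OF V(1)])
        show "((fst v * snd (?b y) - fst (?b y) * snd v) * inverse (?d y)) *\<^sub>R (1, 0) +
              ((fst (?a y) * snd v - snd (?a y) * fst v) * inverse (?d y)) *\<^sub>R (0, 1) = dd G y v"
          if "y \<in> V" for y
          unfolding G''[OF that] plane_linear_inv[OF L[OF that] bij'[OF that]]
          by (simp add: divide_inverse)
        have c: "Ck_on n V (\<lambda>y. dd F (G y) w)" for w
          by (rule Ck_on_compose[OF V(1) _ Suc, of U])
             (use smooth_on_dd[OF assms(2), of w] GU U' in \<open>auto simp: smooth_on_def\<close>)
        have fs: "Ck_on n V (\<lambda>y. fst (dd F (G y) w))" "Ck_on n V (\<lambda>y. snd (dd F (G y) w))" for w
          using Ck_on_bounded_linear[OF bounded_linear_fst V(1) c] Ck_on_bounded_linear[OF bounded_linear_snd V(1) c]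
          by auto
        have diff: "Ck_on n V (\<lambda>y. p y - q y)" if "Ck_on n V p" "Ck_on n V q" for p q :: "_ \<Rightarrow> real"
          using Ck_on_add[OF V(1) that(1) Ck_on_bounded_linear[OF bounded_linear_minus[OF bounded_linear_ident] V(1) that(2)]]
          by simp
        have "Ck_on n V (\<lambda>y. inverse (?d y))"
          by (rule Ck_on_compose[OF V(1), of _ "- {0}"])
             (use dn in \<open>auto intro!: Ck_on_inverse_real diff fs Ck_on_bounded_bilinear[OF bounded_bilinear_mult V(1)]\<close>)
        then show "Ck_on n V (\<lambda>y. ((fst v * snd (?b y) - fst (?b y) * snd v) * inverse (?d y)) *\<^sub>R (1, 0) +
              ((fst (?a y) * snd v - snd (?a y) * fst v) * inverse (?d y)) *\<^sub>R (0, 1))"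
          by (intro Ck_on_add[OF V(1)] Ck_on_bounded_bilinear[OF bounded_bilinear_scaleR V(1)] Ck_on_const
              Ck_on_bounded_bilinear[OF bounded_bilinear_mult V(1)] diff fs)
      qed
    qed
  qed
  then have "smooth_on V G" by (simp add: smooth_on_def)
  moreover have "inj (dd F x)" if "x \<in> U'" for x
  proof -
    have "F x \<in> V" "G (F x) = x" using h that by (auto simp: homeomorphism_def)
    then show ?thesis using bij' bij_is_inj by metis
  qed
  ultimately show thesis using that U' V h by blast
qed

section \<open>Derivatives in moving directions and the second-order chain rule\<close>

lemma smooth_on_linear: "smooth_on S f \<Longrightarrow> x \<in> S \<Longrightarrow> linear (dd f x)"
  by (rule dd_linear[OF smooth_on_differentiable])

text \<open>A product rule for the evaluation of \<open>dd g\<close>, with base point and direction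
  both moving. Expanding the direction in \<open>Basis\<close> reduces it to products; the expansion
  holds only where \<open>h\<close> stays in \<open>T\<close>, which is a neighbourhood of
  \<open>x\<close> by continuity.\<close>

lemma dd_directional:
  fixes g :: "'b::euclidean_space \<Rightarrow> 'c::real_normed_vector" and h u :: "'a::real_normed_vector \<Rightarrow> 'b"
  assumes "open T" "smooth_on T g" "h x \<in> T" "h differentiable (at x)" "u differentiable (at x)"
  shows "dd (\<lambda>y. dd g (h y) (u y)) x = (\<lambda>v. dd (\<lambda>z. dd g z (u x)) (h x) (dd h x v) + dd g (h x) (dd u x v))"
    and "(\<lambda>y. dd g (h y) (u y)) differentiable (at x)"
proof -
  have h: "(h has_derivative dd h x) (at x)" and u: "(u has_derivative dd u x) (at x)"
    using assms by (simp_all add: dd_works)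
  have gb: "((\<lambda>z. dd g z b) has_derivative dd (\<lambda>z. dd g z b) (h x)) (at (h x))" for b
    using assms smooth_on_differentiable[OF smooth_on_dd] dd_works by blast
  have gl: "linear (dd g z)" if "z \<in> T" for z
    using assms(2) smooth_on_differentiable dd_linear that by blast
  have rep: "dd g z w = (\<Sum>b\<in>Basis. (w \<bullet> b) *\<^sub>R dd g z b)" if "z \<in> T" for z w
  proof -
    have "dd g z w = dd g z (\<Sum>b\<in>Basis. (w \<bullet> b) *\<^sub>R b)"
      by (simp add: euclidean_representation)
    also have "\<dots> = (\<Sum>b\<in>Basis. (w \<bullet> b) *\<^sub>R dd g z b)"
      using gl[OF that] by (simp add: linear_sum linear_cmul o_def)
    finally show ?thesis .
  qed
  let ?D = "\<lambda>w k. \<Sum>b\<in>Basis. (w \<bullet> b) *\<^sub>R dd (\<lambda>z. dd g z b) (h x) k"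
  have D: "dd (\<lambda>z. dd g z w) (h x) = ?D w" for w
  proof (rule dd_eqI)
    have "((\<lambda>z. \<Sum>b\<in>Basis. (w \<bullet> b) *\<^sub>R dd g z b) has_derivative ?D w) (at (h x))"
      by (intro has_derivative_sum has_derivative_scaleR_right gb)
    then show "((\<lambda>z. dd g z w) has_derivative ?D w) (at (h x))"
      by (rule has_derivative_transform_within_open[OF _ assms(1,3)]) (simp add: rep)
  qed
  have "((\<lambda>y. \<Sum>b\<in>Basis. (u y \<bullet> b) *\<^sub>R dd g (h y) b) has_derivative
      (\<lambda>v. \<Sum>b\<in>Basis. (u x \<bullet> b) *\<^sub>R dd (\<lambda>z. dd g z b) (h x) (dd h x v) + (dd u x v \<bullet> b) *\<^sub>R dd g (h x) b)) (at x)"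
    by (intro has_derivative_sum has_derivative_scaleR has_derivative_inner_left
        has_derivative_compose[OF h gb] u)
  moreover have "(\<Sum>b\<in>Basis. (u x \<bullet> b) *\<^sub>R dd (\<lambda>z. dd g z b) (h x) (dd h x v) + (dd u x v \<bullet> b) *\<^sub>R dd g (h x) b)
     = dd (\<lambda>z. dd g z (u x)) (h x) (dd h x v) + dd g (h x) (dd u x v)" for v
    unfolding D[of "u x"] rep[OF assms(3), of "dd u x v"] sum.distrib by simp
  ultimately have *: "((\<lambda>y. \<Sum>b\<in>Basis. (u y \<bullet> b) *\<^sub>R dd g (h y) b) has_derivative
     (\<lambda>v. dd (\<lambda>z. dd g z (u x)) (h x) (dd h x v) + dd g (h x) (dd u x v))) (at x)"
    by simp
  have "continuous (at x) h"
    using assms(4) differentiable_imp_continuous_within by blast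
  then obtain S where S: "open S" "x \<in> S" "\<And>y. y \<in> S \<Longrightarrow> h y \<in> T"
    using continuous_at_open[THEN iffD1, rule_format, of x h T] assms(1,3) by metis
  have "((\<lambda>y. dd g (h y) (u y)) has_derivative
     (\<lambda>v. dd (\<lambda>z. dd g z (u x)) (h x) (dd h x v) + dd g (h x) (dd u x v))) (at x)"
    by (rule has_derivative_transform_within_open[OF * S(1,2)]) (use S(3) rep in metis)
  then show "dd (\<lambda>y. dd g (h y) (u y)) x = (\<lambda>v. dd (\<lambda>z. dd g z (u x)) (h x) (dd h x v) + dd g (h x) (dd u x v))"
    "(\<lambda>y. dd g (h y) (u y)) differentiable (at x)"
    by (auto intro: dd_eqI simp: differentiable_def)
qed

text \<open>The first term is the Hessian of \<open>g\<close>; the second one is the deviation from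
  tensorial behaviour. For a change of parameters that second term is tangent, for an isometry it is
  absorbed by the Christoffel terms.\<close>

lemma dd_dd_compose:
  fixes f :: "'a::real_normed_vector \<Rightarrow> 'b::euclidean_space" and g :: "'b \<Rightarrow> 'c::real_normed_vector"
  assumes "open S" "smooth_on S f" "f ` S \<subseteq> T" "open T" "smooth_on T g" "x \<in> S"
  shows "dd (\<lambda>y. dd (\<lambda>x. g (f x)) y w') x w =
    dd (\<lambda>z. dd g z (dd f x w')) (f x) (dd f x w) + dd g (f x) (dd (\<lambda>y. dd f y w') x w)"
proof -
  have d: "f differentiable (at y)" "g differentiable (at (f y))" if "y \<in> S" for y
    using that assms smooth_on_differentiable by blast+
  have fx: "f x \<in> T" using assms by blast
  have du: "(\<lambda>y. dd f y w') differentiable (at x)"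
    by (rule smooth_on_differentiable[OF smooth_on_dd[OF assms(2)] assms(6)])
  note dir = dd_directional[OF assms(4,5) fx d(1)[OF assms(6)] du]
  have "dd (\<lambda>y. dd (\<lambda>x. g (f x)) y w') x = dd (\<lambda>y. dd g (f y) (dd f y w')) x"
    by (rule dd_cong(1)[OF assms(1,6) _ dir(2), symmetric]) (use dd_compose(1)[OF d] in metis)
  then show ?thesis by (simp add: dir(1))
qed

section \<open>Null directions of the second fundamental form\<close>

text \<open>The covariant derivative of the coordinate field \<open>dX w'\<close>; its normal part is the second
  fundamental form.\<close>

definition cov :: "('v::real_normed_vector \<Rightarrow> 'v \<Rightarrow> 'v \<Rightarrow> real) \<Rightarrow> ('e::real_normed_vector \<Rightarrow> 'v) \<Rightarrow> 'e \<Rightarrow> 'e \<Rightarrow> 'e \<Rightarrow> 'v"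
  where "cov g X x w w' = dd (\<lambda>y. dd X y w') x w + christoffel g (X x) (dd X x w) (dd X x w')"

text \<open>Tangency replaces the vanishing of the normal part, so that no orthogonal projection has
  to exist. On space-like patches the two conditions agree, by
  \<open>second_fundamental_form_null\<close>.\<close>

definition null_dir :: "('v::real_normed_vector \<Rightarrow> 'v \<Rightarrow> 'v \<Rightarrow> real) \<Rightarrow> ('e::real_normed_vector \<Rightarrow> 'v) \<Rightarrow> 'e \<Rightarrow> 'e \<Rightarrow> bool"
  where "null_dir g X x w \<longleftrightarrow> (\<forall>w'. cov g X x w w' \<in> range (dd X x))"

text \<open>The Christoffel term depends only on the values of the two tangent vectors, so the sole
  defect is the image under \<open>dd X\<close> of a second derivative of \<omega>. It is tangent,
  which makes null directions independent of the parametrization.\<close>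

lemma cov_compose:
  fixes X :: "'a::euclidean_space \<Rightarrow> 'v::euclidean_space" and \<omega> :: "'e::real_normed_vector \<Rightarrow> 'a"
  assumes "open V" "smooth_on V \<omega>" "\<omega> ` V \<subseteq> W" "open W" "smooth_on W X" "y \<in> V"
  shows "dd (\<lambda>y. X (\<omega> y)) y w = dd X (\<omega> y) (dd \<omega> y w)"
    and "cov g (\<lambda>y. X (\<omega> y)) y w w' = cov g X (\<omega> y) (dd \<omega> y w) (dd \<omega> y w') + dd X (\<omega> y) (dd (\<lambda>y. dd \<omega> y w') y w)"
proof -
  have "\<omega> differentiable (at y)" "X differentiable (at (\<omega> y))"
    using assms smooth_on_differentiable by blast+
  then show 1: "dd (\<lambda>y. X (\<omega> y)) y w = dd X (\<omega> y) (dd \<omega> y w)" for w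
    using dd_compose(1) by metis
  show "cov g (\<lambda>y. X (\<omega> y)) y w w' = cov g X (\<omega> y) (dd \<omega> y w) (dd \<omega> y w') + dd X (\<omega> y) (dd (\<lambda>y. dd \<omega> y w') y w)"
    unfolding cov_def 1 dd_dd_compose[OF assms] by simp
qed

lemma subspace_add_iff:
  assumes "subspace S" "b \<in> S"
  shows "a + b \<in> S \<longleftrightarrow> a \<in> S"
  using subspace_add[OF assms(1), of a b] subspace_diff[OF assms(1), of "a + b" b] assms(2) by auto

lemma null_dir_compose:
  fixes X :: "'a::euclidean_space \<Rightarrow> 'v::euclidean_space" and \<omega> :: "'a \<Rightarrow> 'a"
  assumes "open V" "smooth_on V \<omega>" "\<omega> ` V \<subseteq> W" "open W" "smooth_on W X" "y \<in> V" "inj (dd \<omega> y)"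
  shows "range (dd (\<lambda>y. X (\<omega> y)) y) = range (dd X (\<omega> y))"
    and "null_dir g (\<lambda>y. X (\<omega> y)) y w \<longleftrightarrow> null_dir g X (\<omega> y) (dd \<omega> y w)"
proof -
  note c = cov_compose[OF assms(1-6)]
  have X: "linear (dd X (\<omega> y))" and l: "linear (dd \<omega> y)"
    using assms smooth_on_differentiable dd_linear by blast+
  have s: "surj (dd \<omega> y)" by (rule linear_inj_imp_surj[OF l assms(7)])
  show r: "range (dd (\<lambda>y. X (\<omega> y)) y) = range (dd X (\<omega> y))"
  proof -
    have "dd (\<lambda>y. X (\<omega> y)) y = dd X (\<omega> y) \<circ> dd \<omega> y"
      by (rule ext) (simp only: c(1) o_apply)
    then show ?thesis using s image_comp by metis
  qed
  have sub: "subspace (range (dd X (\<omega> y)))" using X by (simp add: linear_subspace_image)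
  have cv: "cov g (\<lambda>y. X (\<omega> y)) y w w' \<in> range (dd X (\<omega> y)) \<longleftrightarrow>
      cov g X (\<omega> y) (dd \<omega> y w) (dd \<omega> y w') \<in> range (dd X (\<omega> y))" for w'
    unfolding c(2) by (rule subspace_add_iff[OF sub rangeI])
  have all: "(\<forall>w'. Q (dd \<omega> y w')) \<longleftrightarrow> (\<forall>w'. Q w')" for Q
    using s by (metis surjD)
  show "null_dir g (\<lambda>y. X (\<omega> y)) y w \<longleftrightarrow> null_dir g X (\<omega> y) (dd \<omega> y w)"
    unfolding null_dir_def r cv by (rule all)
qed

lemma null_dir_cong:
  fixes X :: "'a::euclidean_space \<Rightarrow> 'v::euclidean_space"
  assumes "open V" "smooth_on V X" "\<And>y. y \<in> V \<Longrightarrow> X y = X' y" "y \<in> V"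
  shows "dd X y = dd X' y" "cov g X y = cov g X' y" "null_dir g X y = null_dir g X' y"
proof -
  have d: "dd X z = dd X' z" if "z \<in> V" for z
    by (rule dd_cong(1)[OF assms(1) that assms(3) smooth_on_differentiable[OF assms(2) that]])
  have "dd (\<lambda>y. dd X y w') y = dd (\<lambda>y. dd X' y w') y" for w'
    by (rule dd_cong(1)[OF assms(1,4)]) (use d smooth_on_differentiable[OF smooth_on_dd] assms in auto)
  then show "dd X y = dd X' y" "cov g X y = cov g X' y" "null_dir g X y = null_dir g X' y"
    using d assms by (auto simp: cov_def null_dir_def fun_eq_iff)
qed

text \<open>The homeomorphisms only make the transition map \<omega> continuous. Composing
  \<open>\<psi> \<circ> \<sigma>\<close> with a linear left inverse \<open>P\<close> of its
  differential at \<open>x\<close> gives a map of the plane with a smooth local inverse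
  \<open>G\<close>, and \<open>\<omega> y = G (P (\<psi> (\<sigma>' y)))\<close> exhibits
  smoothness.\<close>

lemma local_param_transition:
  fixes \<psi> :: "'m::topological_space \<Rightarrow> 'v::euclidean_space" and W W' :: "(real \<times> real) set"
  assumes p: "local_param M \<psi> W \<sigma>" and p': "local_param M \<psi> W' \<sigma>'"
    and x: "x \<in> W" "x' \<in> W'" "\<sigma> x = \<sigma>' x'"
  obtains V \<omega> where "open V" "x' \<in> V" "V \<subseteq> W'" "smooth_on V \<omega>" "\<omega> ` V \<subseteq> W" "\<omega> x' = x"
    "\<And>y. y \<in> V \<Longrightarrow> \<sigma> (\<omega> y) = \<sigma>' y"
proof -
  obtain \<tau> where op: "openin (top_of_set M) (\<sigma> ` W)" and h: "homeomorphism W (\<sigma> ` W) \<sigma> \<tau>"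
    and i: "open W" "smooth_on W (\<psi> \<circ> \<sigma>)" "inj (dd (\<psi> \<circ> \<sigma>) x)"
    using p x by (auto simp: local_param_def immersion_on_def)
  obtain \<tau>' where op': "openin (top_of_set M) (\<sigma>' ` W')" and h': "homeomorphism W' (\<sigma>' ` W') \<sigma>' \<tau>'"
    and i': "open W'" "smooth_on W' (\<psi> \<circ> \<sigma>')"
    using p' by (auto simp: local_param_def immersion_on_def)
  let ?X = "\<psi> \<circ> \<sigma>"
  have "linear (dd ?X x)"
    by (rule smooth_on_linear[OF i(2) x(1)])
  then obtain P where P: "linear P" "P \<circ> dd ?X x = id"
    using linear_injective_left_inverse i(3) by blast
  have bP: "bounded_linear P" using P(1) by (simp add: linear_conv_bounded_linear)
  let ?F = "\<lambda>y. P (?X y)"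
  have "dd ?F x = P \<circ> dd ?X x"
    using dd_bounded_linear(1)[OF bP smooth_on_differentiable[OF i(2) x(1)]] by (simp add: o_def)
  then have inj: "inj (dd ?F x)" using P by simp
  have sF: "smooth_on W ?F" by (rule smooth_on_bounded_linear[OF bP i(1,2)])
  obtain U Y G where U: "open U" "U \<subseteq> W" "x \<in> U" "open Y" "?F x \<in> Y" "homeomorphism U Y ?F G" "smooth_on Y G"
    by (rule smooth_inverse_function[OF i(1) sF x(1) inj]; rule that; assumption)
  define V0 where "V0 = W' \<inter> \<sigma>' -` (\<sigma> ` W)"
  define \<omega> where "\<omega> = (\<lambda>y. \<tau> (\<sigma>' y))"
  have c': "continuous_on W' \<sigma>'" using h' by (simp add: homeomorphism_def)
  have "\<sigma>' \<in> W' \<rightarrow> M" using op' openin_imp_subset by blast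
  then have "openin (top_of_set W') V0"
    unfolding V0_def using continuous_openin_preimage[OF c' _ op] by blast
  then have V0: "open V0" using i'(1) by (simp add: openin_open_eq)
  have "continuous_on V0 \<omega>"
    unfolding \<omega>_def
    by (rule continuous_on_compose2[of "\<sigma> ` W" \<tau>])
       (use h c' in \<open>auto simp: homeomorphism_def V0_def intro: continuous_on_subset\<close>)
  then have V: "open (V0 \<inter> \<omega> -` U)" using V0 U(1) by (simp add: continuous_open_preimage)
  have \<tau>: "\<tau> (\<sigma> y) = y" if "y \<in> W" for y using h that by (simp add: homeomorphism_def)
  have \<sigma>: "\<sigma> (\<tau> q) = q" if "q \<in> \<sigma> ` W" for q using \<tau> that by auto
  have xx: "\<omega> x' = x" using x \<tau> by (metis \<omega>_def)
  have key: "\<sigma> (\<omega> y) = \<sigma>' y" if "y \<in> V0" for y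
    using that \<sigma> by (auto simp: \<omega>_def V0_def)
  have eq: "G (P ((\<psi> \<circ> \<sigma>') y)) = \<omega> y" and inY: "P ((\<psi> \<circ> \<sigma>') y) \<in> Y" if "y \<in> V0 \<inter> \<omega> -` U" for y
  proof -
    have "\<omega> y \<in> U" "P ((\<psi> \<circ> \<sigma>') y) = ?F (\<omega> y)" using that key[of y] by simp_all
    then show "G (P ((\<psi> \<circ> \<sigma>') y)) = \<omega> y" "P ((\<psi> \<circ> \<sigma>') y) \<in> Y"
      using U(6) by (auto simp: homeomorphism_def)
  qed
  have sm: "smooth_on (V0 \<inter> \<omega> -` U) (\<lambda>y. P ((\<psi> \<circ> \<sigma>') y))"
    by (rule smooth_on_bounded_linear[OF bP V smooth_on_subset[OF i'(2)]]) (auto simp: V0_def)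
  have "smooth_on (V0 \<inter> \<omega> -` U) (\<lambda>y. G (P ((\<psi> \<circ> \<sigma>') y)))"
    by (rule smooth_on_compose[OF V _ sm U(7)]) (use inY in blast)
  then have "smooth_on (V0 \<inter> \<omega> -` U) \<omega>"
    by (rule smooth_on_cong[OF V eq, rotated])
  moreover have "x' \<in> V0 \<inter> \<omega> -` U" using x U(3) xx imageI[OF x(1), of \<sigma>] by (simp add: V0_def)
  moreover have "V0 \<inter> \<omega> -` U \<subseteq> W'" "\<omega> ` (V0 \<inter> \<omega> -` U) \<subseteq> W"
    using U(2) by (auto simp: V0_def)
  ultimately show thesis
    using that[of "V0 \<inter> \<omega> -` U" \<omega>] V xx key by simp
qed

lemma local_param_transition_null:
  fixes \<psi> :: "'m::topological_space \<Rightarrow> 'v::euclidean_space" and W W' :: "(real \<times> real) set"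
  assumes p: "local_param M \<psi> W \<sigma>" and p': "local_param M \<psi> W' \<sigma>'"
    and x: "x \<in> W" "x' \<in> W'" "\<sigma> x = \<sigma>' x'"
  obtains k where "dd (\<psi> \<circ> \<sigma>) x k = dd (\<psi> \<circ> \<sigma>') x' w"
    "null_dir g (\<psi> \<circ> \<sigma>') x' w \<Longrightarrow> null_dir g (\<psi> \<circ> \<sigma>) x k"
    "range (dd (\<psi> \<circ> \<sigma>) x) = range (dd (\<psi> \<circ> \<sigma>') x')"
proof -
  obtain V \<omega> where V: "open V" "x' \<in> V" "V \<subseteq> W'" "smooth_on V \<omega>" "\<omega> ` V \<subseteq> W" "\<omega> x' = x"
    and eq: "\<And>y. y \<in> V \<Longrightarrow> \<sigma> (\<omega> y) = \<sigma>' y"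
    by (rule local_param_transition[OF assms]; rule that; assumption)
  have i: "open W" "smooth_on W (\<psi> \<circ> \<sigma>)" "smooth_on W' (\<psi> \<circ> \<sigma>')" "inj (dd (\<psi> \<circ> \<sigma>') x')"
    using p p' x by (auto simp: local_param_def immersion_on_def)
  have s': "smooth_on V (\<psi> \<circ> \<sigma>')" using i(3) V(3) by (rule smooth_on_subset)
  have e: "(\<psi> \<circ> \<sigma>') y = (\<psi> \<circ> \<sigma>) (\<omega> y)" if "y \<in> V" for y using eq[OF that] by simp
  have c: "dd (\<psi> \<circ> \<sigma>') x' = dd (\<lambda>y. (\<psi> \<circ> \<sigma>) (\<omega> y)) x'"
    "null_dir g (\<psi> \<circ> \<sigma>') x' = null_dir g (\<lambda>y. (\<psi> \<circ> \<sigma>) (\<omega> y)) x'"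
    by (rule null_dir_cong[OF V(1) s' _ V(2)], rule e, assumption)+
  note d = cov_compose(1)[OF V(1,4,5) i(1,2) V(2)]
  have "inj (dd \<omega> x')"
  proof (rule injI)
    fix a b assume "dd \<omega> x' a = dd \<omega> x' b"
    then have "dd (\<psi> \<circ> \<sigma>') x' a = dd (\<psi> \<circ> \<sigma>') x' b" unfolding c(1) d by simp
    then show "a = b" using i(4) by (simp add: inj_eq)
  qed
  note n = null_dir_compose[OF V(1,4,5) i(1,2) V(2) this]
  show thesis
  proof (rule that[of "dd \<omega> x' w"])
    show "dd (\<psi> \<circ> \<sigma>) x (dd \<omega> x' w) = dd (\<psi> \<circ> \<sigma>') x' w" unfolding c(1) d V(6) ..
    show "null_dir g (\<psi> \<circ> \<sigma>) x (dd \<omega> x' w)" if "null_dir g (\<psi> \<circ> \<sigma>') x' w"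
      using that n(2)[of g w] unfolding c(2) V(6) by blast
    show "range (dd (\<psi> \<circ> \<sigma>) x) = range (dd (\<psi> \<circ> \<sigma>') x')" using n(1) unfolding c(1) V(6) ..
  qed
qed

text \<open>The definition collects vectors from all local parametrizations through the point; by
  the transition maps each of them contributes the same plane.\<close>

lemma tangent_plane_eq:
  fixes \<psi> :: "'m::topological_space \<Rightarrow> 'v::euclidean_space" and W :: "(real \<times> real) set"
  assumes "local_param M \<psi> W \<sigma>" "x \<in> W"
  shows "tangent_plane M \<psi> (\<sigma> x) = range (dd (\<psi> \<circ> \<sigma>) x)"
proof
  show "range (dd (\<psi> \<circ> \<sigma>) x) \<subseteq> tangent_plane M \<psi> (\<sigma> x)"
    using assms unfolding tangent_plane_def by blast
  show "tangent_plane M \<psi> (\<sigma> x) \<subseteq> range (dd (\<psi> \<circ> \<sigma>) x)"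
  proof
    fix q assume "q \<in> tangent_plane M \<psi> (\<sigma> x)"
    then obtain W' \<sigma>' x' w where "q = dd (\<psi> \<circ> \<sigma>') x' w" "local_param M \<psi> W' \<sigma>'" "x' \<in> (W' :: (real \<times> real) set)" "\<sigma>' x' = \<sigma> x"
      unfolding tangent_plane_def by blast
    then show "q \<in> range (dd (\<psi> \<circ> \<sigma>) x)"
      using local_param_transition_null[OF assms(1) _ assms(2), of W' \<sigma>' x'] by (metis rangeI)
  qed
qed

section \<open>Projection onto a space-like plane\<close>

lemma tangential_part_eqI:
  assumes "bilinear b" "subspace S" "nondegenerate_on b S" "w \<in> S" "\<And>z. z \<in> S \<Longrightarrow> b (v - w) z = 0"
  shows "tangential_part b S v = w"
  unfolding tangential_part_def
proof (rule the_equality)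
  fix w' assume w': "w' \<in> S \<and> (\<forall>z\<in>S. b (v - w') z = 0)"
  have "b (w' - w) z = 0" if "z \<in> S" for z
  proof -
    have "b (w' - w) z = b (v - w) z - b (v - w') z"
      using assms(1) by (simp add: bilinear_lsub)
    then show ?thesis using w' assms(5) that by simp
  qed
  moreover have "w' - w \<in> S" using assms(2,4) w' by (simp add: subspace_diff)
  ultimately have "w' - w = 0" using assms(3) unfolding nondegenerate_on_def by blast
  then show "w' = w" by simp
qed (use assms in auto)

lemma pos_def_on_imp_nondegenerate_on: "pos_def_on b S \<Longrightarrow> nondegenerate_on b S"
  unfolding pos_def_on_def nondegenerate_on_def by (metis less_irrefl)

text \<open>As \<open>tangential_part\<close> is a definite description, the forward direction needs
  a projection to exist. Gram-Schmidt on the images of the standard basis constructs it, and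
  positive definiteness makes the denominators nonzero.\<close>

lemma normal_part_eq_0_iff:
  fixes L :: "real \<times> real \<Rightarrow> 'v::real_normed_vector"
  assumes b: "bilinear b" "\<And>v w. b v w = b w v" and L: "linear L" "inj L" and "pos_def_on b (range L)"
  shows "normal_part b (range L) v = 0 \<longleftrightarrow> v \<in> range L"
proof -
  have sub: "subspace (range L)" using L(1) by (simp add: linear_subspace_image)
  note nd = pos_def_on_imp_nondegenerate_on[OF assms(5)]
  define u1 where "u1 = L (1, 0)"
  define u2 where "u2 = L (0, 1) - (b u1 (L (0, 1)) / b u1 u1) *\<^sub>R u1"
  have z: "k = 0" if "L k = 0" for k using that L linear_injective_0 by blast
  have u2: "u2 = L (- b u1 (L (0, 1)) / b u1 u1, 1)"
    using plane_linear_apply[OF L(1), of "(- b u1 (L (0, 1)) / b u1 u1, 1)"] by (simp add: u2_def u1_def)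
  have "u1 \<noteq> 0" "u2 \<noteq> 0"
    using z[of "(1, 0)"] z[of "(- b u1 (L (0, 1)) / b u1 u1, 1)"] by (auto simp: u1_def u2 zero_prod_def)
  then have p: "b u1 u1 > 0" "b u2 u2 > 0"
    using assms(5) unfolding pos_def_on_def by (auto simp: u2) (simp add: u1_def)
  have o: "b u1 u2 = 0"
    unfolding u2_def using p by (simp add: bilinear_rsub[OF b(1)] bilinear_rmul[OF b(1)])
  define w where "w = (b v u1 / b u1 u1) *\<^sub>R u1 + (b v u2 / b u2 u2) *\<^sub>R u2"
  have wS: "w \<in> range L" unfolding w_def
    by (intro subspace_add[OF sub] subspace_scale[OF sub]) (auto simp: u1_def u2)
  have w: "b (v - w) u1 = 0" "b (v - w) u2 = 0"
    using p o b(2)[of u2 u1] unfolding w_def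
    by (simp_all add: bilinear_lsub[OF b(1)] bilinear_ladd[OF b(1)] bilinear_lmul[OF b(1)])
  have "b (v - w) y = 0" if "y \<in> range L" for y
  proof -
    from that obtain k where "y = L k" by auto
    then have "y = (fst k + snd k * (b u1 (L (0, 1)) / b u1 u1)) *\<^sub>R u1 + snd k *\<^sub>R u2"
      using plane_linear_apply[OF L(1), of k] by (simp add: u1_def u2_def algebra_simps)
    then show ?thesis using w by (simp add: bilinear_radd[OF b(1)] bilinear_rmul[OF b(1)])
  qed
  then have t: "tangential_part b (range L) v = w"
    by (intro tangential_part_eqI[OF b(1) sub nd wS])
  have "tangential_part b (range L) v = v" if "v \<in> range L"
    by (rule tangential_part_eqI[OF b(1) sub nd that]) (simp add: bilinear_lzero[OF b(1)])
  then show ?thesis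
    using wS t unfolding normal_part_def by (metis eq_iff_diff_eq_0)
qed

section \<open>The Levi-Civita connection of a Robertson-Walker metric\<close>

lemma bilinear_rw_metric: "bilinear (rw_metric f p)"
  unfolding bilinear_def rw_metric_def
  by (auto intro!: linearI simp: algebra_simps inner_add_left inner_add_right)

lemma rw_metric_commute: "rw_metric f p v w = rw_metric f p w v"
  by (simp add: rw_metric_def inner_commute mult.commute)

locale robertson_walker =
  fixes I :: "real set" and f :: "real \<Rightarrow> real"
  assumes interval: "open_interval I" and smooth: "smooth_on I f" and nonzero: "t \<in> I \<Longrightarrow> f t \<noteq> 0"
begin

abbreviation "f' \<equiv> deriv f"

lemma open_I: "open I" using interval by (simp add: open_interval_def)

lemma f_deriv: "t \<in> I \<Longrightarrow> (f has_real_derivative f' t) (at t)"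
  using smooth_on_differentiable[OF smooth]
  by (simp add: DERIV_deriv_iff_real_differentiable)

lemma dd_f: "t \<in> I \<Longrightarrow> dd f t k = f' t * k"
  using f_deriv[of t] dd_eqI[of f "(*) (f' t)" t] by (simp add: has_field_derivative_def)

lemma smooth_f': "smooth_on I f'"
  by (rule smooth_on_cong[OF open_I _ smooth_on_dd[OF smooth, of 1]]) (simp add: dd_f)

lemma open_rw_space: "open (rw_space I)"
  unfolding rw_space_def using open_I by (simp add: open_Times)

lemma dd_rw_metric:
  assumes "fst p \<in> I"
  shows "((\<lambda>q. rw_metric f q w z) has_derivative (\<lambda>v. 2 * f (fst p) * f' (fst p) * fst v * (snd w \<bullet> snd z))) (at p)"
proof -
  have "((\<lambda>q. f (fst q)) has_derivative (\<lambda>v. f' (fst p) * fst v)) (at p)"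
    using has_derivative_compose[OF has_derivative_fst[OF has_derivative_ident] f_deriv[OF assms, unfolded has_field_derivative_def]]
    by simp
  then show ?thesis
    unfolding rw_metric_def power2_eq_square
    by (auto intro!: derivative_eq_intros simp: algebra_simps)
qed

text \<open>Supplies the uniqueness behind the definite description in \<open>christoffel\<close>:
  the test vectors \<open>(1, 0)\<close> and \<open>(0, z)\<close> read off the time and space
  components.\<close>

lemma rw_metric_nondegenerate:
  assumes "fst p \<in> I" "\<And>z. rw_metric f p c z = rw_metric f p d z"
  shows "c = d"
proof -
  have "fst c = fst d" using assms(2)[of "(1, 0)"] by (simp add: rw_metric_def)
  moreover have "snd c = snd d"
  proof (rule vector_eq_ldot[THEN iffD1], rule allI)
    fix z show "z \<bullet> snd c = z \<bullet> snd d"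
      using assms(2)[of "(0, z)"] nonzero[OF assms(1)] by (simp add: rw_metric_def inner_commute)
  qed
  ultimately show ?thesis by (simp add: prod_eq_iff)
qed

text \<open>The metric varies with time only, so every term of the Koszul formula carries the factor
  \<open>2 * f * f'\<close>. Solving for the time component keeps \<open>f * f'\<close>; solving for
  the spatial one divides by the square of \<open>f\<close> and leaves
  \<open>f' / f\<close>.\<close>

lemma rw_christoffel:
  assumes "fst p \<in> I"
  shows "christoffel (rw_metric f) p v w =
    (f (fst p) * f' (fst p) * (snd v \<bullet> snd w), (f' (fst p) / f (fst p)) *\<^sub>R (fst v *\<^sub>R snd w + fst w *\<^sub>R snd v))"
    (is "_ = ?c")
  unfolding christoffel_def dd_eqI[OF dd_rw_metric[OF assms]]
proof (rule the_equality)
  note n = nonzero[OF assms]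
  show 1: "\<forall>z. 2 * rw_metric f p ?c z =
     2 * f (fst p) * f' (fst p) * fst v * (snd w \<bullet> snd z) + 2 * f (fst p) * f' (fst p) * fst w * (snd v \<bullet> snd z) -
     2 * f (fst p) * f' (fst p) * fst z * (snd v \<bullet> snd w)"
    using n by (auto simp: rw_metric_def inner_add_left power2_eq_square algebra_simps)
  fix c assume 2: "\<forall>z. 2 * rw_metric f p c z =
     2 * f (fst p) * f' (fst p) * fst v * (snd w \<bullet> snd z) + 2 * f (fst p) * f' (fst p) * fst w * (snd v \<bullet> snd z) -
     2 * f (fst p) * f' (fst p) * fst z * (snd v \<bullet> snd w)"
  show "c = ?c"
  proof (rule rw_metric_nondegenerate[OF assms])
    fix z
    have "2 * rw_metric f p c z = 2 * rw_metric f p ?c z"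
      unfolding 1[rule_format] 2[rule_format] ..
    then show "rw_metric f p c z = rw_metric f p ?c z" by simp
  qed
qed

lemma koszul:
  assumes "fst p \<in> I"
  shows "2 * rw_metric f p (christoffel (rw_metric f) p v w) z = dd (\<lambda>q. rw_metric f q w z) p v
     + dd (\<lambda>q. rw_metric f q v z) p w - dd (\<lambda>q. rw_metric f q v w) p z"
  using nonzero[OF assms] unfolding dd_eqI[OF dd_rw_metric[OF assms]] rw_christoffel[OF assms]
  by (auto simp: rw_metric_def inner_add_left power2_eq_square algebra_simps)

lemma second_fundamental_form_null:
  fixes X :: "real \<times> real \<Rightarrow> spacetime"
  assumes "immersion_on W X" "x \<in> W" "pos_def_on (rw_metric f (X x)) (range (dd X x))"
  shows "(\<forall>w'. second_fundamental_form (rw_metric f) X x w w' = 0) \<longleftrightarrow> null_dir (rw_metric f) X x w"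
proof -
  have "linear (dd X x)" "inj (dd X x)"
    using assms smooth_on_linear[of W X x] by (auto simp: immersion_on_def)
  from normal_part_eq_0_iff[OF bilinear_rw_metric rw_metric_commute this assms(3)]
  show ?thesis unfolding second_fundamental_form_def null_dir_def cov_def by simp
qed

end

section \<open>Isometries preserve null directions\<close>

context robertson_walker
begin

lemma dd_rw_metric_along:
  assumes "H differentiable (at x)" "A differentiable (at x)" "B differentiable (at x)" "fst (H x) \<in> I"
  shows "dd (\<lambda>q. rw_metric f (H q) (A q) (B q)) x v =
     dd (\<lambda>r. rw_metric f r (A x) (B x)) (H x) (dd H x v) +
     rw_metric f (H x) (dd A x v) (B x) + rw_metric f (H x) (A x) (dd B x v)"
proof -
  have h: "(H has_derivative dd H x) (at x)" and a: "(A has_derivative dd A x) (at x)"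
    and b: "(B has_derivative dd B x) (at x)"
    using assms dd_works by auto
  have "((\<lambda>q. f (fst (H q))) has_derivative (\<lambda>v. f' (fst (H x)) * fst (dd H x v))) (at x)"
    using has_derivative_compose[OF has_derivative_fst[OF h] f_deriv[OF assms(4), unfolded has_field_derivative_def]]
    by simp
  then have "((\<lambda>q. rw_metric f (H q) (A q) (B q)) has_derivative
     (\<lambda>v. 2 * f (fst (H x)) * f' (fst (H x)) * fst (dd H x v) * (snd (A x) \<bullet> snd (B x)) +
     rw_metric f (H x) (dd A x v) (B x) + rw_metric f (H x) (A x) (dd B x v))) (at x)"
    unfolding rw_metric_def power2_eq_square
    by (auto intro!: derivative_eq_intros a b simp: algebra_simps)
  from dd_eqI[OF this] show ?thesis
    unfolding dd_eqI[OF dd_rw_metric[OF assms(4)]] by simp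
qed

text \<open>Differentiating the isometry identity in a third direction gives \<open>E\<close>. The
  combination of three instances of \<open>E\<close> with the signs of the Koszul formula isolates
  the second derivative \<open>S\<close> of \<open>F\<close>, because \<open>S\<close> is
  symmetric.\<close>

lemma rw_isometry:
  assumes "isometry_of (rw_metric f) (rw_space I) F" and p: "p \<in> rw_space I"
  shows "inj (dd F p)"
    and "dd (\<lambda>q. dd F q w) p v + christoffel (rw_metric f) (F p) (dd F p v) (dd F p w)
      = dd F p (christoffel (rw_metric f) p v w)"
proof -
  let ?g = "rw_metric f" and ?L = "rw_space I"
  have F: "bij_betw F ?L ?L" "smooth_on ?L F"
    and iso: "\<And>q v w. q \<in> ?L \<Longrightarrow> ?g (F q) (dd F q v) (dd F q w) = ?g q v w"
    using assms(1) unfolding isometry_of_def by blast+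
  have Fp: "F p \<in> ?L" using F(1) p bij_betwE by blast
  have fI: "fst p \<in> I" "fst (F p) \<in> I" using p Fp by (auto simp: rw_space_def)
  have lin: "linear (dd F p)" using smooth_on_linear[OF F(2) p] .
  show inj: "inj (dd F p)"
    unfolding linear_injective_0[OF lin]
  proof (intro allI impI)
    fix v assume "dd F p v = 0"
    then have "?g p v z = ?g p 0 z" for z
      using iso[OF p, of v z] by (simp add: rw_metric_def)
    then show "v = 0" using rw_metric_nondegenerate[OF fI(1)] by blast
  qed
  have surj: "surj (dd F p)" by (rule linear_inj_imp_surj[OF lin inj])
  define S where "S = (\<lambda>v w. dd (\<lambda>q. dd F q w) p v)"
  have sym: "S v w = S w v" for v w
    unfolding S_def by (rule dd_symmetric[OF open_rw_space F(2) p])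
  have dF: "F differentiable (at p)" "(\<lambda>q. dd F q w) differentiable (at p)" for w
    using smooth_on_differentiable[OF F(2) p] smooth_on_differentiable[OF smooth_on_dd[OF F(2)] p] by auto
  have E: "dd (\<lambda>r. ?g r (dd F p w) (dd F p z)) (F p) (dd F p v) + ?g (F p) (S v w) (dd F p z)
      + ?g (F p) (dd F p w) (S v z) = dd (\<lambda>r. ?g r w z) p v" for v w z
  proof -
    have "dd (\<lambda>r. ?g r w z) p = dd (\<lambda>q. ?g (F q) (dd F q w) (dd F q z)) p"
      by (rule dd_cong(1)[OF open_rw_space p])
         (simp_all only: iso differentiableI[OF dd_rw_metric[OF fI(1)]])
    then show ?thesis
      using dd_rw_metric_along[OF dF(1) dF(2)[of w] dF(2)[of z] fI(2), of v] unfolding S_def by simp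
  qed
  define c where "c = christoffel ?g (F p) (dd F p v) (dd F p w)"
  define c0 where "c0 = christoffel ?g p v w"
  have "dd (\<lambda>q. dd F q w) p v + c = dd F p c0"
  proof (rule rw_metric_nondegenerate[OF fI(2)])
    fix y
    obtain z where y: "y = dd F p z" using surj by (metis surjD)
    note bl = bilinear_rw_metric[of f "F p"]
    have k: "2 * ?g (F p) c y = dd (\<lambda>q. ?g q (dd F p w) y) (F p) (dd F p v)
        + dd (\<lambda>q. ?g q (dd F p v) y) (F p) (dd F p w) - dd (\<lambda>q. ?g q (dd F p v) (dd F p w)) (F p) y"
      "2 * ?g p c0 z = dd (\<lambda>q. ?g q w z) p v + dd (\<lambda>q. ?g q v z) p w - dd (\<lambda>q. ?g q v w) p z"
      unfolding c_def c0_def by (rule koszul[OF fI(2)], rule koszul[OF fI(1)])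
    have "2 * ?g (F p) c y + 2 * ?g (F p) (S v w) y = 2 * ?g p c0 z"
      using k E[of w z v] E[of v z w] E[of v w z] rw_metric_commute[of f "F p" "dd F p w" "S v z"]
        rw_metric_commute[of f "F p" "dd F p v" "S w z"]
      unfolding y sym[of z v] sym[of z w] sym[of w v] by linarith
    then show "?g (F p) (dd (\<lambda>q. dd F q w) p v + c) y = ?g (F p) (dd F p c0) y"
      using iso[OF p, of c0 z] by (simp add: y S_def bilinear_ladd[OF bl])
  qed
  then show "dd (\<lambda>q. dd F q w) p v + christoffel ?g (F p) (dd F p v) (dd F p w) = dd F p (christoffel ?g p v w)"
    unfolding c_def c0_def .
qed

text \<open>By the transformation rule for the Christoffel terms, \<open>cov\<close> of
  \<open>F \<circ> X\<close> is the image of \<open>cov\<close> of \<open>X\<close> under the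
  differential of \<open>F\<close>. That differential is injective, so tangency can be pulled
  back.\<close>

lemma isometry_null_dir:
  fixes X :: "real \<times> real \<Rightarrow> spacetime"
  assumes F: "isometry_of (rw_metric f) (rw_space I) F"
    and W: "open W" "smooth_on W X" "X ` W \<subseteq> rw_space I" "x \<in> W"
    and n: "null_dir (rw_metric f) (\<lambda>y. F (X y)) x w"
  shows "null_dir (rw_metric f) X x w"
proof -
  have sF: "smooth_on (rw_space I) F" using F by (simp add: isometry_of_def)
  have p: "X x \<in> rw_space I" using W by blast
  have lin: "linear (dd F (X x))" by (rule smooth_on_linear[OF sF p])
  have d1: "dd (\<lambda>y. F (X y)) x = (\<lambda>v. dd F (X x) (dd X x v))"
    by (rule dd_compose(1)[OF smooth_on_differentiable[OF W(2,4)] smooth_on_differentiable[OF sF p]])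
  have c: "cov (rw_metric f) (\<lambda>y. F (X y)) x w w' = dd F (X x) (cov (rw_metric f) X x w w')" for w'
    unfolding cov_def dd_dd_compose[OF W(1-3) open_rw_space sF W(4)] d1 linear_add[OF lin]
      rw_isometry(2)[OF F p, symmetric] by (simp add: ac_simps)
  show ?thesis
    unfolding null_dir_def
  proof
    fix w'
    have "dd F (X x) (cov (rw_metric f) X x w w') \<in> range (\<lambda>v. dd F (X x) (dd X x v))"
      using n unfolding null_dir_def c d1 by blast
    then obtain v where "dd F (X x) (cov (rw_metric f) X x w w') = dd F (X x) (dd X x v)" by blast
    then show "cov (rw_metric f) X x w w' \<in> range (dd X x)"
      using rw_isometry(1)[OF F p] by (metis injD rangeI)
  qed
qed

lemma cov_plane:
  fixes X :: "real \<times> real \<Rightarrow> spacetime"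
  assumes W: "open W" "smooth_on W X" "x \<in> W" "fst (X x) \<in> I"
  shows "cov (rw_metric f) X x w w' = fst w' *\<^sub>R cov (rw_metric f) X x w (1, 0) + snd w' *\<^sub>R cov (rw_metric f) X x w (0, 1)"
proof -
  have D: "dd (\<lambda>y. dd X y w') x w = fst w' *\<^sub>R dd (\<lambda>y. dd X y (1, 0)) x w + snd w' *\<^sub>R dd (\<lambda>y. dd X y (0, 1)) x w"
  proof -
    have d: "(\<lambda>y. dd X y v) differentiable (at x)" for v
      by (rule smooth_on_differentiable[OF smooth_on_dd[OF W(2)] W(3)])
    have "((\<lambda>y. fst w' *\<^sub>R dd X y (1, 0) + snd w' *\<^sub>R dd X y (0, 1)) has_derivative
      (\<lambda>w. fst w' *\<^sub>R dd (\<lambda>y. dd X y (1, 0)) x w + snd w' *\<^sub>R dd (\<lambda>y. dd X y (0, 1)) x w)) (at x)"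
      by (intro has_derivative_add has_derivative_scaleR_right dd_works d)
    then have "((\<lambda>y. dd X y w') has_derivative
      (\<lambda>w. fst w' *\<^sub>R dd (\<lambda>y. dd X y (1, 0)) x w + snd w' *\<^sub>R dd (\<lambda>y. dd X y (0, 1)) x w)) (at x)"
      by (rule has_derivative_transform_within_open[OF _ W(1,3)])
         (metis plane_linear_apply smooth_on_linear[OF W(2)])
    from dd_eqI[OF this] show ?thesis by simp
  qed
  have L: "dd X x w' = fst w' *\<^sub>R dd X x (1, 0) + snd w' *\<^sub>R dd X x (0, 1)"
    by (rule plane_linear_apply[OF smooth_on_linear[OF W(2,3)]])
  show ?thesis
    unfolding cov_def D rw_christoffel[OF W(4)] L
    by (simp add: algebra_simps inner_add_right)
qed

lemma null_dir_planeI: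
  fixes X :: "real \<times> real \<Rightarrow> spacetime"
  assumes W: "open W" "smooth_on W X" "x \<in> W" "fst (X x) \<in> I"
    and "cov (rw_metric f) X x w (1, 0) \<in> range (dd X x)" "cov (rw_metric f) X x w (0, 1) \<in> range (dd X x)"
  shows "null_dir (rw_metric f) X x w"
  unfolding null_dir_def
proof
  fix w'
  have sub: "subspace (range (dd X x))" using smooth_on_linear[OF W(2,3)] by (simp add: linear_subspace_image)
  show "cov (rw_metric f) X x w w' \<in> range (dd X x)"
    unfolding cov_plane[OF W, of w w']
    by (intro subspace_add[OF sub] subspace_scale[OF sub] assms(5,6))
qed

end

section \<open>The surfaces of the given type have a null direction\<close>

text \<open>If \<open>A\<close> is the matrix with rows \<open>\<alpha>1, \<alpha>2, \<alpha>3\<close>, then \<open>A' = \<Omega> A\<close> with \<open>\<Omega>\<close> skew-symmetric,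
  so the matrix \<open>transpose A ** A\<close> is constant.\<close>

lemma skew_frame_orthonormal:
  fixes \<alpha>1 \<alpha>2 \<alpha>3 :: "real \<Rightarrow> real^3" and a1 a2 :: "real \<Rightarrow> real"
  assumes J: "open_interval J" "v0 \<in> J" "v \<in> J"
    and d1: "\<forall>v\<in>J. (\<alpha>1 has_vector_derivative a1 v *\<^sub>R \<alpha>2 v + a2 v *\<^sub>R \<alpha>3 v) (at v)"
    and d2: "\<forall>v\<in>J. (\<alpha>2 has_vector_derivative - a1 v *\<^sub>R \<alpha>1 v) (at v)"
    and d3: "\<forall>v\<in>J. (\<alpha>3 has_vector_derivative - a2 v *\<^sub>R \<alpha>1 v) (at v)"
    and on: "norm (\<alpha>1 v0) = 1" "norm (\<alpha>2 v0) = 1" "norm (\<alpha>3 v0) = 1"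
      "\<alpha>1 v0 \<bullet> \<alpha>2 v0 = 0" "\<alpha>1 v0 \<bullet> \<alpha>3 v0 = 0" "\<alpha>2 v0 \<bullet> \<alpha>3 v0 = 0"
  shows "norm (\<alpha>2 v) = 1" "\<alpha>1 v \<bullet> \<alpha>2 v = 0"
proof -
  define A :: "real \<Rightarrow> real^3^3" where "A = (\<lambda>v. vector [\<alpha>1 v, \<alpha>2 v, \<alpha>3 v])"
  have row: "row 1 (A v) = \<alpha>1 v" "row 2 (A v) = \<alpha>2 v" "row 3 (A v) = \<alpha>3 v" for v
    by (simp_all add: A_def row_def vec_lambda_eta)
  have orth: "orthogonal_matrix (A v) \<longleftrightarrow> norm (\<alpha>1 v) = 1 \<and> norm (\<alpha>2 v) = 1 \<and> norm (\<alpha>3 v) = 1 \<and>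
     \<alpha>1 v \<bullet> \<alpha>2 v = 0 \<and> \<alpha>1 v \<bullet> \<alpha>3 v = 0 \<and> \<alpha>2 v \<bullet> \<alpha>3 v = 0" for v
    unfolding orthogonal_matrix_orthonormal_rows orthogonal_def
    by (auto simp: forall_3 row inner_commute)
  have J': "convex J" "open J"
    using J(1) is_interval_convex by (auto simp: open_interval_def)
  have "(transpose (A v) ** A v) $ j $ k = (transpose (A v0) ** A v0) $ j $ k" for j k
  proof -
    \<comment> \<open>Working with the mutual inner products of the frame vectors would give a
      coupled linear system and call for a uniqueness theorem. The entries of
      \<open>transpose A ** A\<close> simply have derivative zero, because the contributions of the
      skew matrix cancel.\<close>
    let ?h = "\<lambda>v. \<alpha>1 v $ j * \<alpha>1 v $ k + \<alpha>2 v $ j * \<alpha>2 v $ k + \<alpha>3 v $ j * \<alpha>3 v $ k"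
    have comp: "(transpose (A v) ** A v) $ j $ k = ?h v" for v
      by (simp add: matrix_matrix_mult_def transpose_def A_def sum_3)
    have c: "((\<lambda>v. \<beta> v $ i) has_real_derivative \<beta>' $ i) (at v)"
      if "(\<beta> has_vector_derivative \<beta>') (at v)" for \<beta> :: "real \<Rightarrow> real^3" and \<beta>' i v
      using bounded_linear.has_vector_derivative[OF bounded_linear_vec_nth that]
      by (simp add: has_real_derivative_iff_has_vector_derivative)
    have z: "(?h has_derivative (\<lambda>h. 0)) (at u within J)" if u: "u \<in> J" for u
    proof -
      note e1 = c[OF bspec[OF d1 u]] and e2 = c[OF bspec[OF d2 u]] and e3 = c[OF bspec[OF d3 u]]
      have "(?h has_real_derivative 0) (at u)"
        by (rule derivative_eq_intros e1 e2 e3 refl)+ (simp add: algebra_simps)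
      then show ?thesis
        by (simp add: has_field_derivative_def lambda_zero has_derivative_at_withinI)
    qed
    have "\<exists>c. \<forall>x\<in>J. ?h x = c"
      by (rule has_derivative_zero_constant[OF J'(1)]) (rule z)
    then have "?h v = ?h v0" using J(2,3) by auto
    then show ?thesis unfolding comp .
  qed
  then have "transpose (A v) ** A v = transpose (A v0) ** A v0" by (simp add: vec_eq_iff)
  moreover have "orthogonal_matrix (A v0)" unfolding orth using on by simp
  ultimately have "orthogonal_matrix (A v)" by (simp add: orthogonal_matrix)
  then show "norm (\<alpha>2 v) = 1" "\<alpha>1 v \<bullet> \<alpha>2 v = 0" unfolding orth by blast+
qed

lemma interval_integral_has_real_derivative:
  fixes h :: "real \<Rightarrow> real"
  assumes J: "open_interval J" "u0 \<in> J" "u \<in> J" and h: "continuous_on J h"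
  shows "((\<lambda>u. LBINT s=ereal u0..ereal u. h s) has_real_derivative h u) (at u)"
proof -
  have oJ: "open J" "is_interval J" using J(1) by (auto simp: open_interval_def)
  obtain e where e: "e > 0" "cball u e \<subseteq> J" using oJ(1) J(3) open_contains_cball by blast
  obtain e0 where e0: "e0 > 0" "cball u0 e0 \<subseteq> J" using oJ(1) J(2) open_contains_cball by blast
  \<comment> \<open>The interval reaches beyond both points: it contains \<open>u0\<close> on either
    side of \<open>u\<close>, and \<open>u\<close> is interior, so the derivative within
    \<open>{a..b}\<close> is a full derivative.\<close>
  define a where "a = min (u - e) (u0 - e0)"
  define b where "b = max (u + e) (u0 + e0)"
  have "u - e \<in> J" "u + e \<in> J"
    by (rule subsetD[OF e(2)], use e in \<open>simp add: dist_real_def\<close>)+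
  moreover have "u0 - e0 \<in> J" "u0 + e0 \<in> J"
    by (rule subsetD[OF e0(2)], use e0 in \<open>simp add: dist_real_def\<close>)+
  ultimately have "a \<in> J" "b \<in> J" by (simp_all add: a_def b_def min_def max_def)
  then have sub: "{a..b} \<subseteq> J" using mem_is_interval_1_I[OF oJ(2)] by (meson atLeastAtMost_iff subsetI)
  have ab: "a < u" "u < b" "a \<le> u0" "u0 \<le> b" using e e0 by (auto simp: a_def b_def)
  have "((\<lambda>u. LBINT s=ereal u0..ereal u. h s) has_vector_derivative h u) (at u within {a..b})"
    by (rule interval_integral_FTC2) (use ab h sub in \<open>auto intro: continuous_on_subset\<close>)
  moreover have "at u within {a..b} = at u"
    using ab by (intro at_within_interior) (simp add: interior_atLeastAtMost_real)
  ultimately show ?thesis by (simp add: has_real_derivative_iff_has_vector_derivative)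
qed

context robertson_walker
begin

text \<open>Here \<open>p\<close> is the derivative dr/dt of the arc length along a null line with
  respect to time. The formula is the equation \<open>t_rr = 2 (f'/f) t_r^2 - f f'\<close> rewritten
  for \<open>p = 1 / t_r\<close>.\<close>

lemma profile_derivative:
  assumes "t \<in> I" "a\<^sup>2 - (f t)\<^sup>2 > 0"
  defines "p \<equiv> \<lambda>s. a / (f s * sqrt (a\<^sup>2 - (f s)\<^sup>2))"
  shows "(p has_real_derivative f t * f' t * (p t)^3 - 2 * (f' t / f t) * p t) (at t)"
proof -
  define R where "R = sqrt (a\<^sup>2 - (f t)\<^sup>2)"
  have R: "R > 0" "R\<^sup>2 = a\<^sup>2 - (f t)\<^sup>2" using assms(2) by (auto simp: R_def)
  have fn: "f t \<noteq> 0" using nonzero assms(1) by blast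
  note d = f_deriv[OF assms(1)]
  have dR: "((\<lambda>s. sqrt (a\<^sup>2 - (f s)\<^sup>2)) has_real_derivative - f t * f' t / R) (at t)"
  proof -
    have "((\<lambda>s. a\<^sup>2 - (f s)\<^sup>2) has_real_derivative - (2 * f t * f' t)) (at t)"
      by (auto intro!: derivative_eq_intros d)
    from DERIV_chain2[OF DERIV_real_sqrt[OF assms(2)] this] show ?thesis
      using R(1) by (simp add: R_def[symmetric] field_simps)
  qed
  have "(p has_real_derivative - a * (f' t * R + f t * (- f t * f' t / R)) / (f t * R)\<^sup>2) (at t)"
    unfolding p_def
    by (rule DERIV_cong[OF DERIV_divide[OF DERIV_const DERIV_mult[OF d dR]]])
       (use fn R(1) in \<open>simp_all add: R_def[symmetric]\<close>, simp add: power2_eq_square mult.commute)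
  moreover have "- a * (f' t * R + f t * (- f t * f' t / R)) / (f t * R)\<^sup>2
     = f t * f' t * (p t)^3 - 2 * (f' t / f t) * p t"
  proof -
    have pt: "p t = a / (f t * R)" by (simp add: p_def R_def)
    have a2: "a\<^sup>2 = R\<^sup>2 + (f t)\<^sup>2" using R(2) by simp
    have a3: "a^3 = a * (R\<^sup>2 + (f t)\<^sup>2)" using a2 by (simp add: power3_eq_cube power2_eq_square)
    show ?thesis
      unfolding pt power_divide power_mult_distrib a3 using fn R(1)
      by (simp add: divide_simps) (simp add: algebra_simps power2_eq_square power3_eq_cube)
  qed
  ultimately show ?thesis by simp
qed

text \<open>The differential equations for the \<phi>i and \<alpha>i cancel everything in the
  v-derivative except a multiple of \<alpha>1, while the u-derivative is
  \<open>(1, p \<alpha>2)\<close>. In this orthogonal frame both covariant derivatives along u are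
  multiples of coordinate vectors, so explicit preimages exist.\<close>

lemma nullity_surface_null_dir:
  assumes "nullity_surface f I D \<phi>" and x: "x \<in> D"
  shows "null_dir (rw_metric f) \<phi> x (1, 0)"
proof -
  obtain Iu Iv u0 v0 a a1 a2 \<phi>1 \<phi>2 \<phi>3 \<alpha>1 \<alpha>2 \<alpha>3 where
    Iu: "open_interval Iu" "Iu \<subseteq> I" "u0 \<in> Iu" and Iv: "open_interval Iv" "v0 \<in> Iv"
    and a: "\<And>u. u \<in> Iu \<Longrightarrow> a\<^sup>2 - (f u)\<^sup>2 > 0"
    and s: "smooth_on Iv \<phi>1" "smooth_on Iv \<phi>2" "smooth_on Iv \<phi>3"
    and d\<phi>: "\<forall>v\<in>Iv. (\<phi>2 has_real_derivative - a1 v * \<phi>1 v) (at v)"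
       "\<forall>v\<in>Iv. (\<phi>3 has_real_derivative - a2 v * \<phi>1 v) (at v)"
    and d\<alpha>: "\<forall>v\<in>Iv. (\<alpha>1 has_vector_derivative a1 v *\<^sub>R \<alpha>2 v + a2 v *\<^sub>R \<alpha>3 v) (at v)"
       "\<forall>v\<in>Iv. (\<alpha>2 has_vector_derivative - a1 v *\<^sub>R \<alpha>1 v) (at v)"
       "\<forall>v\<in>Iv. (\<alpha>3 has_vector_derivative - a2 v *\<^sub>R \<alpha>1 v) (at v)"
    and on: "norm (\<alpha>1 v0) = 1" "norm (\<alpha>2 v0) = 1" "norm (\<alpha>3 v0) = 1"
      "\<alpha>1 v0 \<bullet> \<alpha>2 v0 = 0" "\<alpha>1 v0 \<bullet> \<alpha>3 v0 = 0" "\<alpha>2 v0 \<bullet> \<alpha>3 v0 = 0"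
    and D: "D \<subseteq> Iu \<times> Iv" and imm: "immersion_on D \<phi>"
    and \<phi>: "\<forall>(u, v)\<in>D. \<phi> (u, v) =
          (u, \<phi>1 v *\<^sub>R \<alpha>1 v
              + ((LBINT s=u0..u. a / (f s * sqrt (a\<^sup>2 - (f s)\<^sup>2))) + \<phi>2 v) *\<^sub>R \<alpha>2 v
              + \<phi>3 v *\<^sub>R (\<alpha>3 v :: real^3))"
    using assms(1) unfolding nullity_surface_def by (elim exE conjE) (rule that; assumption?; blast)
  define p where "p = (\<lambda>s. a / (f s * sqrt (a\<^sup>2 - (f s)\<^sup>2)))"
  define \<Theta> where "\<Theta> = (\<lambda>u. LBINT s=ereal u0..ereal u. p s)"
  have inj: "inj (dd \<phi> y)" if "y \<in> D" for y
    using imm that by (simp add: immersion_on_def)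
  have oD: "open D" and sD: "smooth_on D \<phi>" using imm by (auto simp: immersion_on_def)
  have dp: "(p has_real_derivative f u * f' u * (p u)^3 - 2 * (f' u / f u) * p u) (at u)" if "u \<in> Iu" for u
    unfolding p_def using profile_derivative a that Iu(2) by blast
  have "continuous_on Iu p"
    using dp DERIV_isCont continuous_at_imp_continuous_on by blast
  then have d\<Theta>: "(\<Theta> has_real_derivative p u) (at u)" if "u \<in> Iu" for u
    unfolding \<Theta>_def using interval_integral_has_real_derivative[OF Iu(1,3) that] by blast
  have \<phi>': "\<phi> y = (fst y, \<phi>1 (snd y) *\<^sub>R \<alpha>1 (snd y) + (\<Theta> (fst y) + \<phi>2 (snd y)) *\<^sub>R \<alpha>2 (snd y) + \<phi>3 (snd y) *\<^sub>R \<alpha>3 (snd y))"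
    if "y \<in> D" for y
    using \<phi> that by (auto simp: \<Theta>_def p_def split_beta)
  have fs: "(fst has_derivative fst) (at y)" "(snd has_derivative snd) (at y)" for y :: "real \<times> real"
    by (auto intro: bounded_linear_imp_has_derivative bounded_linear_fst bounded_linear_snd)
  \<comment> \<open>The coefficient of \<alpha>1 in the v-derivative of \<phi>; those of \<alpha>2
    and \<alpha>3 vanish by the equations for \<phi>2 and \<phi>3.\<close>
  define G where "G = (\<lambda>y. vector_derivative \<phi>1 (at (snd y)) - (\<Theta> (fst y) + \<phi>2 (snd y)) * a1 (snd y) - \<phi>3 (snd y) * a2 (snd y))"
  have der: "(\<phi> has_derivative (\<lambda>k. (fst k, (p (fst y) * fst k) *\<^sub>R \<alpha>2 (snd y) + (G y * snd k) *\<^sub>R \<alpha>1 (snd y)))) (at y)"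
    if y: "y \<in> D" for y
  proof -
    obtain u v where uv: "y = (u, v)" "u \<in> Iu" "v \<in> Iv" using D y by (cases y) auto
    have "(\<Theta> has_derivative (*) (p u)) (at (fst y))"
      using d\<Theta>[OF uv(2)] uv(1) by (simp add: has_field_derivative_def)
    from has_derivative_compose[OF fs(1) this]
    have 1: "((\<lambda>y. \<Theta> (fst y)) has_derivative (\<lambda>k. p u * fst k)) (at y)" .
    have "\<phi>1 differentiable (at v)" using smooth_on_differentiable[OF s(1) uv(3)] .
    then have "(\<phi>1 has_vector_derivative vector_derivative \<phi>1 (at v)) (at v)"
      by (simp add: vector_derivative_works)
    then have 2: "((\<lambda>y. \<phi>1 (snd y)) has_derivative (\<lambda>k. snd k *\<^sub>R vector_derivative \<phi>1 (at v))) (at y)"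
      using has_derivative_compose[OF fs(2), of \<phi>1] uv unfolding has_vector_derivative_def by force
    have 3: "((\<lambda>y. \<beta> (snd y)) has_derivative (\<lambda>k. snd k *\<^sub>R b)) (at y)"
      if "(\<beta> has_vector_derivative b) (at v)" for \<beta> :: "real \<Rightarrow> 'z::real_normed_vector" and b
      using has_derivative_compose[OF fs(2), of \<beta>] that uv unfolding has_vector_derivative_def by force
    have 4: "((\<lambda>y. \<phi>2 (snd y)) has_derivative (\<lambda>k. snd k *\<^sub>R (- a1 v * \<phi>1 v))) (at y)"
      "((\<lambda>y. \<phi>3 (snd y)) has_derivative (\<lambda>k. snd k *\<^sub>R (- a2 v * \<phi>1 v))) (at y)"
      using 3 d\<phi> uv(3) has_real_derivative_iff_has_vector_derivative by blast+
    have "((\<lambda>y. (fst y, \<phi>1 (snd y) *\<^sub>R \<alpha>1 (snd y) + (\<Theta> (fst y) + \<phi>2 (snd y)) *\<^sub>R \<alpha>2 (snd y) + \<phi>3 (snd y) *\<^sub>R \<alpha>3 (snd y)))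
      has_derivative (\<lambda>k. (fst k, (p (fst y) * fst k) *\<^sub>R \<alpha>2 (snd y) + (G y * snd k) *\<^sub>R \<alpha>1 (snd y)))) (at y)"
      by (rule derivative_eq_intros fs 1 2 4 3[OF bspec[OF d\<alpha>(1) uv(3)]] 3[OF bspec[OF d\<alpha>(2) uv(3)]]
           3[OF bspec[OF d\<alpha>(3) uv(3)]] refl)+
         (simp add: fun_eq_iff uv G_def algebra_simps)
    then show ?thesis
      by (rule has_derivative_transform_within_open[OF _ oD y]) (simp add: \<phi>')
  qed
  note dd\<phi> = dd_eqI[OF der]
  obtain u v where uv: "x = (u, v)" "u \<in> Iu" "v \<in> Iv" using D x by (cases x) auto
  have tI: "fst (\<phi> x) \<in> I" "fst (\<phi> x) = u" using uv Iu(2) \<phi>'[OF x] by auto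
  note orth = skew_frame_orthonormal[OF Iv uv(3) d\<alpha> on]
  have der2: "((\<lambda>y. dd \<phi> y (1, 0)) has_derivative
     (\<lambda>k. (0, ((f u * f' u * (p u)^3 - 2 * (f' u / f u) * p u) * fst k) *\<^sub>R \<alpha>2 v + (p u * snd k) *\<^sub>R (- a1 v *\<^sub>R \<alpha>1 v)))) (at x)"
  proof -
    have 1: "((\<lambda>y. p (fst y)) has_derivative (\<lambda>k. (f u * f' u * (p u)^3 - 2 * (f' u / f u) * p u) * fst k)) (at x)"
      using has_derivative_compose[OF fs(1)[of x], of p] dp[OF uv(2)] uv(1)
      unfolding has_field_derivative_def by force
    have 2: "((\<lambda>y. \<alpha>2 (snd y)) has_derivative (\<lambda>k. snd k *\<^sub>R (- a1 v *\<^sub>R \<alpha>1 v))) (at x)"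
      using has_derivative_compose[OF fs(2)[of x], of \<alpha>2] bspec[OF d\<alpha>(2) uv(3)] uv(1)
      unfolding has_vector_derivative_def by force
    have "((\<lambda>y. (1, p (fst y) *\<^sub>R \<alpha>2 (snd y))) has_derivative
     (\<lambda>k. (0, ((f u * f' u * (p u)^3 - 2 * (f' u / f u) * p u) * fst k) *\<^sub>R \<alpha>2 v + (p u * snd k) *\<^sub>R (- a1 v *\<^sub>R \<alpha>1 v)))) (at x)"
      by (rule derivative_eq_intros 1 2 refl)+ (simp add: fun_eq_iff uv algebra_simps)
    then show ?thesis
      by (rule has_derivative_transform_within_open[OF _ oD x]) (simp add: dd\<phi>)
  qed
  \<comment> \<open>Here the immersion hypothesis enters: without it the v-derivative could vanish,
    and \<alpha>1 would not have to be tangent.\<close>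
  have G0: "G x \<noteq> 0"
  proof
    assume "G x = 0"
    then have "dd \<phi> x (0, 1) = dd \<phi> x (0, 0)" by (simp add: dd\<phi>[OF x])
    then show False using inj[OF x] by (metis injD prod.inject zero_neq_one)
  qed
  have f0: "f u \<noteq> 0" using nonzero uv(2) Iu(2) by blast
  \<comment> \<open>In the \<alpha>2-component the Christoffel term \<open>2 (f'/f) p\<close>
    cancels the linear term of the derivative of \<open>p\<close>, leaving \<open>f f' p^3\<close>,
    that is \<open>f f' p^2\<close> times the spatial part of the u-derivative.\<close>
  have "cov (rw_metric f) \<phi> x (1, 0) (1, 0) = dd \<phi> x (f u * f' u * (p u)\<^sup>2, 0)"
    unfolding cov_def dd_eqI[OF der2] rw_christoffel[OF tI(1)] dd\<phi>[OF x] tI(2)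
    using orth(1) by (simp add: uv(1) scaleR_add_left[symmetric] dot_square_norm power2_eq_square power3_eq_cube)
  moreover have "cov (rw_metric f) \<phi> x (1, 0) (0, 1) = dd \<phi> x (0, f' u / f u - p u * a1 v / G x)"
    unfolding cov_def dd_symmetric[OF oD sD x, of "(0, 1)" "(1, 0)"] dd_eqI[OF der2] rw_christoffel[OF tI(1)] dd\<phi>[OF x] tI(2)
    using orth(2) G0 by (simp add: uv(1) inner_commute algebra_simps)
  ultimately show ?thesis
    by (intro null_dir_planeI[OF oD sD x tI(1)]) auto
qed

text \<open>A congruence provides \<sigma> only as a homeomorphism. That
  \<open>\<psi> \<circ> \<sigma>\<close> is smooth follows by applying the smooth inverse of
  \<open>F\<close> to \<phi>, and that it is an immersion from the chain rule for \<phi>. So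
  \<sigma> is a local parametrization, in which the first coordinate direction is null.\<close>

lemma locally_congruent_imp_positive_relative_nullity:
  fixes M :: "'m::topological_space set"
  assumes sp: "spacelike_surface (rw_metric f) (rw_space I) M \<psi>"
    and lc: "locally_congruent (rw_metric f) (rw_space I) M \<psi> (nullity_surface f I)"
  shows "positive_relative_nullity (rw_metric f) M \<psi>"
  unfolding positive_relative_nullity_def
proof
  fix p assume p: "p \<in> M"
  let ?L = "rw_space I" and ?g = "rw_metric f"
  obtain U F D \<phi> W \<sigma> \<tau> where U: "openin (top_of_set M) U" "p \<in> U" and F: "isometry_of ?g ?L F"
    and D: "nullity_surface f I D \<phi>" "open W" "W \<subseteq> D"
    and h: "homeomorphism W U \<sigma> \<tau>" and eq': "\<forall>x\<in>W. F (\<psi> (\<sigma> x)) = \<phi> x"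
    using bspec[OF lc[unfolded locally_congruent_def] p] by (elim exE conjE) (rule that; assumption)
  note eq = bspec[OF eq']
  let ?X = "\<psi> \<circ> \<sigma>"
  have UW: "U = \<sigma> ` W" using h by (simp add: homeomorphism_def)
  obtain x where x: "x \<in> W" "\<sigma> x = p" using U(2) UW by blast
  have imm: "open D" "smooth_on D \<phi>" "\<And>y. y \<in> D \<Longrightarrow> inj (dd \<phi> y)"
    using D(1) by (auto simp: nullity_surface_def immersion_on_def)
  have "\<psi> ` M \<subseteq> ?L" using sp by (simp add: spacelike_surface_def immersed_surface_def)
  then have XL: "?X ` W \<subseteq> ?L" using U(1) UW openin_imp_subset by fastforce
  have bF: "bij_betw F ?L ?L" and sF: "smooth_on ?L F" and sG: "smooth_on ?L (inv_into ?L F)"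
    using F by (auto simp: isometry_of_def)
  have G: "inv_into ?L F (\<phi> y) = ?X y" "\<phi> y \<in> ?L" if "y \<in> W" for y
  proof -
    have "?X y \<in> ?L" using XL that by blast
    then show "inv_into ?L F (\<phi> y) = ?X y" "\<phi> y \<in> ?L"
      using eq[OF that] bij_betwE[OF bF, rule_format, of "?X y"]
        inv_into_f_f[OF bij_betw_imp_inj_on[OF bF], of "?X y"] by simp_all
  qed
  have s\<phi>: "smooth_on W \<phi>" using imm(2) D(3) by (rule smooth_on_subset)
  have "smooth_on W (\<lambda>y. inv_into ?L F (\<phi> y))"
    by (rule smooth_on_compose[OF D(2) _ s\<phi> sG]) (use G(2) in blast)
  then have sX: "smooth_on W ?X" by (rule smooth_on_cong[OF D(2) G(1), rotated])
  have e: "\<phi> y = F (?X y)" if "y \<in> W" for y using eq[OF that] by simp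
  have dd: "dd \<phi> y = dd (\<lambda>y. F (?X y)) y" "null_dir ?g \<phi> y = null_dir ?g (\<lambda>y. F (?X y)) y" if "y \<in> W" for y
    by (rule null_dir_cong[OF D(2) s\<phi> _ that], rule e, assumption)+
  have "inj (dd ?X y)" if y: "y \<in> W" for y
  proof -
    have XyL: "?X y \<in> ?L" using XL y by blast
    have "dd \<phi> y = (\<lambda>v. dd F (?X y) (dd ?X y v))"
      unfolding dd(1)[OF y] by (rule dd_compose(1)[OF smooth_on_differentiable[OF sX y] smooth_on_differentiable[OF sF XyL]])
    moreover have "inj (dd \<phi> y)" using imm(3) D(3) y by blast
    ultimately show ?thesis by (metis (no_types, lifting) injD injI)
  qed
  then have "immersion_on W ?X" using D(2) sX by (simp add: immersion_on_def)
  then have lp: "local_param M \<psi> W \<sigma>" using U(1) h UW by (auto simp: local_param_def)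
  have "null_dir ?g \<phi> x (1, 0)" using nullity_surface_null_dir[OF D(1)] D(3) x(1) by blast
  then have nd: "null_dir ?g ?X x (1, 0)"
    using isometry_null_dir[OF F D(2) sX XL x(1)] unfolding dd(2)[OF x(1)] by blast
  have "pos_def_on (?g (\<psi> (\<sigma> x))) (tangent_plane M \<psi> (\<sigma> x))"
    using sp p x(2) by (simp add: spacelike_surface_def)
  then have "pos_def_on (?g (?X x)) (range (dd ?X x))" by (simp add: tangent_plane_eq[OF lp x(1)])
  then have "\<forall>w'. second_fundamental_form ?g ?X x (1, 0) w' = 0"
    using second_fundamental_form_null[OF \<open>immersion_on W ?X\<close> x(1)] nd by blast
  then have "dd ?X x (1, 0) \<in> relative_null_space ?g M \<psi> p"
    unfolding relative_null_space_def using lp x by blast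
  moreover have "dd ?X x (1, 0) \<noteq> 0"
    using \<open>immersion_on W ?X\<close> x(1) linear_injective_0[OF smooth_on_linear[OF sX x(1)]]
    unfolding immersion_on_def by (metis prod.inject zero_neq_one zero_prod_def)
  ultimately have "\<not> relative_null_space ?g M \<psi> p \<subseteq> {0}" by blast
  then show "dim (relative_null_space ?g M \<psi> p) > 0"
    using dim_eq_0 by blast
qed

end

unbundle cross3_syntax

section \<open>Flat surfaces in Euclidean space\<close>

lemma dd_inner:
  fixes a b :: "'a::real_normed_vector \<Rightarrow> 'b::real_inner"
  assumes "a differentiable (at x)" "b differentiable (at x)"
  shows "dd (\<lambda>y. a y \<bullet> b y) x v = a x \<bullet> dd b x v + dd a x v \<bullet> b x"
  by (simp add: dd_bounded_bilinear(1)[OF bounded_bilinear_inner assms])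

lemma dd_scaleR:
  fixes a :: "'a::real_normed_vector \<Rightarrow> real" and b :: "'a \<Rightarrow> 'b::real_normed_vector"
  assumes "a differentiable (at x)" "b differentiable (at x)"
  shows "dd (\<lambda>y. a y *\<^sub>R b y) x v = a x *\<^sub>R dd b x v + dd a x v *\<^sub>R b x"
  by (simp add: dd_bounded_bilinear(1)[OF bounded_bilinear_scaleR assms])

lemma dd_mult:
  fixes a b :: "'a::real_normed_vector \<Rightarrow> real"
  assumes "a differentiable (at x)" "b differentiable (at x)"
  shows "dd (\<lambda>y. a y * b y) x v = a x * dd b x v + dd a x v * b x"
  by (simp add: dd_bounded_bilinear(1)[OF bounded_bilinear_mult assms])

lemma dd_eq_0:
  assumes "open S" "x \<in> S" "\<And>y. y \<in> S \<Longrightarrow> f y = c"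
  shows "dd f x v = 0"
proof -
  have "dd (\<lambda>y. c) x = dd f x"
    by (rule dd_cong(1)[OF assms(1,2)]) (simp_all add: assms(3))
  then show ?thesis by (metis frechet_derivative_const)
qed

lemma smooth_on_cross3:
  assumes "open S" "smooth_on S a" "smooth_on S b"
  shows "smooth_on S (\<lambda>y. a y \<times> b y)"
  by (rule smooth_on_bounded_bilinear[OF _ assms]) (simp add: bilinear_conv_bounded_bilinear[symmetric] bilinear_cross)

text \<open>By Lagrange's identity \<open>r\<close> has zero cross product with
  \<open>a \<times> b\<close>, hence is parallel to it; being also orthogonal to it, it
  vanishes.\<close>

lemma cross3_collinear_orthogonal:
  fixes r a b :: "real^3"
  assumes "r \<bullet> a = 0" "r \<bullet> b = 0" "r \<bullet> (a \<times> b) = 0" "a \<times> b \<noteq> 0"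
  shows "r = 0"
proof -
  have "r \<times> (a \<times> b) = 0" using assms(1,2) by (simp add: Lagrange)
  then show ?thesis using assms(3,4) norm_and_cross_eq_0 by blast
qed

text \<open>Cramer's rule for the Gram matrix of a plane in space, whose determinant is the squared
  length of the cross product. The coordinates of a tangent vector become smooth expressions in
  inner products.\<close>

lemma plane_gram:
  fixes L :: "real \<times> real \<Rightarrow> real^3"
  assumes L: "linear L" "inj L"
  defines "a \<equiv> L (1, 0)" and "b \<equiv> L (0, 1)"
  shows "(a \<bullet> a) * (b \<bullet> b) - (a \<bullet> b) * (a \<bullet> b) > 0" and "a \<times> b \<noteq> 0"
    and "(a \<times> b) \<bullet> L w = 0"
    and "v \<bullet> (a \<times> b) = 0 \<Longrightarrow>
     L (((v \<bullet> a) * (b \<bullet> b) - (v \<bullet> b) * (a \<bullet> b)) / ((a \<bullet> a) * (b \<bullet> b) - (a \<bullet> b) * (a \<bullet> b)),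
        ((v \<bullet> b) * (a \<bullet> a) - (v \<bullet> a) * (a \<bullet> b)) / ((a \<bullet> a) * (b \<bullet> b) - (a \<bullet> b) * (a \<bullet> b))) = v"
proof -
  note p = plane_linear_apply[OF L(1), folded a_def b_def]
  have z: "k = 0" if "L k = 0" for k using that L linear_injective_0 by blast
  let ?d = "(a \<bullet> a) * (b \<bullet> b) - (a \<bullet> b) * (a \<bullet> b)"
  have nz: "b \<noteq> 0" using z[of "(0, 1)"] by (auto simp: b_def zero_prod_def)
  have "?d \<noteq> 0"
  proof
    assume "?d = 0"
    \<comment> \<open>A multiple of the part of \<open>a\<close> orthogonal to \<open>b\<close>; its
      squared length is \<open>b \<bullet> b\<close> times the Gram determinant.\<close>
    define u where "u = L (b \<bullet> b, - (a \<bullet> b))"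
    have "u \<bullet> u = (b \<bullet> b) * ?d"
      unfolding u_def p by (simp add: inner_simps inner_commute algebra_simps)
    then have "u = 0" using \<open>?d = 0\<close> by simp
    then have "(b \<bullet> b, - (a \<bullet> b)) = 0" using z unfolding u_def by blast
    then show False using nz by (simp add: zero_prod_def)
  qed
  moreover have "(norm (a \<times> b))\<^sup>2 = ?d"
    using norm_cross_dot[of a b] unfolding power_mult_distrib power2_norm_eq_inner
    by (simp add: power2_eq_square)
  ultimately show d: "?d > 0" and n: "a \<times> b \<noteq> 0"
    by (metis less_eq_real_def zero_le_power2, auto)
  show "(a \<times> b) \<bullet> L w = 0" unfolding p by (simp add: inner_add_right dot_cross_self)
  let ?x = "((v \<bullet> a) * (b \<bullet> b) - (v \<bullet> b) * (a \<bullet> b)) / ?d" and ?y = "((v \<bullet> b) * (a \<bullet> a) - (v \<bullet> a) * (a \<bullet> b)) / ?d"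
  assume v: "v \<bullet> (a \<times> b) = 0"
  let ?r = "v - L (?x, ?y)"
  have cramer: "((s * B - t * C) / D) * A + ((t * A - s * C) / D) * C = s"
    "((s * B - t * C) / D) * C + ((t * A - s * C) / D) * B = t"
    if "D = A * B - C * C" "D > 0" for A B C D s t :: real
  proof -
    have "((s * B - t * C) / D) * A + ((t * A - s * C) / D) * C = s * D / D"
      "((s * B - t * C) / D) * C + ((t * A - s * C) / D) * B = t * D / D"
      unfolding times_divide_eq_left add_divide_distrib[symmetric] that(1) by (simp_all add: algebra_simps)
    then show "((s * B - t * C) / D) * A + ((t * A - s * C) / D) * C = s"
      "((s * B - t * C) / D) * C + ((t * A - s * C) / D) * B = t" using that(2) by simp_all
  qed
  have "?x * (a \<bullet> a) + ?y * (a \<bullet> b) = v \<bullet> a" "?x * (a \<bullet> b) + ?y * (b \<bullet> b) = v \<bullet> b"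
    using cramer[OF refl d, of "v \<bullet> a" "v \<bullet> b"] by simp_all
  then have "?r \<bullet> a = 0" "?r \<bullet> b = 0"
    unfolding p by (simp_all add: inner_diff_left inner_add_left inner_commute[of b a])
  moreover have "?r \<bullet> (a \<times> b) = 0"
    using v unfolding p by (simp add: inner_simps dot_cross_self)
  ultimately have "?r = 0" using cross3_collinear_orthogonal n by blast
  then show "L (?x, ?y) = v" by simp
qed

text \<open>Pointwise choice of preimages would give no smoothness; the Gram formula selects them by
  one smooth expression.\<close>

lemma smooth_tangent_coordinates:
  fixes x :: "real \<times> real \<Rightarrow> real^3"
  assumes W: "open W" "smooth_on W x" "\<And>y. y \<in> W \<Longrightarrow> inj (dd x y)"
    and V: "smooth_on W V" "\<And>y. y \<in> W \<Longrightarrow> V y \<in> range (dd x y)"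
  obtains k where "smooth_on W k" "\<And>y. y \<in> W \<Longrightarrow> dd x y (k y) = V y"
proof -
  let ?a = "\<lambda>y. dd x y (1, 0)" and ?b = "\<lambda>y. dd x y (0, 1)"
  let ?d = "\<lambda>y. (?a y \<bullet> ?a y) * (?b y \<bullet> ?b y) - (?a y \<bullet> ?b y) * (?a y \<bullet> ?b y)"
  let ?k = "\<lambda>y. (((V y \<bullet> ?a y) * (?b y \<bullet> ?b y) - (V y \<bullet> ?b y) * (?a y \<bullet> ?b y)) / ?d y,
        ((V y \<bullet> ?b y) * (?a y \<bullet> ?a y) - (V y \<bullet> ?a y) * (?a y \<bullet> ?b y)) / ?d y)"
  have g: "?d y \<noteq> 0" "dd x y (?k y) = V y" if y: "y \<in> W" for y
  proof -
    note pg = plane_gram[OF smooth_on_linear[OF W(2) y] W(3)[OF y]]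
    show "?d y \<noteq> 0" using pg(1) by simp
    obtain w where "V y = dd x y w" using V(2)[OF y] by (rule rangeE)
    then have "V y \<bullet> (?a y \<times> ?b y) = 0" using pg(3) by (metis inner_commute)
    then show "dd x y (?k y) = V y" by (rule pg(4))
  qed
  have "smooth_on W ?k"
    by (intro smooth_on_Pair smooth_on_divide smooth_on_diff smooth_on_mult smooth_on_inner W(1) V(1)
        smooth_on_dd W(2) g(1))
  then show thesis using that[of ?k] g(2) by simp
qed

text \<open>The Euclidean second fundamental form of \<open>x\<close> with respect to the (not normalized) normal
  vector \<open>x\<^sub>1 \<times> x\<^sub>2\<close>.\<close>

definition cross_normal :: "(real \<times> real \<Rightarrow> real^3) \<Rightarrow> real \<times> real \<Rightarrow> real^3"
  where "cross_normal x y = dd x y (1, 0) \<times> dd x y (0, 1)"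

definition esff :: "(real \<times> real \<Rightarrow> real^3) \<Rightarrow> real \<times> real \<Rightarrow> real \<times> real \<Rightarrow> real \<times> real \<Rightarrow> real"
  where "esff x y w w' = cross_normal x y \<bullet> dd (\<lambda>z. dd x z w) y w'"

locale euclidean_patch =
  fixes W :: "(real \<times> real) set" and x :: "real \<times> real \<Rightarrow> real^3"
  assumes open_W: "open W" and smooth_x: "smooth_on W x" and inj_x: "y \<in> W \<Longrightarrow> inj (dd x y)"
begin

lemma linear_x: "y \<in> W \<Longrightarrow> linear (dd x y)"
  by (rule smooth_on_linear[OF smooth_x])

lemma smooth_normal: "smooth_on W (cross_normal x)"
  unfolding cross_normal_def[abs_def] by (intro smooth_on_cross3 open_W smooth_on_dd smooth_x)

lemma normal_nonzero: "y \<in> W \<Longrightarrow> cross_normal x y \<noteq> 0"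
  unfolding cross_normal_def by (rule plane_gram(2)[OF linear_x inj_x])

lemma normal_orthogonal: "y \<in> W \<Longrightarrow> cross_normal x y \<bullet> dd x y w = 0"
  unfolding cross_normal_def by (rule plane_gram(3)[OF linear_x inj_x])

lemma tangentE:
  assumes "y \<in> W" "v \<bullet> cross_normal x y = 0"
  obtains w where "dd x y w = v"
  using plane_gram(4)[OF linear_x inj_x, OF assms(1,1)] assms(2) unfolding cross_normal_def by blast

lemma esff_commute: "y \<in> W \<Longrightarrow> esff x y w w' = esff x y w' w"
  unfolding esff_def using dd_symmetric[OF open_W smooth_x] by metis

lemma esff_linear: "y \<in> W \<Longrightarrow> linear (esff x y w)"
proof -
  assume y: "y \<in> W"
  have l: "linear (dd (\<lambda>z. dd x z w) y)" by (rule smooth_on_linear[OF smooth_on_dd[OF smooth_x] y])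
  show ?thesis
    unfolding esff_def by (rule linearI) (simp_all add: linear_add[OF l] linear_cmul[OF l] inner_add_right)
qed

text \<open>Differentiate the orthogonality of the normal and \<open>dd x z w\<close>. Thus the
  second fundamental form can be read off from first derivatives of the normal.\<close>

lemma normal_derivative:
  assumes y: "y \<in> W"
  shows "dd (cross_normal x) y w' \<bullet> dd x y w = - esff x y w w'"
proof -
  have "dd (\<lambda>z. cross_normal x z \<bullet> dd x z w) y w' = 0"
    by (rule dd_eq_0[OF open_W y]) (rule normal_orthogonal)
  then show ?thesis
    using dd_inner[OF smooth_on_differentiable[OF smooth_normal y] smooth_on_differentiable[OF smooth_on_dd[OF smooth_x] y], of w w']
    by (simp add: esff_def)
qed

text \<open>The proof uses the Codazzi equation in the form that \<open>D\<^sub>w \<zeta> \<bullet> D\<^bsub>w'\<^esub> n\<close> is symmetric in \<open>w\<close> and \<open>w'\<close>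
  for the cross normal \<open>n\<close>.\<close>

lemma ruling_straight:
  assumes \<zeta>: "smooth_on W \<zeta>" "\<And>y. y \<in> W \<Longrightarrow> norm (\<zeta> y) = 1"
    and k: "\<And>y. y \<in> W \<Longrightarrow> dd x y (k y) = \<zeta> y"
    and null: "\<And>y w. y \<in> W \<Longrightarrow> esff x y (k y) w = 0"
    and y: "y \<in> W" and ne: "dd \<zeta> y (k y) \<noteq> 0"
  shows "esff x y w w' = 0"
proof -
  let ?n = "cross_normal x"
  have d\<zeta>: "\<zeta> differentiable (at y)" "(\<lambda>z. dd \<zeta> z w) differentiable (at y)" if "y \<in> W" for y w
    using smooth_on_differentiable[OF \<zeta>(1) that] smooth_on_differentiable[OF smooth_on_dd[OF \<zeta>(1)] that] by auto
  have dn: "?n differentiable (at y)" if "y \<in> W" for y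
    using smooth_on_differentiable[OF smooth_normal that] .
  \<comment> \<open>Differentiating \<open>\<zeta> \<bullet> n = 0\<close> leaves only this term,
    since \<open>\<zeta> \<bullet> dd n\<close> is an entry of the second fundamental form in the
    null direction. So every derivative of \<zeta> is tangent.\<close>
  have tan: "dd \<zeta> y w \<bullet> ?n y = 0" if "y \<in> W" for y w
  proof -
    have "dd (\<lambda>z. \<zeta> z \<bullet> ?n z) y w = 0"
      by (rule dd_eq_0[OF open_W that, of _ 0]) (metis k normal_orthogonal inner_commute)
    moreover have "\<zeta> y \<bullet> dd ?n y w = 0"
      using normal_derivative[OF that, of w "k y"] null[OF that, of w] k[OF that] by (simp add: inner_commute)
    ultimately show ?thesis using dd_inner[OF d\<zeta>(1)[OF that] dn[OF that], of w] by simp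
  qed
  have A: "dd (\<lambda>z. dd \<zeta> z w) y w' \<bullet> ?n y + dd \<zeta> y w \<bullet> dd ?n y w' = 0" for w w'
  proof -
    have "dd (\<lambda>z. dd \<zeta> z w \<bullet> ?n z) y w' = 0"
      by (rule dd_eq_0[OF open_W y]) (rule tan)
    then show ?thesis using dd_inner[OF d\<zeta>(2)[OF y] dn[OF y], of w w'] by simp
  qed
  have cod: "dd \<zeta> y w \<bullet> dd ?n y w' = dd \<zeta> y w' \<bullet> dd ?n y w" for w w'
    using A[of w w'] A[of w' w] dd_symmetric[OF open_W \<zeta>(1) y, of w w'] by simp
  \<comment> \<open>Exchange the directions by \<open>cod\<close>. Then the normal is differentiated
    along the null direction and paired with a tangent vector, which gives zero.\<close>
  have z: "dd \<zeta> y (k y) \<bullet> dd ?n y w = 0" for w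
  proof -
    obtain m where m: "dd x y m = dd \<zeta> y w" using tangentE[OF y tan[OF y]] by metis
    have "dd \<zeta> y w \<bullet> dd ?n y (k y) = - esff x y m (k y)"
      using normal_derivative[OF y, of "k y" m] m by (simp add: inner_commute)
    then show ?thesis
      using cod[of "k y" w] null[OF y, of m] esff_commute[OF y, of m "k y"] by simp
  qed
  \<comment> \<open>The parameter direction \<open>m\<close> of the turning vector is a second null
    direction. As \<zeta> has unit length, it is orthogonal to the first one, so the two span the
    plane and the form vanishes altogether.\<close>
  obtain m where m: "dd x y m = dd \<zeta> y (k y)" using tangentE[OF y tan[OF y]] by metis
  have hm: "esff x y m w = 0" for w
    using normal_derivative[OF y, of w m] z[of w] m by (simp add: inner_commute)
  have "dd (\<lambda>z. \<zeta> z \<bullet> \<zeta> z) y (k y) = 0"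
    by (rule dd_eq_0[OF open_W y, of _ 1]) (use \<zeta>(2) in \<open>simp add: dot_square_norm\<close>)
  then have orth: "dd \<zeta> y (k y) \<bullet> \<zeta> y = 0"
    using dd_inner[OF d\<zeta>(1)[OF y] d\<zeta>(1)[OF y], of "k y"] by (simp add: inner_commute)
  define p where "p = dd x y m"
  define q where "q = dd x y (k y)"
  have pq: "p \<noteq> 0" "q \<noteq> 0" "p \<bullet> q = 0"
    using ne m k[OF y] \<zeta>(2)[OF y] orth by (auto simp: p_def q_def)
  \<comment> \<open>Linear independence of \<open>m\<close> and \<open>k y\<close>: their images are
    nonzero and orthogonal. The determinant is the denominator of the coordinates of
    \<open>w'\<close> below.\<close>
  have "fst m * snd (k y) - snd m * fst (k y) \<noteq> 0"
  proof
    assume "fst m * snd (k y) - snd m * fst (k y) = 0"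
    then have e: "snd (k y) *\<^sub>R m - snd m *\<^sub>R k y = 0" "fst (k y) *\<^sub>R m - fst m *\<^sub>R k y = 0"
      by (simp_all add: prod_eq_iff algebra_simps)
    have z0: "s = 0" if "s *\<^sub>R m - t *\<^sub>R k y = 0" for s t
    proof -
      have "s *\<^sub>R p - t *\<^sub>R q = dd x y (s *\<^sub>R m - t *\<^sub>R k y)"
        unfolding p_def q_def by (simp add: linear_diff[OF linear_x[OF y]] linear_cmul[OF linear_x[OF y]])
      then have "s *\<^sub>R p - t *\<^sub>R q = 0" using that linear_0[OF linear_x[OF y]] by simp
      then have "(s *\<^sub>R p - t *\<^sub>R q) \<bullet> p = 0" by simp
      then show "s = 0" using pq by (simp add: inner_simps inner_commute)
    qed
    have "k y = 0" using z0[OF e(1)] z0[OF e(2)] by (simp add: prod_eq_iff)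
    then show False using pq(2) linear_0[OF linear_x[OF y]] by (simp add: q_def)
  qed
  then obtain d where d: "d \<noteq> 0" "d = fst m * snd (k y) - snd m * fst (k y)" by blast
  have "w' = ((fst w' * snd (k y) - snd w' * fst (k y)) / d) *\<^sub>R m + ((fst m * snd w' - snd m * fst w') / d) *\<^sub>R k y"
  proof -
    have "d *\<^sub>R w' = (fst w' * snd (k y) - snd w' * fst (k y)) *\<^sub>R m + (fst m * snd w' - snd m * fst w') *\<^sub>R k y"
      unfolding d(2) by (simp add: prod_eq_iff algebra_simps)
    then have "(1 / d) *\<^sub>R d *\<^sub>R w' = (1 / d) *\<^sub>R ((fst w' * snd (k y) - snd w' * fst (k y)) *\<^sub>R m + (fst m * snd w' - snd m * fst w') *\<^sub>R k y)"
      by simp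
    then show ?thesis using d(1) by (simp add: scaleR_add_right)
  qed
  then obtain s t where w': "w' = s *\<^sub>R m + t *\<^sub>R k y" by blast
  have "esff x y w m = 0" "esff x y w (k y) = 0"
    using hm[of w] null[OF y, of w] esff_commute[OF y, of w] by auto
  then show ?thesis
    unfolding w' by (simp add: linear_add[OF esff_linear[OF y]] linear_cmul[OF esff_linear[OF y]])
qed

text \<open>The derivative of the unit normal is orthogonal to the normal because of its length, and
  to the tangent plane because the form vanishes. So the normal is constant on the convex domain,
  and then so is its inner product with \<open>x\<close>.\<close>

lemma planar:
  assumes "convex W" "W \<noteq> {}" and flat: "\<And>y w w'. y \<in> W \<Longrightarrow> esff x y w w' = 0"
  obtains n c where "norm n = 1" "\<And>y. y \<in> W \<Longrightarrow> n \<bullet> x y = c"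
proof -
  let ?n = "cross_normal x"
  define N where "N = (\<lambda>y. inverse (norm (?n y)) *\<^sub>R ?n y)"
  have sN: "smooth_on W N"
    unfolding N_def using normal_nonzero
    by (intro smooth_on_scaleR smooth_on_inverse smooth_on_norm open_W smooth_normal) auto
  have N1: "norm (N y) = 1" and Nx: "N y \<bullet> dd x y w = 0" if "y \<in> W" for y w
    using normal_nonzero[OF that] normal_orthogonal[OF that] by (simp_all add: N_def)
  have dN: "dd N y w = 0" if y: "y \<in> W" for y w
  proof -
    note d = smooth_on_differentiable[OF sN y]
    have "dd (\<lambda>z. N z \<bullet> N z) y w = 0"
      by (rule dd_eq_0[OF open_W y, of _ 1]) (use N1 in \<open>simp add: dot_square_norm\<close>)
    then have "dd N y w \<bullet> N y = 0" using dd_inner[OF d d, of w] by (simp add: inner_commute)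
    then have 1: "dd N y w \<bullet> ?n y = 0" using normal_nonzero[OF y] by (simp add: N_def)
    have 2: "dd N y w \<bullet> dd x y w' = 0" for w'
    proof -
      have "dd (\<lambda>z. N z \<bullet> dd x z w') y w = 0"
        by (rule dd_eq_0[OF open_W y]) (rule Nx)
      moreover have "N y \<bullet> dd (\<lambda>z. dd x z w') y w = 0"
        using flat[OF y, of w' w] by (simp add: N_def esff_def)
      ultimately show ?thesis
        using dd_inner[OF d smooth_on_differentiable[OF smooth_on_dd[OF smooth_x] y], of w' w] by simp
    qed
    show ?thesis
      by (rule cross3_collinear_orthogonal[OF 2 2 1[unfolded cross_normal_def]])
         (use normal_nonzero[OF y] in \<open>simp add: cross_normal_def\<close>)
  qed
  have "\<exists>n. \<forall>y\<in>W. N y = n"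
  proof (rule has_derivative_zero_constant[OF assms(1)])
    fix y assume y: "y \<in> W"
    have "dd N y = (\<lambda>h. 0)" using dN[OF y] by (simp add: fun_eq_iff)
    then show "(N has_derivative (\<lambda>h. 0)) (at y within W)"
      using dd_works[OF smooth_on_differentiable[OF sN y]] by (metis has_derivative_at_withinI)
  qed
  then obtain n where n: "\<And>y. y \<in> W \<Longrightarrow> N y = n" by blast
  have "\<exists>c. \<forall>y\<in>W. n \<bullet> x y = c"
  proof (rule has_derivative_zero_constant[OF assms(1)])
    fix y assume y: "y \<in> W"
    have "((\<lambda>y. n \<bullet> x y) has_derivative (\<lambda>h. n \<bullet> dd x y h)) (at y)"
      by (rule has_derivative_inner_right[OF dd_works[OF smooth_on_differentiable[OF smooth_x y]]])
    moreover have "(\<lambda>h. n \<bullet> dd x y h) = (\<lambda>h. 0)" using Nx[OF y] n[OF y] by (simp add: fun_eq_iff)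
    ultimately show "((\<lambda>y. n \<bullet> x y) has_derivative (\<lambda>h. 0)) (at y within W)"
      by (metis has_derivative_at_withinI)
  qed
  then obtain c where "\<And>y. y \<in> W \<Longrightarrow> n \<bullet> x y = c" by blast
  moreover have "norm n = 1" using N1 n assms(2) by auto
  ultimately show thesis using that by blast
qed

end

unbundle cross3_syntax

section \<open>Totally geodesic hyperplanes\<close>

lemma orthonormal_frame_expansion:
  fixes n e y :: "real^3"
  assumes "norm n = 1" "norm e = 1" "n \<bullet> e = 0"
  shows "(n \<bullet> y) *\<^sub>R n + (e \<bullet> y) *\<^sub>R e + ((n \<times> e) \<bullet> y) *\<^sub>R (n \<times> e) = y"
    and "norm (n \<times> e) = 1" "e \<times> (n \<times> e) = n" "(n \<times> e) \<times> n = e"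
proof -
  have nn: "n \<bullet> n = 1" "e \<bullet> e = 1" "e \<bullet> n = 0" using assms by (simp_all add: dot_square_norm inner_commute)
  show c: "norm (n \<times> e) = 1"
    using norm_cross_dot[of n e] assms power2_eq_iff_nonneg[of "norm (n \<times> e)" 1] by simp
  then have cc: "(n \<times> e) \<bullet> (n \<times> e) = 1" by (simp add: dot_square_norm)
  show en: "e \<times> (n \<times> e) = n" using nn by (simp add: Lagrange)
  have "n \<times> (n \<times> e) = - e" using nn assms(3) by (simp add: Lagrange)
  then show "(n \<times> e) \<times> n = e" using cross_skew[of "n \<times> e" n] by simp
  let ?r = "y - ((n \<bullet> y) *\<^sub>R n + (e \<bullet> y) *\<^sub>R e + ((n \<times> e) \<bullet> y) *\<^sub>R (n \<times> e))"
  have "?r = 0"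
  proof (rule cross3_collinear_orthogonal[of _ e "n \<times> e"])
    show "?r \<bullet> e = 0"
      by (simp add: inner_diff_left inner_add_left nn assms(3) dot_cross_self inner_commute[of y])
    show "?r \<bullet> (n \<times> e) = 0"
      by (simp add: inner_diff_left inner_add_left cc dot_cross_self inner_commute[of y])
    show "?r \<bullet> (e \<times> (n \<times> e)) = 0"
      unfolding en by (simp add: inner_diff_left inner_add_left nn dot_cross_self inner_commute[of y])
    show "e \<times> (n \<times> e) \<noteq> 0" unfolding en using assms(1) by auto
  qed
  then show "(n \<bullet> y) *\<^sub>R n + (e \<bullet> y) *\<^sub>R e + ((n \<times> e) \<bullet> y) *\<^sub>R (n \<times> e) = y" by simp
qed

context robertson_walker
begin

text \<open>An affine parametrization has no second derivatives, and the Christoffel vector stays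
  tangent because its spatial part is a combination of those of its arguments while the time
  direction itself is tangent.\<close>

lemma plane_totally_geodesic:
  assumes n: "norm n = 1"
  shows "totally_geodesic_hypersurface (rw_metric f) (rw_space I) {p. fst p \<in> I \<and> n \<bullet> snd p = c}"
    (is "totally_geodesic_hypersurface _ _ ?H")
proof -
  obtain e0 :: "real^3" where e0: "e0 \<noteq> 0" "orthogonal n e0"
    using orthogonal_to_vector_exists[of n] by auto
  define e where "e = inverse (norm e0) *\<^sub>R e0"
  have e: "norm e = 1" "n \<bullet> e = 0" using e0 by (simp_all add: e_def orthogonal_def)
  note fr = orthonormal_frame_expansion[OF n e]
  let ?e' = "n \<times> e"
  have on: "e \<bullet> e = 1" "?e' \<bullet> ?e' = 1" "n \<bullet> n = 1" "e \<bullet> n = 0" "?e' \<bullet> e = 0" "e \<bullet> ?e' = 0" "n \<bullet> ?e' = 0" "?e' \<bullet> n = 0"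
    using e n fr(2) by (simp_all add: dot_square_norm inner_commute dot_cross_self)
  define L :: "real^3 \<Rightarrow> spacetime" where "L = (\<lambda>s. (s $ 1, s $ 2 *\<^sub>R e + s $ 3 *\<^sub>R ?e'))"
  define \<sigma> :: "real^3 \<Rightarrow> spacetime" where "\<sigma> = (\<lambda>s. (0, c *\<^sub>R n) + L s)"
  define \<tau> :: "spacetime \<Rightarrow> real^3" where "\<tau> = (\<lambda>p. vector [fst p, e \<bullet> snd p, ?e' \<bullet> snd p])"
  define W where "W = {s :: real^3. s $ 1 \<in> I}"
  have bL: "bounded_linear L"
    unfolding L_def
    by (intro bounded_linear_Pair bounded_linear_add bounded_linear_vec_nth bounded_linear_scaleR_const)
  have dL: "dd L s = L" for s using bL by (intro dd_eqI) (rule bounded_linear_imp_has_derivative)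
  have d\<sigma>: "dd \<sigma> s = L" for s
    unfolding \<sigma>_def by (rule dd_eqI) (auto intro!: derivative_eq_intros bounded_linear_imp_has_derivative bL)
  have rL: "range L = {w. n \<bullet> snd w = 0}"
  proof
    show "range L \<subseteq> {w. n \<bullet> snd w = 0}" using e(2) on(7) by (auto simp: L_def inner_add_right)
    show "{w. n \<bullet> snd w = 0} \<subseteq> range L"
    proof
      fix w :: spacetime assume "w \<in> {w. n \<bullet> snd w = 0}"
      then have "w = L (vector [fst w, e \<bullet> snd w, ?e' \<bullet> snd w])"
        using fr(1)[of "snd w"] by (simp add: L_def prod_eq_iff)
      then show "w \<in> range L" by blast
    qed
  qed
  have \<tau>\<sigma>: "\<tau> (\<sigma> s) = s" for s
    by (simp add: \<tau>_def \<sigma>_def L_def vec_eq_iff forall_3 inner_add_right on)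
  have \<sigma>\<tau>: "\<sigma> (\<tau> p) = p" if "p \<in> ?H" for p
    using fr(1)[of "snd p"] that by (simp add: \<tau>_def \<sigma>_def L_def prod_eq_iff algebra_simps)
  have oW: "open W"
    unfolding W_def using open_I by (rule open_vimage_vec_nth[unfolded vimage_def])
  have img: "\<sigma> ` W = ?H"
  proof
    show "\<sigma> ` W \<subseteq> ?H" using on e by (auto simp: W_def \<sigma>_def L_def inner_add_right)
    show "?H \<subseteq> \<sigma> ` W"
    proof
      fix p assume p: "p \<in> ?H"
      then have "\<tau> p \<in> W" by (simp add: W_def \<tau>_def)
      then show "p \<in> \<sigma> ` W" using \<sigma>\<tau>[OF p] by (metis imageI)
    qed
  qed
  have sm: "smooth_on W \<sigma>"
    unfolding \<sigma>_def
    by (intro smooth_on_add oW smooth_on_const smooth_on_bounded_linear[OF bL oW smooth_on_ident])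
  have injL: "inj L"
  proof (rule injI)
    fix s s' assume "L s = L s'"
    then have "\<sigma> s = \<sigma> s'" by (simp add: \<sigma>_def)
    then show "s = s'" using \<tau>\<sigma> by metis
  qed
  have "homeomorphism W (\<sigma> ` W) \<sigma> \<tau>"
  proof (rule homeomorphismI)
    show "continuous_on W \<sigma>" by (rule smooth_on_continuous[OF sm])
    have "continuous_on UNIV \<tau>"
    proof -
      have "\<tau> = (\<lambda>p. fst p *\<^sub>R axis 1 1 + (e \<bullet> snd p) *\<^sub>R axis 2 1 + (?e' \<bullet> snd p) *\<^sub>R axis 3 1)"
        by (simp add: \<tau>_def fun_eq_iff vec_eq_iff forall_3 axis_def)
      then show ?thesis by (simp only:) (intro continuous_intros)
    qed
    then show "continuous_on (\<sigma> ` W) \<tau>" by (rule continuous_on_subset) simp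
  qed (use \<tau>\<sigma> in auto)
  then have lp: "local_param ?H id W \<sigma>"
    unfolding local_param_def immersion_on_def using oW sm injL img by (auto simp: d\<sigma>)
  have geo: "nondegenerate_on (rw_metric f (\<sigma> s)) (range (dd \<sigma> s))" "second_fundamental_form (rw_metric f) \<sigma> s w w' = 0"
    if s: "s \<in> W" for s w w'
  proof -
    have \<sigma>I: "fst (\<sigma> s) \<in> I" using s by (simp add: W_def \<sigma>_def L_def)
    note f0 = nonzero[OF \<sigma>I]
    \<comment> \<open>The induced metric is Lorentzian, not definite. A vector orthogonal to
      everything is tested against \<open>(1, 0)\<close> and against its own spatial part.\<close>
    show nd: "nondegenerate_on (rw_metric f (\<sigma> s)) (range (dd \<sigma> s))"
      unfolding d\<sigma> rL nondegenerate_on_def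
    proof (intro ballI impI)
      fix v assume v: "v \<in> {w. n \<bullet> snd w = 0}" and z: "\<forall>w\<in>{w. n \<bullet> snd w = 0}. rw_metric f (\<sigma> s) v w = 0"
      have "rw_metric f (\<sigma> s) v (1, 0) = 0" "rw_metric f (\<sigma> s) v (0, snd v) = 0"
        using v by (auto intro!: bspec[OF z])
      then show "v = 0" using f0 by (simp add: rw_metric_def prod_eq_iff)
    qed
    have sub: "subspace (range (dd \<sigma> s))"
      unfolding d\<sigma> using bL by (simp add: linear_subspace_image bounded_linear.linear)
    have "dd (\<lambda>y. dd \<sigma> y w') s w = 0" unfolding d\<sigma> by (metis frechet_derivative_const)
    moreover have "christoffel (rw_metric f) (\<sigma> s) (dd \<sigma> s w) (dd \<sigma> s w') \<in> range (dd \<sigma> s)"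
      unfolding rw_christoffel[OF \<sigma>I] d\<sigma> rL using e(2) on(7) by (simp add: L_def inner_add_right)
    ultimately have "dd (\<lambda>y. dd \<sigma> y w') s w + christoffel (rw_metric f) (\<sigma> s) (dd \<sigma> s w) (dd \<sigma> s w') \<in> range (dd \<sigma> s)"
      by simp
    from tangential_part_eqI[OF bilinear_rw_metric sub nd this]
    show "second_fundamental_form (rw_metric f) \<sigma> s w w' = 0"
      unfolding second_fundamental_form_def normal_part_def by (simp add: bilinear_lzero[OF bilinear_rw_metric])
  qed
  show ?thesis
    unfolding totally_geodesic_hypersurface_def
  proof (intro conjI ballI)
    show "?H \<subseteq> rw_space I" by (auto simp: rw_space_def mem_Times_iff)
    fix q assume "q \<in> ?H"
    then have "q \<in> \<sigma> ` W" using img by simp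
    then show "\<exists>(W :: (real^3) set) \<sigma>. local_param ?H id W \<sigma> \<and> q \<in> \<sigma> ` W \<and>
        (\<forall>x\<in>W. nondegenerate_on (rw_metric f (\<sigma> x)) (range (dd \<sigma> x)) \<and>
               (\<forall>w w'. second_fundamental_form (rw_metric f) \<sigma> x w w' = 0))"
      using lp geo by blast
  qed
qed

end

unbundle no cross3_syntax

section \<open>Change of coordinates on a surface\<close>

lemma homeomorphism_open_image:
  assumes "homeomorphism W (\<sigma> ` W) \<sigma> \<tau>" "openin (top_of_set M) (\<sigma> ` W)" "open V" "V \<subseteq> W"
  shows "openin (top_of_set M) (\<sigma> ` V)" "homeomorphism V (\<sigma> ` V) \<sigma> \<tau>"
proof -
  have "openin (top_of_set W) V" using assms(3,4) by (simp add: open_openin_trans open_subset)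
  then have "openin (top_of_set (\<sigma> ` W)) (\<sigma> ` V)"
    by (rule homeomorphism_imp_open_map[OF assms(1)])
  then show "openin (top_of_set M) (\<sigma> ` V)" using assms(2) openin_trans by blast
  show "homeomorphism V (\<sigma> ` V) \<sigma> \<tau>"
    by (rule homeomorphism_of_subsets[OF assms(1,4) _ refl]) (use assms(4) in auto)
qed

text \<open>Makes a map with injective differential into a coordinate system. The new domain is a
  product of intervals, so that one can integrate along a coordinate and conclude constancy from
  vanishing derivatives.\<close>

lemma local_param_coordinates:
  fixes \<psi> :: "'m::topological_space \<Rightarrow> 'v::euclidean_space" and W :: "(real \<times> real) set"
  assumes lp: "local_param M \<psi> W \<sigma>" and \<Phi>: "smooth_on W \<Phi>" and x: "x \<in> W" "inj (dd \<Phi> x)"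
  obtains A B G where "open_interval A" "open_interval B" "\<Phi> x \<in> A \<times> B" "local_param M \<psi> (A \<times> B) (\<sigma> \<circ> G)"
    "smooth_on (A \<times> B) G" "G ` (A \<times> B) \<subseteq> W" "G (\<Phi> x) = x" "\<And>y. y \<in> A \<times> B \<Longrightarrow> \<Phi> (G y) = y"
    "\<And>y. y \<in> A \<times> B \<Longrightarrow> inj (dd G y)" "\<And>y v. y \<in> A \<times> B \<Longrightarrow> dd \<Phi> (G y) (dd G y v) = v"
    "\<And>y. y \<in> A \<times> B \<Longrightarrow> inj (dd \<Phi> (G y))"
proof -
  obtain \<tau> where op: "openin (top_of_set M) (\<sigma> ` W)" and h: "homeomorphism W (\<sigma> ` W) \<sigma> \<tau>"
    and i: "open W" "smooth_on W (\<psi> \<circ> \<sigma>)" "\<And>x. x \<in> W \<Longrightarrow> inj (dd (\<psi> \<circ> \<sigma>) x)"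
    using lp by (auto simp: local_param_def immersion_on_def)
  obtain U V G where U: "open U" "U \<subseteq> W" "x \<in> U" and V: "open V" "\<Phi> x \<in> V"
    and hG: "homeomorphism U V \<Phi> G" and sG: "smooth_on V G" and inj: "\<And>x. x \<in> U \<Longrightarrow> inj (dd \<Phi> x)"
    by (rule smooth_inverse_function[OF i(1) \<Phi> x]; rule that; assumption)
  obtain A0 B0 where AB0: "open A0" "open B0" "\<Phi> x \<in> A0 \<times> B0" "A0 \<times> B0 \<subseteq> V"
    using V by (elim open_prod_elim)
  obtain ea where ea: "ea > 0" "ball (fst (\<Phi> x)) ea \<subseteq> A0"
    using AB0(1,3) openE by (metis mem_Times_iff)
  obtain eb where eb: "eb > 0" "ball (snd (\<Phi> x)) eb \<subseteq> B0"
    using AB0(2,3) openE by (metis mem_Times_iff)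
  define A where "A = ball (fst (\<Phi> x)) ea"
  define B where "B = ball (snd (\<Phi> x)) eb"
  have int: "open_interval A" "open_interval B"
    using ea eb by (auto simp: open_interval_def A_def B_def is_interval_ball_real)
  have xAB: "\<Phi> x \<in> A \<times> B" using ea eb by (simp add: A_def B_def mem_Times_iff)
  have ABV: "A \<times> B \<subseteq> V" using AB0(4) ea(2) eb(2) by (auto simp: A_def B_def)
  have oAB: "open (A \<times> B)" unfolding A_def B_def by (intro open_Times open_ball)
  have \<Phi>G: "\<Phi> (G y) = y" "G y \<in> U" if "y \<in> V" for y
    using homeomorphism_apply2[OF hG that] homeomorphism_image2[OF hG] that by auto
  have G\<Phi>: "G (\<Phi> z) = z" if "z \<in> U" for z using homeomorphism_apply1[OF hG that] .
  have sub: "G ` (A \<times> B) \<subseteq> U" using \<Phi>G(2) ABV by blast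
  have sGAB: "smooth_on (A \<times> B) G" using sG ABV by (rule smooth_on_subset)
  have d: "dd \<Phi> (G y) (dd G y v) = v" if y: "y \<in> A \<times> B" for y v
  proof -
    have GyW: "G y \<in> W" using sub y U(2) by blast
    have "dd (\<lambda>y. \<Phi> (G y)) y v = dd \<Phi> (G y) (dd G y v)"
      using dd_compose(1)[OF smooth_on_differentiable[OF sGAB y] smooth_on_differentiable[OF \<Phi> GyW]] by simp
    moreover have "dd (\<lambda>y. y) y = dd (\<lambda>y. \<Phi> (G y)) y"
      by (rule dd_cong(1)[OF oAB y]) (use \<Phi>G(1) ABV in \<open>auto simp: subset_iff\<close>)
    moreover have "dd (\<lambda>y :: real \<times> real. y) y = (\<lambda>v. v)" by (rule dd_eqI) (rule has_derivative_ident)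
    ultimately show ?thesis by metis
  qed
  have iG: "inj (dd G y)" if "y \<in> A \<times> B" for y
    using d[OF that] by (metis injI)
  have i\<Phi>: "inj (dd \<Phi> (G y))" if "y \<in> A \<times> B" for y
    using inj sub that by blast
  have GAB: "G ` (A \<times> B) = U \<inter> \<Phi> -` (A \<times> B)"
  proof
    show "G ` (A \<times> B) \<subseteq> U \<inter> \<Phi> -` (A \<times> B)"
    proof
      fix z assume "z \<in> G ` (A \<times> B)"
      then obtain y where y: "y \<in> A \<times> B" "z = G y" by (elim imageE)
      then show "z \<in> U \<inter> \<Phi> -` (A \<times> B)" using \<Phi>G[OF subsetD[OF ABV y(1)]] by simp
    qed
    show "U \<inter> \<Phi> -` (A \<times> B) \<subseteq> G ` (A \<times> B)"
      using G\<Phi> by (metis IntD1 IntD2 imageI subsetI vimageD)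
  qed
  have "open (G ` (A \<times> B))"
    unfolding GAB using hG oAB U(1) by (simp add: continuous_open_preimage homeomorphism_def)
  from homeomorphism_open_image[OF h op this] sub U(2)
  have im: "openin (top_of_set M) (\<sigma> ` G ` (A \<times> B))" "homeomorphism (G ` (A \<times> B)) (\<sigma> ` G ` (A \<times> B)) \<sigma> \<tau>"
    by blast+
  have "homeomorphism (A \<times> B) (G ` (A \<times> B)) G \<Phi>"
    by (rule homeomorphism_of_subsets[OF homeomorphism_symD[OF hG] ABV sub refl])
  from homeomorphism_compose[OF this im(2)]
  have hc: "homeomorphism (A \<times> B) ((\<sigma> \<circ> G) ` (A \<times> B)) (\<sigma> \<circ> G) (\<Phi> \<circ> \<tau>)"
    by (simp add: image_comp)
  have GW: "G ` (A \<times> B) \<subseteq> W" using sub U(2) by blast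
  have "immersion_on (A \<times> B) (\<lambda>y. (\<psi> \<circ> \<sigma>) (G y))"
    unfolding immersion_on_def
  proof (intro conjI ballI)
    show "smooth_on (A \<times> B) (\<lambda>y. (\<psi> \<circ> \<sigma>) (G y))"
      by (rule smooth_on_compose[OF oAB GW sGAB i(2)])
    fix y assume y: "y \<in> A \<times> B"
    have GyW: "G y \<in> W" using GW y by blast
    have "dd (\<lambda>y. (\<psi> \<circ> \<sigma>) (G y)) y = (\<lambda>v. dd (\<psi> \<circ> \<sigma>) (G y) (dd G y v))"
      by (rule dd_compose(1)[OF smooth_on_differentiable[OF sGAB y] smooth_on_differentiable[OF i(2) GyW]])
    then show "inj (dd (\<lambda>y. (\<psi> \<circ> \<sigma>) (G y)) y)"
      using i(3)[OF GyW] iG[OF y] by (metis (no_types, lifting) injD injI)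
  qed (rule oAB)
  then have lp': "local_param M \<psi> (A \<times> B) (\<sigma> \<circ> G)"
    unfolding local_param_def using hc im(1) by (auto simp: image_comp o_def)
  have "\<Phi> (G y) = y" if "y \<in> A \<times> B" for y using \<Phi>G(1) that ABV by blast
  from that[OF int xAB lp' sGAB GW G\<Phi>[OF U(3)] this iG d i\<Phi>] show thesis .
qed

section \<open>The null lines of a surface in a Robertson-Walker space-time\<close>

lemma constant_along_fst:
  fixes h :: "real \<times> real \<Rightarrow> 'b::real_normed_vector"
  assumes "open_interval A" "open B" "smooth_on (A \<times> B) h" "\<And>y. y \<in> A \<times> B \<Longrightarrow> dd h y (1, 0) = 0"
    and "a \<in> A" "a' \<in> A" "v \<in> B"
  shows "h (a, v) = h (a', v)"
proof -
  have "\<exists>c. \<forall>a\<in>A. h (a, v) = c"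
  proof (rule has_derivative_zero_constant)
    show "convex A" using assms(1) by (simp add: open_interval_def is_interval_convex_1)
    fix a assume "a \<in> A"
    then have av: "(a, v) \<in> A \<times> B" using assms(7) by simp
    note d = smooth_on_differentiable[OF assms(3) av]
    have 1: "((\<lambda>a. (a, v)) has_derivative (\<lambda>s. (s, 0))) (at a)"
      by (auto intro!: derivative_eq_intros)
    have "((\<lambda>a. h (a, v)) has_derivative (\<lambda>s. dd h (a, v) (s, 0))) (at a)"
      using has_derivative_compose[OF 1 dd_works[OF d]] .
    moreover have "dd h (a, v) (s, 0) = 0" for s
      using plane_linear_apply[OF dd_linear[OF d], of "(s, 0)"] assms(4)[OF av] by simp
    ultimately show "((\<lambda>a. h (a, v)) has_derivative (\<lambda>s. 0)) (at a within A)"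
      using has_derivative_at_withinI by simp
  qed
  then show ?thesis using assms(5,6) by auto
qed

locale spacelike_patch = robertson_walker I f for I f +
  fixes W :: "(real \<times> real) set" and X :: "real \<times> real \<Rightarrow> spacetime"
  assumes immersion: "immersion_on W X" and time_in_I: "y \<in> W \<Longrightarrow> fst (X y) \<in> I"
    and pos_def: "y \<in> W \<Longrightarrow> pos_def_on (rw_metric f (X y)) (range (dd X y))"
begin

lemma patch: "open W" "smooth_on W X" "y \<in> W \<Longrightarrow> inj (dd X y)"
  using immersion by (auto simp: immersion_on_def)

lemma dd_time: "y \<in> W \<Longrightarrow> dd (\<lambda>y. fst (X y)) y w = fst (dd X y w)"
  using dd_bounded_linear(1)[OF bounded_linear_fst smooth_on_differentiable[OF patch(2)]] by simp

lemma dd_space: "y \<in> W \<Longrightarrow> dd (\<lambda>y. snd (X y)) y w = snd (dd X y w)"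
  using dd_bounded_linear(1)[OF bounded_linear_snd smooth_on_differentiable[OF patch(2)]] by simp

lemma dd_dd_space: "y \<in> W \<Longrightarrow> dd (\<lambda>z. dd (\<lambda>y. snd (X y)) z w) y w' = snd (dd (\<lambda>z. dd X z w) y w')"
proof -
  assume y: "y \<in> W"
  note d = dd_bounded_linear[OF bounded_linear_snd smooth_on_differentiable[OF smooth_on_dd[OF patch(2), of w] y]]
  have "dd (\<lambda>z. snd (dd X z w)) y = dd (\<lambda>z. dd (\<lambda>y. snd (X y)) z w) y"
    by (rule dd_cong(1)[OF patch(1) y _ d(2)]) (simp add: dd_space)
  then show ?thesis using d(1) by metis
qed

lemma dd_dd_time: "y \<in> W \<Longrightarrow> dd (\<lambda>z. dd (\<lambda>y. fst (X y)) z w) y w' = fst (dd (\<lambda>z. dd X z w) y w')"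
proof -
  assume y: "y \<in> W"
  note d = dd_bounded_linear[OF bounded_linear_fst smooth_on_differentiable[OF smooth_on_dd[OF patch(2), of w] y]]
  have "dd (\<lambda>z. fst (dd X z w)) y = dd (\<lambda>z. dd (\<lambda>y. fst (X y)) z w) y"
    by (rule dd_cong(1)[OF patch(1) y _ d(2)]) (simp add: dd_time)
  then show ?thesis using d(1) by metis
qed

lemma time_less_space: "y \<in> W \<Longrightarrow> w \<noteq> 0 \<Longrightarrow> (fst (dd X y w))\<^sup>2 < (f (fst (X y)))\<^sup>2 * (snd (dd X y w) \<bullet> snd (dd X y w))"
proof -
  assume y: "y \<in> W" and "w \<noteq> 0"
  then have "dd X y w \<noteq> 0"
    using linear_injective_0[OF smooth_on_linear[OF patch(2) y]] patch(3)[OF y] by blast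
  then have "rw_metric f (X y) (dd X y w) (dd X y w) > 0"
    using pos_def[OF y] unfolding pos_def_on_def by blast
  then show ?thesis by (simp add: rw_metric_def power2_eq_square)
qed

text \<open>A nonzero space-like vector has nonzero spatial part, so the projection to Euclidean
  space is again an immersion and the Euclidean theory applies to it.\<close>

sublocale space: euclidean_patch W "\<lambda>y. snd (X y)"
proof
  show "open W" by (rule patch(1))
  show s: "smooth_on W (\<lambda>y. snd (X y))" by (rule smooth_on_snd[OF patch(1,2)])
  fix y assume y: "y \<in> W"
  show "inj (dd (\<lambda>y. snd (X y)) y)"
    unfolding linear_injective_0[OF smooth_on_linear[OF s y]]
  proof (intro allI impI, rule ccontr)
    fix w assume "dd (\<lambda>y. snd (X y)) y w = 0" "w \<noteq> 0"
    then show False using time_less_space[OF y, of w] by (simp add: dd_space[OF y])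
  qed
qed

text \<open>The Christoffel term contributes only multiples of the spatial parts of tangent vectors.
  The Euclidean normal annihilates these, and only the second derivative of the spatial map
  remains.\<close>

lemma null_dir_esff:
  assumes y: "y \<in> W" and "null_dir (rw_metric f) X y k"
  shows "esff (\<lambda>y. snd (X y)) y k w = 0"
proof -
  let ?n = "cross_normal (\<lambda>y. snd (X y)) y"
  have o: "?n \<bullet> snd (dd X y w) = 0" for w
    using space.normal_orthogonal[OF y, of w] by (simp add: dd_space[OF y])
  obtain m where m: "cov (rw_metric f) X y k w = dd X y m"
    using assms(2) unfolding null_dir_def by blast
  have "?n \<bullet> snd (cov (rw_metric f) X y k w) = 0" unfolding m by (rule o)
  then have "?n \<bullet> snd (dd (\<lambda>z. dd X z w) y k) = 0"
    unfolding cov_def rw_christoffel[OF time_in_I[OF y]] by (simp add: inner_add_right o)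
  then have "esff (\<lambda>y. snd (X y)) y w k = 0" by (simp add: esff_def dd_dd_space[OF y])
  then show ?thesis using space.esff_commute[OF y] by metis
qed

lemma null_dir_scaleR:
  assumes y: "y \<in> W" and "null_dir (rw_metric f) X y k"
  shows "null_dir (rw_metric f) X y (c *\<^sub>R k)"
proof -
  have l: "linear (dd (\<lambda>z. dd X z w') y)" for w'
    by (rule smooth_on_linear[OF smooth_on_dd[OF patch(2)] y])
  have sub: "subspace (range (dd X y))"
    using smooth_on_linear[OF patch(2) y] by (simp add: linear_subspace_image)
  have "cov (rw_metric f) X y (c *\<^sub>R k) w' = c *\<^sub>R cov (rw_metric f) X y k w'" for w'
    unfolding cov_def rw_christoffel[OF time_in_I[OF y]] linear_cmul[OF l]
      linear_cmul[OF smooth_on_linear[OF patch(2) y]] by (simp add: algebra_simps)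
  then show ?thesis
    using assms(2) subspace_scale[OF sub] unfolding null_dir_def by simp
qed

end

context robertson_walker
begin

lemma local_param_spacelike:
  fixes M :: "'m::topological_space set" and W :: "(real \<times> real) set"
  assumes "spacelike_surface (rw_metric f) (rw_space I) M \<psi>" "local_param M \<psi> W \<sigma>"
  shows "spacelike_patch I f W (\<psi> \<circ> \<sigma>)"
proof
  show "immersion_on W (\<psi> \<circ> \<sigma>)" using assms(2) by (simp add: local_param_def)
  fix y assume y: "y \<in> W"
  have "\<sigma> ` W \<subseteq> M" using assms(2) openin_imp_subset unfolding local_param_def by blast
  then have M: "\<sigma> y \<in> M" using y by blast
  then show "fst ((\<psi> \<circ> \<sigma>) y) \<in> I"
    using assms(1) by (auto simp: spacelike_surface_def immersed_surface_def rw_space_def mem_Times_iff)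
  have "pos_def_on (rw_metric f (\<psi> (\<sigma> y))) (tangent_plane M \<psi> (\<sigma> y))"
    using assms(1) M by (simp add: spacelike_surface_def)
  then show "pos_def_on (rw_metric f ((\<psi> \<circ> \<sigma>) y)) (range (dd (\<psi> \<circ> \<sigma>) y))"
    by (simp add: tangent_plane_eq[OF assms(2) y])
qed

text \<open>Membership in the null space is witnessed in some unknown parametrization; the
  transition map carries the witness to the one at hand.\<close>

lemma relative_null_spaceD:
  fixes M :: "'m::topological_space set" and W :: "(real \<times> real) set"
  assumes sp: "spacelike_surface (rw_metric f) (rw_space I) M \<psi>" and lp: "local_param M \<psi> W \<sigma>"
    and y: "y \<in> W" and z: "z \<in> relative_null_space (rw_metric f) M \<psi> (\<sigma> y)"
  obtains k where "dd (\<psi> \<circ> \<sigma>) y k = z" "null_dir (rw_metric f) (\<psi> \<circ> \<sigma>) y k"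
proof -
  obtain W' \<sigma>' x' w where w: "z = dd (\<psi> \<circ> \<sigma>') x' w" "local_param M \<psi> W' \<sigma>'" "x' \<in> (W' :: (real \<times> real) set)" "\<sigma>' x' = \<sigma> y"
    "\<forall>w'. second_fundamental_form (rw_metric f) (\<psi> \<circ> \<sigma>') x' w w' = 0"
    using z unfolding relative_null_space_def by blast
  interpret p': spacelike_patch I f W' "\<psi> \<circ> \<sigma>'" by (rule local_param_spacelike[OF sp w(2)])
  have "null_dir (rw_metric f) (\<psi> \<circ> \<sigma>') x' w"
    using second_fundamental_form_null[OF p'.immersion w(3) p'.pos_def[OF w(3)]] w(5) by blast
  then show thesis
    using local_param_transition_null[OF lp w(2) y w(3) w(4)[symmetric], of w "rw_metric f"] that w(1) by metis
qed

text \<open>The spanning field of the distribution is rescaled to unit spatial part. If its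
  direction turned along itself at one point, it would do so on a ball; that piece would be flat,
  hence inside \<open>I\<close> times a plane, against the hypothesis on totally geodesic
  hypersurfaces.\<close>

lemma nullity_ruling:
  fixes M :: "'m::topological_space set"
  assumes sp: "spacelike_surface (rw_metric f) (rw_space I) M \<psi>"
    and sld: "smooth_line_distribution M \<psi> (relative_null_space (rw_metric f) M \<psi>)"
    and ntg: "\<not> (\<exists>U H. openin (top_of_set M) U \<and> U \<noteq> {} \<and> \<psi> ` U \<subseteq> H \<and>
              totally_geodesic_hypersurface (rw_metric f) (rw_space I) H)"
    and p: "p \<in> M"
  obtains W :: "(real \<times> real) set" and \<sigma> \<zeta> k where "local_param M \<psi> W \<sigma>" "p \<in> \<sigma> ` W" "smooth_on W \<zeta>"
    "\<And>y. y \<in> W \<Longrightarrow> norm (\<zeta> y) = 1" "\<And>y. y \<in> W \<Longrightarrow> snd (dd (\<psi> \<circ> \<sigma>) y (k y)) = \<zeta> y"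
    "\<And>y. y \<in> W \<Longrightarrow> null_dir (rw_metric f) (\<psi> \<circ> \<sigma>) y (k y)" "\<And>y. y \<in> W \<Longrightarrow> dd \<zeta> y (k y) = 0"
proof -
  obtain W :: "(real \<times> real) set" and \<sigma> Z where lp: "local_param M \<psi> W \<sigma>" "p \<in> \<sigma> ` W" and sZ: "smooth_on W Z"
    and Z: "\<forall>x\<in>W. Z x \<noteq> 0 \<and> Z x \<in> tangent_plane M \<psi> (\<sigma> x) \<and> relative_null_space (rw_metric f) M \<psi> (\<sigma> x) = span {Z x}"
    using bspec[OF sld[unfolded smooth_line_distribution_def] p] by (elim exE conjE) (rule that; assumption)
  let ?X = "\<psi> \<circ> \<sigma>"
  let ?x = "\<lambda>y. snd (?X y)"
  interpret spacelike_patch I f W ?X by (rule local_param_spacelike[OF sp lp(1)])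
  have Zk: "\<exists>k. dd ?X y k = Z y \<and> null_dir (rw_metric f) ?X y k" if y: "y \<in> W" for y
  proof -
    have "Z y \<in> relative_null_space (rw_metric f) M \<psi> (\<sigma> y)" using Z y by (simp add: span_base)
    then show ?thesis using relative_null_spaceD[OF sp lp(1) y] by metis
  qed
  have Zn: "snd (Z y) \<noteq> 0" if y: "y \<in> W" for y
  proof
    assume z: "snd (Z y) = 0"
    obtain k where k: "dd ?X y k = Z y" using Zk[OF y] by blast
    have "k \<noteq> 0" using k Z y linear_0[OF smooth_on_linear[OF patch(2) y]] by metis
    then show False using time_less_space[OF y, of k] by (simp add: k z)
  qed
  define \<zeta> where "\<zeta> = (\<lambda>y. inverse (norm (snd (Z y))) *\<^sub>R snd (Z y))"
  have s\<zeta>: "smooth_on W \<zeta>"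
    unfolding \<zeta>_def using Zn by (intro smooth_on_scaleR smooth_on_inverse smooth_on_norm smooth_on_snd patch(1) sZ) auto
  have \<zeta>1: "norm (\<zeta> y) = 1" if "y \<in> W" for y using Zn[OF that] by (simp add: \<zeta>_def)
  have ex: "\<exists>k. dd ?x y k = \<zeta> y \<and> null_dir (rw_metric f) ?X y k" if y: "y \<in> W" for y
  proof -
    obtain k where k: "dd ?X y k = Z y" "null_dir (rw_metric f) ?X y k" using Zk[OF y] by blast
    have "dd ?x y (inverse (norm (snd (Z y))) *\<^sub>R k) = \<zeta> y"
      by (subst linear_cmul[OF space.linear_x[OF y]]) (simp only: dd_space[OF y] k(1) \<zeta>_def)
    then show ?thesis using null_dir_scaleR[OF y k(2)] by blast
  qed
  have rng: "\<zeta> y \<in> range (dd ?x y)" if y: "y \<in> W" for y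
  proof -
    obtain k where "dd ?x y k = \<zeta> y" using ex[OF y] by blast
    then show ?thesis by (metis rangeI)
  qed
  obtain k where sk: "smooth_on W k" and k: "\<And>y. y \<in> W \<Longrightarrow> dd ?x y (k y) = \<zeta> y"
    by (rule smooth_tangent_coordinates[OF patch(1) space.smooth_x space.inj_x s\<zeta> rng]; (rule that)?; assumption)
  \<comment> \<open>The smooth choice \<open>k y\<close> agrees with the pointwise null direction,
    because the spatial differential is injective.\<close>
  have null: "null_dir (rw_metric f) ?X y (k y)" if y: "y \<in> W" for y
    using ex[OF y] k[OF y] space.inj_x[OF y] by (metis injD)
  have straight: "dd \<zeta> y (k y) = 0" if y: "y \<in> W" for y
  proof (rule ccontr)
    assume ne: "dd \<zeta> y (k y) \<noteq> 0"
    have lin: "dd \<zeta> y (k y) = fst (k y) *\<^sub>R dd \<zeta> y (1, 0) + snd (k y) *\<^sub>R dd \<zeta> y (0, 1)" if "y \<in> W" for y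
      by (rule plane_linear_apply[OF smooth_on_linear[OF s\<zeta> that]])
    have "smooth_on W (\<lambda>y. fst (k y) *\<^sub>R dd \<zeta> y (1, 0) + snd (k y) *\<^sub>R dd \<zeta> y (0, 1))"
      by (intro smooth_on_add smooth_on_scaleR smooth_on_fst smooth_on_snd smooth_on_dd patch(1) sk s\<zeta>)
    then have "continuous_on W (\<lambda>y. fst (k y) *\<^sub>R dd \<zeta> y (1, 0) + snd (k y) *\<^sub>R dd \<zeta> y (0, 1))"
      by (rule smooth_on_continuous)
    then have "continuous_on W (\<lambda>y. dd \<zeta> y (k y))"
      by (rule continuous_on_eq) (simp only: lin)
    then have oV: "open (W \<inter> (\<lambda>y. dd \<zeta> y (k y)) -` (- {0}))"
      by (rule continuous_open_preimage[OF _ patch(1)]) auto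
    obtain e where e: "e > 0" "ball y e \<subseteq> W \<inter> (\<lambda>y. dd \<zeta> y (k y)) -` (- {0})"
      by (rule openE[OF oV, of y]) (use y ne in auto)
    have sub: "ball y e \<subseteq> W" using e(2) by blast
    interpret B: euclidean_patch "ball y e" ?x
      using smooth_on_subset[OF space.smooth_x sub] space.inj_x sub by unfold_locales auto
    have flat: "esff ?x z w w' = 0" if z: "z \<in> ball y e" for z w w'
    proof -
      have zW: "z \<in> W" and nz: "dd \<zeta> z (k z) \<noteq> 0" using e(2) z by auto
      show ?thesis
        by (rule space.ruling_straight[OF s\<zeta> \<zeta>1 k null_dir_esff[OF _ null] zW nz])
    qed
    obtain n c where nc: "norm n = 1" "\<And>z. z \<in> ball y e \<Longrightarrow> n \<bullet> ?x z = c"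
      by (rule B.planar[OF convex_ball _ flat]; (rule that)?; (assumption | use e(1) in simp))
    obtain \<tau> where "openin (top_of_set M) (\<sigma> ` W)" "homeomorphism W (\<sigma> ` W) \<sigma> \<tau>"
      using lp(1) unfolding local_param_def by blast
    then have "openin (top_of_set M) (\<sigma> ` ball y e)"
      using homeomorphism_open_image(1) sub open_ball by metis
    moreover have "\<sigma> ` ball y e \<noteq> {}" using e(1) by simp
    moreover have "\<psi> ` \<sigma> ` ball y e \<subseteq> {p. fst p \<in> I \<and> n \<bullet> snd p = c}"
    proof
      fix q assume "q \<in> \<psi> ` \<sigma> ` ball y e"
      then obtain z where z: "z \<in> ball y e" "q = ?X z" by auto
      then show "q \<in> {p. fst p \<in> I \<and> n \<bullet> snd p = c}"
        using nc(2)[OF z(1)] time_in_I[OF subsetD[OF sub z(1)]] by simp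
    qed
    ultimately show False
      using ntg plane_totally_geodesic[OF nc(1), of c] by blast
  qed
  have k': "snd (dd ?X y (k y)) = \<zeta> y" if "y \<in> W" for y using k[OF that] dd_space[OF that] by simp
  show thesis by (rule that[OF lp s\<zeta> \<zeta>1 k' null straight])
qed

text \<open>Both the direction \<open>\<zeta>\<close> of the null lines and the foot point \<open>b = x - (x \<bullet> \<zeta>) \<zeta>\<close> are constant
  along them, so a component of \<open>(\<zeta>, b)\<close> serves as the transversal coordinate; no flow is needed.\<close>

lemma ruled_coordinates:
  fixes M :: "'m::topological_space set"
  assumes sp: "spacelike_surface (rw_metric f) (rw_space I) M \<psi>"
    and sld: "smooth_line_distribution M \<psi> (relative_null_space (rw_metric f) M \<psi>)"
    and ntg: "\<not> (\<exists>U H. openin (top_of_set M) U \<and> U \<noteq> {} \<and> \<psi> ` U \<subseteq> H \<and>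
              totally_geodesic_hypersurface (rw_metric f) (rw_space I) H)"
    and p: "p \<in> M"
  obtains A B \<sigma> \<zeta> \<beta> where "open_interval A" "open_interval B" "local_param M \<psi> (A \<times> B) \<sigma>" "p \<in> \<sigma> ` (A \<times> B)"
    "smooth_on B \<zeta>" "smooth_on B \<beta>" "\<And>v. v \<in> B \<Longrightarrow> norm (\<zeta> v) = 1" "\<And>v. v \<in> B \<Longrightarrow> \<zeta> v \<bullet> \<beta> v = 0"
    "\<And>r v. r \<in> A \<Longrightarrow> v \<in> B \<Longrightarrow> snd ((\<psi> \<circ> \<sigma>) (r, v)) = r *\<^sub>R \<zeta> v + \<beta> v"
    "\<And>y. y \<in> A \<times> B \<Longrightarrow> null_dir (rw_metric f) (\<psi> \<circ> \<sigma>) y (1, 0)"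
proof -
  obtain W :: "(real \<times> real) set" and \<sigma> \<zeta> k where lp: "local_param M \<psi> W \<sigma>" "p \<in> \<sigma> ` W" and s\<zeta>: "smooth_on W \<zeta>"
    and \<zeta>1: "\<And>y. y \<in> W \<Longrightarrow> norm (\<zeta> y) = 1" and k: "\<And>y. y \<in> W \<Longrightarrow> snd (dd (\<psi> \<circ> \<sigma>) y (k y)) = \<zeta> y"
    and null: "\<And>y. y \<in> W \<Longrightarrow> null_dir (rw_metric f) (\<psi> \<circ> \<sigma>) y (k y)" and straight: "\<And>y. y \<in> W \<Longrightarrow> dd \<zeta> y (k y) = 0"
    by (rule nullity_ruling[OF assms]; rule that; assumption)
  let ?X = "\<psi> \<circ> \<sigma>"
  let ?x = "\<lambda>y. snd (?X y)"
  interpret spacelike_patch I f W ?X by (rule local_param_spacelike[OF sp lp(1)])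
  note oW = patch(1)
  define r where "r = (\<lambda>y. ?x y \<bullet> \<zeta> y)"
  define b where "b = (\<lambda>y. ?x y - r y *\<^sub>R \<zeta> y)"
  have sr: "smooth_on W r" unfolding r_def by (intro smooth_on_inner oW space.smooth_x s\<zeta>)
  have sb: "smooth_on W b" unfolding b_def by (intro smooth_on_diff smooth_on_scaleR oW space.smooth_x s\<zeta> sr)
  note dx = smooth_on_differentiable[OF space.smooth_x] and d\<zeta> = smooth_on_differentiable[OF s\<zeta>]
    and dr = smooth_on_differentiable[OF sr] and db = smooth_on_differentiable[OF sb]
  have xk: "dd ?x y (k y) = \<zeta> y" if "y \<in> W" for y using k[OF that] dd_space[OF that] by simp
  have rk: "dd r y (k y) = 1" if y: "y \<in> W" for y
    unfolding r_def dd_inner[OF dx[OF y] d\<zeta>[OF y]] using xk[OF y] straight[OF y] \<zeta>1[OF y]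
    by (simp add: dot_square_norm)
  have b': "dd b y w = dd ?x y w - (r y *\<^sub>R dd \<zeta> y w + dd r y w *\<^sub>R \<zeta> y)" if y: "y \<in> W" for y w
    unfolding b_def
    using dd_diff[OF dx[OF y] dd_bounded_bilinear(2)[OF bounded_bilinear_scaleR dr[OF y] d\<zeta>[OF y]]]
      dd_scaleR[OF dr[OF y] d\<zeta>[OF y]] by simp
  have bk: "dd b y (k y) = 0" if y: "y \<in> W" for y
    unfolding b'[OF y] using rk[OF y] xk[OF y] straight[OF y] by simp
  obtain x0 where x0: "x0 \<in> W" "p = \<sigma> x0" using lp(2) by blast
  \<comment> \<open>Otherwise the spatial differential would be \<open>dd r\<close> times a fixed
    vector, of rank at most one, against the immersion property.\<close>
  have "\<exists>w. dd \<zeta> x0 w \<noteq> 0 \<or> dd b x0 w \<noteq> 0"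
  proof (rule ccontr)
    assume "\<not> (\<exists>w. dd \<zeta> x0 w \<noteq> 0 \<or> dd b x0 w \<noteq> 0)"
    then have "dd \<zeta> x0 w = 0" "dd b x0 w = 0" for w by blast+
    then have e: "dd ?x x0 w = dd r x0 w *\<^sub>R \<zeta> x0" for w using b'[OF x0(1), of w] by (metis add_0 eq_iff_diff_eq_0 scaleR_zero_right)
    have z: "w = 0" if "dd r x0 w = 0" for w
    proof -
      have "dd ?x x0 w = 0" using e[of w] that by (metis scaleR_zero_left)
      then show "w = 0"
        using linear_injective_0[OF space.linear_x[OF x0(1)], THEN iffD1, OF space.inj_x[OF x0(1)]] by blast
    qed
    note lr = smooth_on_linear[OF sr x0(1)]
    have "dd r x0 (dd r x0 (0, 1), - dd r x0 (1, 0)) = 0"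
      using plane_linear_apply[OF lr, of "(dd r x0 (0, 1), - dd r x0 (1, 0))"] by (simp add: mult.commute)
    then have "(dd r x0 (0, 1), - dd r x0 (1, 0)) = 0" by (rule z)
    then have "dd r x0 (0, 1) = 0" by (simp add: zero_prod_def)
    then show False using z[of "(0, 1)"] by (simp add: zero_prod_def)
  qed
  then obtain w where w: "dd \<zeta> x0 w \<noteq> 0 \<or> dd b x0 w \<noteq> 0" by blast
  have "\<exists>v :: real \<times> real \<Rightarrow> real. smooth_on W v \<and> (\<forall>y\<in>W. dd v y (k y) = 0) \<and> dd v x0 w \<noteq> 0"
  proof -
    have "\<exists>v :: real \<times> real \<Rightarrow> real. smooth_on W v \<and> (\<forall>y\<in>W. dd v y (k y) = 0) \<and> dd v x0 w \<noteq> 0"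
      if g: "smooth_on W g" "\<And>y. y \<in> W \<Longrightarrow> dd g y (k y) = 0" "dd g x0 w \<noteq> 0" for g :: "real \<times> real \<Rightarrow> real^3"
    proof -
      \<comment> \<open>Pairing the vector function with its own derivative turns it into a scalar
        whose derivative along \<open>w\<close> is a squared length, hence nonzero.\<close>
      let ?v = "\<lambda>y. g y \<bullet> dd g x0 w"
      have "dd ?v y h = dd g y h \<bullet> dd g x0 w" if "y \<in> W" for y h
        using dd_bounded_linear(1)[OF bounded_linear_inner_left smooth_on_differentiable[OF g(1) that]] by simp
      then have "\<forall>y\<in>W. dd ?v y (k y) = 0" "dd ?v x0 w \<noteq> 0" using g(2,3) x0(1) by auto
      moreover have "smooth_on W ?v" by (rule smooth_on_bounded_linear[OF bounded_linear_inner_left oW g(1)])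
      ultimately show ?thesis by blast
    qed
    from this[OF s\<zeta> straight] this[OF sb bk] w show ?thesis by blast
  qed
  then obtain v :: "real \<times> real \<Rightarrow> real" where sv: "smooth_on W v" and vk: "\<forall>y\<in>W. dd v y (k y) = 0" and vw: "dd v x0 w \<noteq> 0"
    by blast
  define \<Phi> where "\<Phi> = (\<lambda>y. (r y, v y))"
  have s\<Phi>: "smooth_on W \<Phi>" unfolding \<Phi>_def by (intro smooth_on_Pair oW sr sv)
  have d\<Phi>: "dd \<Phi> y h = (dd r y h, dd v y h)" if y: "y \<in> W" for y h
    unfolding \<Phi>_def using dd_eqI[OF has_derivative_Pair[OF dd_works[OF dr[OF y]] dd_works[OF smooth_on_differentiable[OF sv y]]]] by simp
  note l\<Phi> = smooth_on_linear[OF s\<Phi> x0(1)]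
  have "surj (dd \<Phi> x0)"
  proof (rule surjI)
    fix q :: "real \<times> real"
    let ?t = "snd q / dd v x0 w"
    have "dd \<Phi> x0 (?t *\<^sub>R w + (fst q - ?t * dd r x0 w) *\<^sub>R k x0) = ?t *\<^sub>R dd \<Phi> x0 w + (fst q - ?t * dd r x0 w) *\<^sub>R dd \<Phi> x0 (k x0)"
      by (simp only: linear_add[OF l\<Phi>] linear_cmul[OF l\<Phi>])
    also have "\<dots> = q" using vw vk x0(1) rk[OF x0(1)] by (simp add: d\<Phi>[OF x0(1)] prod_eq_iff)
    finally show "dd \<Phi> x0 (?t *\<^sub>R w + (fst q - ?t * dd r x0 w) *\<^sub>R k x0) = q" .
  qed
  then have inj: "inj (dd \<Phi> x0)" using linear_surj_imp_inj[OF l\<Phi>] by blast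
  obtain A B G where AB: "open_interval A" "open_interval B" "\<Phi> x0 \<in> A \<times> B" and lp': "local_param M \<psi> (A \<times> B) (\<sigma> \<circ> G)"
    and sG: "smooth_on (A \<times> B) G" "G ` (A \<times> B) \<subseteq> W" "G (\<Phi> x0) = x0" and \<Phi>G: "\<And>y. y \<in> A \<times> B \<Longrightarrow> \<Phi> (G y) = y"
    and iG: "\<And>y. y \<in> A \<times> B \<Longrightarrow> inj (dd G y)" and dG: "\<And>y v. y \<in> A \<times> B \<Longrightarrow> dd \<Phi> (G y) (dd G y v) = v"
    and i\<Phi>: "\<And>y. y \<in> A \<times> B \<Longrightarrow> inj (dd \<Phi> (G y))"
    by (rule local_param_coordinates[OF lp(1) s\<Phi> x0(1) inj]; rule that; assumption)
  have oAB: "open (A \<times> B)" and oB: "open B" using AB by (auto simp: open_interval_def open_Times)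
  have GW: "G y \<in> W" if "y \<in> A \<times> B" for y using sG(2) that by blast
  \<comment> \<open>The first new coordinate vector is the null direction: \<open>dd \<Phi>\<close>
    sends both to \<open>(1, 0)\<close>, since \<open>r\<close> grows at unit rate along the lines
    and the transversal coordinate is constant there.\<close>
  have Gk: "dd G y (1, 0) = k (G y)" if y: "y \<in> A \<times> B" for y
  proof (rule injD[OF i\<Phi>[OF y]])
    show "dd \<Phi> (G y) (dd G y (1, 0)) = dd \<Phi> (G y) (k (G y))"
      by (simp only: dG[OF y] d\<Phi>[OF GW[OF y], of "k (G y)"] rk[OF GW[OF y]] bspec[OF vk GW[OF y]])
  qed
  obtain r0 where r0: "r0 \<in> A" using AB(3) by (auto simp: mem_Times_iff)
  have along: "g (G (a, v)) = g (G (r0, v))"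
    if "smooth_on W g" "\<And>y. y \<in> W \<Longrightarrow> dd g y (k y) = 0" "a \<in> A" "v \<in> B" for g :: "real \<times> real \<Rightarrow> real^3" and a v
  proof (rule constant_along_fst[OF AB(1) oB _ _ that(3) r0 that(4)])
    show "smooth_on (A \<times> B) (\<lambda>y. g (G y))" by (rule smooth_on_compose[OF oAB sG(2,1) that(1)])
    show "dd (\<lambda>y. g (G y)) y (1, 0) = 0" if y: "y \<in> A \<times> B" for y
      using dd_compose(1)[OF smooth_on_differentiable[OF sG(1) y] smooth_on_differentiable[OF \<open>smooth_on W g\<close> GW[OF y]]]
        Gk[OF y] \<open>\<And>y. y \<in> W \<Longrightarrow> dd g y (k y) = 0\<close>[OF GW[OF y]] by simp
  qed
  have sB: "smooth_on B (\<lambda>v. g (G (r0, v)))" if "smooth_on W g" for g :: "real \<times> real \<Rightarrow> real^3"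
  proof (rule smooth_on_compose[OF oB, of "\<lambda>v. G (r0, v)"])
    show "(\<lambda>v. G (r0, v)) ` B \<subseteq> W" using sG(2) r0 by blast
    show "smooth_on B (\<lambda>v. G (r0, v))"
      by (rule smooth_on_compose[OF oB, of "\<lambda>v. (r0, v)" "A \<times> B"])
         (use r0 sG(1) in \<open>auto intro!: smooth_on_Pair smooth_on_const smooth_on_ident oB\<close>)
  qed (rule that)
  show thesis
  proof (rule that[OF AB(1,2) lp'])
    show "p \<in> (\<sigma> \<circ> G) ` (A \<times> B)"
      using AB(3) sG(3) x0(2) by (metis comp_apply imageI)
    show "smooth_on B (\<lambda>v. \<zeta> (G (r0, v)))" "smooth_on B (\<lambda>v. b (G (r0, v)))" by (rule sB[OF s\<zeta>], rule sB[OF sb])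
    fix v assume v: "v \<in> B"
    then have Wv: "G (r0, v) \<in> W" using GW r0 by blast
    show "norm (\<zeta> (G (r0, v))) = 1" by (rule \<zeta>1[OF Wv])
    then show "\<zeta> (G (r0, v)) \<bullet> b (G (r0, v)) = 0"
      by (simp add: b_def r_def inner_diff_right dot_square_norm inner_commute)
    fix a assume a: "a \<in> A"
    have av: "(a, v) \<in> A \<times> B" using a v by simp
    have "?x (G (a, v)) = r (G (a, v)) *\<^sub>R \<zeta> (G (a, v)) + b (G (a, v))" by (simp add: b_def)
    moreover have "r (G (a, v)) = a" using \<Phi>G[OF av] by (simp add: \<Phi>_def)
    ultimately show "snd ((\<psi> \<circ> (\<sigma> \<circ> G)) (a, v)) = a *\<^sub>R \<zeta> (G (r0, v)) + b (G (r0, v))"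
      using along[OF s\<zeta> straight a v] along[OF sb bk a v] by simp
  next
    fix y assume y: "y \<in> A \<times> B"
    have "null_dir (rw_metric f) (\<lambda>y. ?X (G y)) y (1, 0)"
      unfolding null_dir_compose(2)[OF oAB sG(1,2) oW patch(2) y iG[OF y]] Gk[OF y] by (rule null[OF GW[OF y]])
    then show "null_dir (rw_metric f) (\<psi> \<circ> (\<sigma> \<circ> G)) y (1, 0)" by (simp add: o_def)
  qed
qed

end

section \<open>Space-like surfaces ruled by null lines\<close>

text \<open>The local normal form: the first coordinate is arc length along the null lines in
  Euclidean space. The last assumption is what remains of the condition that T vanishes
  nowhere.\<close>

locale ruled_patch = spacelike_patch I f "A \<times> B" X for I f A B X +
  fixes \<zeta> \<beta> :: "real \<Rightarrow> real^3"
  assumes A: "open_interval A" and B: "open_interval B"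
    and smooth_\<zeta>: "smooth_on B \<zeta>" and smooth_\<beta>: "smooth_on B \<beta>"
    and norm_\<zeta>: "v \<in> B \<Longrightarrow> norm (\<zeta> v) = 1" and \<zeta>_\<beta>: "v \<in> B \<Longrightarrow> \<zeta> v \<bullet> \<beta> v = 0"
    and ruled: "r \<in> A \<Longrightarrow> v \<in> B \<Longrightarrow> snd (X (r, v)) = r *\<^sub>R \<zeta> v + \<beta> v"
    and null: "y \<in> A \<times> B \<Longrightarrow> null_dir (rw_metric f) X y (1, 0)"
    and curvature: "t \<in> I \<Longrightarrow> deriv (deriv f) t / f t - (deriv f t)\<^sup>2 / (f t)\<^sup>2 \<noteq> 0"
    and time_nonconstant: "y \<in> A \<times> B \<Longrightarrow> \<exists>w. fst (dd X y w) \<noteq> 0"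
begin

lemma open_B: "open B" using B by (simp add: open_interval_def)

definition "time y = fst (X y)"
definition "time_r y = dd time y (1, 0)"
definition "time_v y = dd time y (0, 1)"
definition "\<zeta>' v = dd \<zeta> v 1"
definition "c v = dd \<beta> v 1 \<bullet> \<zeta> v"
definition "\<omega> y = fst y *\<^sub>R \<zeta>' (snd y) + dd \<beta> (snd y) 1 - c (snd y) *\<^sub>R \<zeta> (snd y)"

text \<open>The vector \<open>\<partial>\<^sub>v - c \<partial>\<^sub>r\<close> is tangent to the surface and orthogonal to the null lines; its spatial
  part is \<open>\<omega>\<close>, and \<open>s\<close> below is its time component.\<close>

lemma time_I: "y \<in> A \<times> B \<Longrightarrow> time y \<in> I"
  unfolding time_def by (rule time_in_I)

lemma smooth_c: "smooth_on B c"
  unfolding c_def[abs_def] by (intro smooth_on_inner open_B smooth_on_dd smooth_\<beta> smooth_\<zeta>)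

lemma smooth_\<zeta>': "smooth_on B \<zeta>'"
  unfolding \<zeta>'_def[abs_def] by (intro smooth_on_dd smooth_\<zeta>)

lemma smooth_time: "smooth_on (A \<times> B) time"
  unfolding time_def[abs_def] by (rule smooth_on_fst[OF patch(1,2)])

lemma smooth_time_rv: "smooth_on (A \<times> B) time_r" "smooth_on (A \<times> B) time_v"
  unfolding time_r_def[abs_def] time_v_def[abs_def] by (intro smooth_on_dd smooth_time)+

lemma smooth_on_snd_fun:
  fixes g :: "real \<Rightarrow> 'z::real_normed_vector"
  shows "smooth_on B g \<Longrightarrow> smooth_on (A \<times> B) (\<lambda>y. g (snd y))"
  by (rule smooth_on_compose[OF patch(1), of snd B]) (auto intro: smooth_on_snd[OF patch(1) smooth_on_ident])

lemma dd_snd_fun: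
  fixes g :: "real \<Rightarrow> 'z::real_normed_vector"
  assumes "smooth_on B g" "y \<in> A \<times> B"
  shows "dd (\<lambda>y. g (snd y)) y w = snd w *\<^sub>R dd g (snd y) 1"
proof -
  have v: "snd y \<in> B" using assms(2) by auto
  note g = smooth_on_differentiable[OF assms(1) v]
  have "dd (snd :: real \<times> real \<Rightarrow> real) y = snd"
    by (rule dd_eqI) (rule bounded_linear_imp_has_derivative[OF bounded_linear_snd])
  then have "dd (\<lambda>y. g (snd y)) y w = dd g (snd y) (snd w)"
    using dd_compose(1)[OF bounded_linear_imp_differentiable[OF bounded_linear_snd] g] by simp
  also have "\<dots> = dd g (snd y) (snd w *\<^sub>R 1)" by simp
  also have "\<dots> = snd w *\<^sub>R dd g (snd y) 1" by (rule linear_cmul[OF dd_linear[OF g]])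
  finally show ?thesis .
qed

lemma snd_fun_differentiable:
  fixes g :: "real \<Rightarrow> 'z::real_normed_vector"
  shows "smooth_on B g \<Longrightarrow> y \<in> A \<times> B \<Longrightarrow> (\<lambda>y. g (snd y)) differentiable (at y)"
  using smooth_on_differentiable[OF smooth_on_snd_fun] .

lemma \<zeta>_orth: assumes "v \<in> B" shows "\<zeta> v \<bullet> \<zeta> v = 1" "\<zeta>' v \<bullet> \<zeta> v = 0"
proof -
  show "\<zeta> v \<bullet> \<zeta> v = 1" using norm_\<zeta>[OF assms] by (simp add: dot_square_norm)
  have "dd (\<lambda>v. \<zeta> v \<bullet> \<zeta> v) v 1 = 0"
    by (rule dd_eq_0[OF open_B assms, of _ 1]) (simp add: norm_\<zeta> dot_square_norm)
  then show "\<zeta>' v \<bullet> \<zeta> v = 0"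
    using smooth_on_differentiable[OF smooth_\<zeta> assms] by (simp add: dd_inner \<zeta>'_def inner_commute)
qed

lemma \<omega>_\<zeta>: "y \<in> A \<times> B \<Longrightarrow> \<omega> y \<bullet> \<zeta> (snd y) = 0"
  using \<zeta>_orth[of "snd y"] by (auto simp: \<omega>_def c_def inner_diff_left inner_add_left)

lemma dd_X:
  assumes y: "y \<in> A \<times> B"
  shows "dd X y (1, 0) = (time_r y, \<zeta> (snd y))"
    and "dd X y (0, 1) = (time_v y, \<omega> y + c (snd y) *\<^sub>R \<zeta> (snd y))"
proof -
  have d: "fst differentiable (at y)" by (rule bounded_linear_imp_differentiable[OF bounded_linear_fst])
  have f1: "dd fst y = fst" by (rule dd_eqI) (rule bounded_linear_imp_has_derivative[OF bounded_linear_fst])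
  note dz = snd_fun_differentiable[OF smooth_\<zeta> y] and db = snd_fun_differentiable[OF smooth_\<beta> y]
  have D: "snd (dd X y w) = fst y *\<^sub>R (snd w *\<^sub>R \<zeta>' (snd y)) + fst w *\<^sub>R \<zeta> (snd y) + snd w *\<^sub>R dd \<beta> (snd y) 1" for w
  proof -
    have "snd (dd X y w) = dd (\<lambda>y. snd (X y)) y w" by (simp add: dd_space[OF y])
    also have "dd (\<lambda>y. snd (X y)) y = dd (\<lambda>y. fst y *\<^sub>R \<zeta> (snd y) + \<beta> (snd y)) y"
      by (rule dd_cong(1)[OF patch(1) y _ smooth_on_differentiable[OF space.smooth_x y]]) (auto simp: ruled)
    also have "\<dots> w = fst y *\<^sub>R (snd w *\<^sub>R \<zeta>' (snd y)) + fst w *\<^sub>R \<zeta> (snd y) + snd w *\<^sub>R dd \<beta> (snd y) 1"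
      unfolding dd_add[OF dd_bounded_bilinear(2)[OF bounded_bilinear_scaleR d dz] db] dd_scaleR[OF d dz] f1
        dd_snd_fun[OF smooth_\<zeta> y] dd_snd_fun[OF smooth_\<beta> y] \<zeta>'_def ..
    finally show ?thesis .
  qed
  show "dd X y (1, 0) = (time_r y, \<zeta> (snd y))"
    using D[of "(1, 0)"] dd_time[OF y, of "(1, 0)"] by (simp add: prod_eq_iff time_r_def time_def[abs_def])
  show "dd X y (0, 1) = (time_v y, \<omega> y + c (snd y) *\<^sub>R \<zeta> (snd y))"
    using D[of "(0, 1)"] dd_time[OF y, of "(0, 1)"]
    by (simp add: prod_eq_iff time_v_def time_def[abs_def] \<omega>_def)
qed

lemma \<omega>_nonzero: assumes y: "y \<in> A \<times> B" shows "\<omega> y \<noteq> 0"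
proof
  assume "\<omega> y = 0"
  then have "snd (dd X y (- c (snd y), 1)) = 0"
    unfolding plane_linear_apply[OF smooth_on_linear[OF patch(2) y], of "(- c (snd y), 1)"]
    by (simp add: dd_X[OF y])
  then show False using time_less_space[OF y, of "(- c (snd y), 1)"] by (simp add: zero_prod_def)
qed

text \<open>The factor in \<open>\<zeta>' = q \<omega>\<close>, a proportionality that is proved
  from nullity in \<open>null_equations\<close>. Writing it as a quotient of inner products makes
  smoothness immediate.\<close>

definition "q y = (\<zeta>' (snd y) \<bullet> \<omega> y) / (\<omega> y \<bullet> \<omega> y)"

lemma smooth_\<omega>: "smooth_on (A \<times> B) \<omega>"
  unfolding \<omega>_def[abs_def]
  by (intro smooth_on_diff smooth_on_add smooth_on_scaleR patch(1) smooth_on_fst[OF patch(1) smooth_on_ident]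
      smooth_on_snd_fun smooth_\<zeta>' smooth_on_dd[OF smooth_\<beta>] smooth_c smooth_\<zeta>)

lemma smooth_q: "smooth_on (A \<times> B) q"
  unfolding q_def[abs_def]
  by (intro smooth_on_divide smooth_on_inner patch(1) smooth_on_snd_fun smooth_\<zeta>' smooth_\<omega>) (simp add: \<omega>_nonzero)

lemma dd_\<omega>: assumes y: "y \<in> A \<times> B" shows "dd \<omega> y (1, 0) = \<zeta>' (snd y)"
proof -
  have d: "fst differentiable (at y)" by (rule bounded_linear_imp_differentiable[OF bounded_linear_fst])
  have f1: "dd fst y = fst" by (rule dd_eqI) (rule bounded_linear_imp_has_derivative[OF bounded_linear_fst])
  let ?g = "\<lambda>v. dd \<beta> v 1 - c v *\<^sub>R \<zeta> v"
  have sg: "smooth_on B ?g"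
    by (intro smooth_on_diff smooth_on_scaleR open_B smooth_on_dd smooth_\<beta> smooth_c smooth_\<zeta>)
  have "\<omega> = (\<lambda>y. fst y *\<^sub>R \<zeta>' (snd y) + ?g (snd y))" by (simp add: fun_eq_iff \<omega>_def)
  then have "dd \<omega> y (1, 0) = dd (\<lambda>y. fst y *\<^sub>R \<zeta>' (snd y) + ?g (snd y)) y (1, 0)" by simp
  also have "\<dots> = \<zeta>' (snd y)"
    unfolding dd_add[OF dd_bounded_bilinear(2)[OF bounded_bilinear_scaleR d snd_fun_differentiable[OF smooth_\<zeta>' y]] snd_fun_differentiable[OF sg y]]
      dd_scaleR[OF d snd_fun_differentiable[OF smooth_\<zeta>' y]] f1 dd_snd_fun[OF smooth_\<zeta>' y] dd_snd_fun[OF sg y] by simp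
  finally show ?thesis .
qed

definition "H t = f' t / f t"

text \<open>Nullity writes the covariant derivatives of both coordinate fields along the lines as
  tangent vectors. Their spatial parts, split along \<zeta> and \<omega>, determine the
  coefficients; the time parts are then the two scalar equations.\<close>

lemma null_equations:
  assumes y: "y \<in> A \<times> B"
  shows "dd time_r y (1, 0) = 2 * H (time y) * (time_r y)\<^sup>2 - f (time y) * f' (time y)"
    and "\<zeta>' (snd y) = q y *\<^sub>R \<omega> y"
    and "dd time_v y (1, 0) + f (time y) * f' (time y) * c (snd y) =
      2 * H (time y) * time_r y * time_v y + q y * (time_v y - c (snd y) * time_r y)"
proof -
  let ?v = "snd y"
  let ?h = "H (time y)" and ?ff = "f (time y) * f' (time y)"
  have v: "?v \<in> B" using y by auto
  have XI: "fst (X y) \<in> I" by (rule time_in_I[OF y])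
  have ft: "fst (X y) = time y" by (simp add: time_def)
  note z = \<zeta>_orth[OF v] and w = \<omega>_\<zeta>[OF y]
  have zw: "\<zeta> ?v \<bullet> \<omega> y = 0" using w by (simp add: inner_commute)
  have w0: "\<omega> y \<bullet> \<omega> y \<noteq> 0" using \<omega>_nonzero[OF y] by simp
  note lin = plane_linear_apply[OF smooth_on_linear[OF patch(2) y]]
  have t: "dd (\<lambda>z. dd (\<lambda>y. fst (X y)) z (1, 0)) y w = dd time_r y w"
    "dd (\<lambda>z. dd (\<lambda>y. fst (X y)) z (0, 1)) y w = dd time_v y w" for w
    by (simp_all add: time_r_def[abs_def] time_v_def[abs_def] time_def[abs_def])
  have X1: "dd (\<lambda>z. dd X z (1, 0)) y w = (dd time_r y w, snd w *\<^sub>R \<zeta>' ?v)" for w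
  proof -
    have "dd (\<lambda>z. dd (\<lambda>y. snd (X y)) z (1, 0)) y = dd (\<lambda>y. \<zeta> (snd y)) y"
      by (rule dd_cong(1)[OF patch(1) y _ smooth_on_differentiable[OF smooth_on_dd[OF space.smooth_x] y]])
         (simp add: dd_space dd_X)
    then have "snd (dd (\<lambda>z. dd X z (1, 0)) y w) = snd w *\<^sub>R \<zeta>' ?v"
      using dd_dd_space[OF y, of "(1, 0)" w] dd_snd_fun[OF smooth_\<zeta> y, of w] by (simp add: \<zeta>'_def)
    then show ?thesis using dd_dd_time[OF y, of "(1, 0)" w] t(1)[of w] by (simp add: prod_eq_iff)
  qed
  have X2: "dd (\<lambda>z. dd X z (0, 1)) y (1, 0) = (dd time_v y (1, 0), \<zeta>' ?v)"
    using dd_dd_time[OF y, of "(0, 1)" "(1, 0)"] t(2)[of "(1, 0)"] dd_symmetric[OF patch(1,2) y, of "(0, 1)" "(1, 0)"] X1[of "(0, 1)"]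
    by (simp add: prod_eq_iff)
  have c1: "cov (rw_metric f) X y (1, 0) (1, 0) = (dd time_r y (1, 0) + ?ff, (2 * ?h * time_r y) *\<^sub>R \<zeta> ?v)"
    unfolding cov_def X1 rw_christoffel[OF XI] dd_X[OF y] ft using z
    by (simp add: H_def scaleR_add_left[symmetric] del: scaleR_add_left)
  have c2: "cov (rw_metric f) X y (1, 0) (0, 1) = (dd time_v y (1, 0) + ?ff * c ?v,
      \<zeta>' ?v + (?h * time_r y) *\<^sub>R \<omega> y + (?h * (time_r y * c ?v + time_v y)) *\<^sub>R \<zeta> ?v)"
    unfolding cov_def X2 rw_christoffel[OF XI] dd_X[OF y] ft using z zw
    by (simp add: H_def inner_add_right algebra_simps)
  obtain m where "cov (rw_metric f) X y (1, 0) (1, 0) = dd X y m"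
    using null[OF y] unfolding null_dir_def by blast
  then have m: "dd time_r y (1, 0) + ?ff = fst m * time_r y + snd m * time_v y"
    "(2 * ?h * time_r y) *\<^sub>R \<zeta> ?v = fst m *\<^sub>R \<zeta> ?v + snd m *\<^sub>R (\<omega> y + c ?v *\<^sub>R \<zeta> ?v)"
    unfolding c1 lin[of m] dd_X[OF y] by simp_all
  have "((2 * ?h * time_r y) *\<^sub>R \<zeta> ?v) \<bullet> \<omega> y = (fst m *\<^sub>R \<zeta> ?v + snd m *\<^sub>R (\<omega> y + c ?v *\<^sub>R \<zeta> ?v)) \<bullet> \<omega> y"
    using m(2) by simp
  then have m2: "snd m = 0" using zw w0 by (simp add: inner_add_left)
  have "((2 * ?h * time_r y) *\<^sub>R \<zeta> ?v) \<bullet> \<zeta> ?v = (fst m *\<^sub>R \<zeta> ?v + snd m *\<^sub>R (\<omega> y + c ?v *\<^sub>R \<zeta> ?v)) \<bullet> \<zeta> ?v"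
    using m(2) by simp
  then have "fst m = 2 * ?h * time_r y" using z m2 by (simp add: inner_add_left)
  then show "dd time_r y (1, 0) = 2 * ?h * (time_r y)\<^sup>2 - ?ff"
    using m(1) m2 by (simp add: power2_eq_square)
  obtain n where "cov (rw_metric f) X y (1, 0) (0, 1) = dd X y n"
    using null[OF y] unfolding null_dir_def by blast
  then have n: "dd time_v y (1, 0) + ?ff * c ?v = fst n * time_r y + snd n * time_v y"
    "\<zeta>' ?v + (?h * time_r y) *\<^sub>R \<omega> y + (?h * (time_r y * c ?v + time_v y)) *\<^sub>R \<zeta> ?v
       = fst n *\<^sub>R \<zeta> ?v + snd n *\<^sub>R (\<omega> y + c ?v *\<^sub>R \<zeta> ?v)"
    unfolding c2 lin[of n] dd_X[OF y] by simp_all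
  have "(\<zeta>' ?v + (?h * time_r y) *\<^sub>R \<omega> y + (?h * (time_r y * c ?v + time_v y)) *\<^sub>R \<zeta> ?v) \<bullet> \<zeta> ?v
       = (fst n *\<^sub>R \<zeta> ?v + snd n *\<^sub>R (\<omega> y + c ?v *\<^sub>R \<zeta> ?v)) \<bullet> \<zeta> ?v"
    using n(2) by simp
  then have n1: "?h * (time_r y * c ?v + time_v y) = fst n + snd n * c ?v"
    using z w by (simp add: inner_add_left)
  \<comment> \<open>The \<zeta>-component has just been seen to vanish, so \<zeta>' is a multiple of
    \<omega>: the ruled surface is developable.\<close>
  have "\<zeta>' ?v = (snd n - ?h * time_r y) *\<^sub>R \<omega> y + (fst n + snd n * c ?v - ?h * (time_r y * c ?v + time_v y)) *\<^sub>R \<zeta> ?v"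
    using n(2) by (simp add: algebra_simps)
  then have zq: "\<zeta>' ?v = (snd n - ?h * time_r y) *\<^sub>R \<omega> y" by (simp add: n1)
  then have q: "q y = snd n - ?h * time_r y" using w0 by (simp add: q_def)
  show "\<zeta>' ?v = q y *\<^sub>R \<omega> y" using zq q by simp
  have e: "fst n = ?h * (time_r y * c ?v + time_v y) - (q y + ?h * time_r y) * c ?v" "snd n = q y + ?h * time_r y"
    using n1 q by auto
  show "dd time_v y (1, 0) + ?ff * c ?v = 2 * ?h * time_r y * time_v y + q y * (time_v y - c ?v * time_r y)"
    unfolding n(1) e by (simp add: algebra_simps)
qed

text \<open>A Riccati equation, obtained by differentiating \<open>\<zeta>' = q \<omega>\<close>
  along the line: the left side is constant there and the derivative of \<omega> is again
  \<zeta>'.\<close>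

lemma dd_q: assumes y: "y \<in> A \<times> B" shows "dd q y (1, 0) = - (q y)\<^sup>2"
proof -
  have "dd (\<lambda>y. \<zeta>' (snd y)) y = dd (\<lambda>y. q y *\<^sub>R \<omega> y) y"
    by (rule dd_cong(1)[OF patch(1) y null_equations(2) snd_fun_differentiable[OF smooth_\<zeta>' y]])
  then have "q y *\<^sub>R \<zeta>' (snd y) + dd q y (1, 0) *\<^sub>R \<omega> y = 0"
    using dd_snd_fun[OF smooth_\<zeta>' y, of "(1, 0)"]
      dd_scaleR[OF smooth_on_differentiable[OF smooth_q y] smooth_on_differentiable[OF smooth_\<omega> y], of "(1, 0)"]
    by (simp add: dd_\<omega>[OF y])
  then have "(q y * q y + dd q y (1, 0)) *\<^sub>R \<omega> y = 0"
    unfolding null_equations(2)[OF y] by (simp add: scaleR_add_left)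
  then show ?thesis using \<omega>_nonzero[OF y] by (simp add: power2_eq_square)
qed

lemma dd_comp_time:
  assumes y: "y \<in> A \<times> B" and g: "(g has_real_derivative g') (at (time y))"
  shows "dd (\<lambda>y. g (time y)) y w = g' * dd time y w" "(\<lambda>y. g (time y)) differentiable (at y)"
proof -
  have "((\<lambda>y. g (time y)) has_derivative (\<lambda>w. g' * dd time y w)) (at y)"
    using has_derivative_compose[OF dd_works[OF smooth_on_differentiable[OF smooth_time y]] g[unfolded has_field_derivative_def]] .
  then show "dd (\<lambda>y. g (time y)) y w = g' * dd time y w" "(\<lambda>y. g (time y)) differentiable (at y)"
    by (auto simp: dd_eqI differentiable_def)
qed

lemma f'_deriv: "t \<in> I \<Longrightarrow> (f' has_real_derivative deriv f' t) (at t)"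
  using smooth_on_differentiable[OF smooth_f'] by (simp add: DERIV_deriv_iff_real_differentiable)

lemma H_deriv:
  assumes "t \<in> I"
  shows "(H has_real_derivative (deriv f' t * f t - (f' t)\<^sup>2) / (f t)\<^sup>2) (at t)"
  unfolding H_def[abs_def] using DERIV_divide[OF f'_deriv[OF assms] f_deriv[OF assms] nonzero[OF assms]]
  by (simp add: power2_eq_square)

lemma ff'_deriv:
  assumes "t \<in> I"
  shows "((\<lambda>t. f t * f' t) has_real_derivative (f' t)\<^sup>2 + f t * deriv f' t) (at t)"
  using DERIV_mult[OF f_deriv[OF assms] f'_deriv[OF assms]] by (simp add: power2_eq_square algebra_simps)

lemma dd_time_rv: "dd time y (1, 0) = time_r y" "dd time y (0, 1) = time_v y"
  by (simp_all add: time_r_def time_v_def)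

section \<open>The integrability condition\<close>

definition "s y = time_v y - c (snd y) * time_r y"

lemma dd_time_v: assumes y: "y \<in> A \<times> B" shows "dd time_r y (0, 1) = dd time_v y (1, 0)"
  unfolding time_r_def[abs_def] time_v_def[abs_def] by (rule dd_symmetric[OF patch(1) smooth_time y])

lemma dd_s: assumes y: "y \<in> A \<times> B"
  shows "dd s y (1, 0) = dd time_v y (1, 0) - c (snd y) * dd time_r y (1, 0)"
proof -
  note dr = smooth_on_differentiable[OF smooth_time_rv(1) y] and dv = smooth_on_differentiable[OF smooth_time_rv(2) y]
  note dc = snd_fun_differentiable[OF smooth_c y]
  show ?thesis
    unfolding s_def[abs_def] dd_diff[OF dv dd_bounded_bilinear(2)[OF bounded_bilinear_mult dc dr]] dd_mult[OF dc dr]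
      dd_snd_fun[OF smooth_c y] by simp
qed

text \<open>Subtracting \<open>c\<close> times the equation for \<open>time_r\<close> from that for
  \<open>time_v\<close> cancels the inhomogeneous terms \<open>f f' c\<close>, so \<open>s\<close>
  obeys a homogeneous linear equation along each line.\<close>

lemma dd_s_eq: assumes y: "y \<in> A \<times> B"
  shows "dd s y (1, 0) = (2 * H (time y) * time_r y + q y) * s y"
  unfolding dd_s[OF y] null_equations(1)[OF y] using null_equations(3)[OF y]
  by (simp add: s_def algebra_simps power2_eq_square)

lemma smooth_s: "smooth_on (A \<times> B) s"
  unfolding s_def[abs_def]
  by (intro smooth_on_diff smooth_on_mult patch(1) smooth_time_rv smooth_on_snd_fun smooth_c)

text \<open>Symmetry of second derivatives and constancy of \<open>c\<close> along the lines turn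
  the second derivative of \<open>s\<close> into the transversal derivative of
  \<open>t_rr\<close>.\<close>

lemma dd_dd_s: assumes y: "y \<in> A \<times> B"
  shows "dd (\<lambda>y. dd s y (1, 0)) y (1, 0) =
    dd (\<lambda>y. dd time_r y (1, 0)) y (0, 1) - c (snd y) * dd (\<lambda>y. dd time_r y (1, 0)) y (1, 0)"
proof -
  let ?r = "\<lambda>y. dd time_r y (1, 0)" and ?v = "\<lambda>y. dd time_v y (1, 0)"
  have dr: "?r differentiable (at y)" and dv: "?v differentiable (at y)"
    by (rule smooth_on_differentiable[OF smooth_on_dd[OF smooth_time_rv(1)] y],
        rule smooth_on_differentiable[OF smooth_on_dd[OF smooth_time_rv(2)] y])
  note dc = snd_fun_differentiable[OF smooth_c y]
  have "dd (\<lambda>y. dd s y (1, 0)) y = dd (\<lambda>y. ?v y - c (snd y) * ?r y) y"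
    by (rule dd_cong(1)[OF patch(1) y dd_s smooth_on_differentiable[OF smooth_on_dd[OF smooth_s] y]])
  then have "dd (\<lambda>y. dd s y (1, 0)) y (1, 0) = dd ?v y (1, 0) - c (snd y) * dd ?r y (1, 0)"
    unfolding dd_diff[OF dv dd_bounded_bilinear(2)[OF bounded_bilinear_mult dc dr]] dd_mult[OF dc dr]
      dd_snd_fun[OF smooth_c y] by simp
  moreover have "dd ?v y (1, 0) = dd ?r y (0, 1)"
  proof -
    have "dd ?v y = dd (\<lambda>y. dd time_r y (0, 1)) y"
      by (rule dd_cong(1)[OF patch(1) y _ dv]) (simp add: dd_time_v)
    then show ?thesis using dd_symmetric[OF patch(1) smooth_time_rv(1) y, of "(0, 1)" "(1, 0)"] by simp
  qed
  ultimately show ?thesis by simp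
qed

text \<open>Differentiating the two null equations along \<open>\<partial>\<^sub>r\<close> and \<open>\<partial>\<^sub>v - c \<partial>\<^sub>r\<close> gives
  \<open>s (f f'' - f'\<^sup>2) = 0\<close>: the null lines are orthogonal to the level lines of the time.\<close>

lemma s_zero: assumes y: "y \<in> A \<times> B" shows "s y = 0"
proof -
  let ?t = "time y"
  have tI: "?t \<in> I" by (rule time_I[OF y])
  note f0 = nonzero[OF tI]
  define a where "a = time_r y"
  define h where "h = H ?t"
  define h' where "h' = (deriv f' ?t * f ?t - (f' ?t)\<^sup>2) / (f ?t)\<^sup>2"
  define g where "g = f ?t * f' ?t"
  define g' where "g' = (f' ?t)\<^sup>2 + f ?t * deriv f' ?t"
  have r: "dd time_r y (1, 0) = 2 * h * a\<^sup>2 - g"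
    unfolding null_equations(1)[OF y] by (simp add: h_def a_def g_def)
  note dH = dd_comp_time[OF y H_deriv[OF tI], folded h'_def] and dF = dd_comp_time[OF y ff'_deriv[OF tI], folded g'_def]
  note dr = smooth_on_differentiable[OF smooth_time_rv(1) y]
  have A: "dd (\<lambda>y. dd time_r y (1, 0)) y w = 2 * h' * dd time y w * a\<^sup>2 + 4 * h * a * dd time_r y w - g' * dd time y w" for w
  proof -
    have d1: "(\<lambda>y. H (time y) * (time_r y * time_r y)) differentiable (at y)"
      by (intro dd_bounded_bilinear(2)[OF bounded_bilinear_mult] dH dr)
    have d1': "(\<lambda>y. 2 * (H (time y) * (time_r y * time_r y))) differentiable (at y)"
      by (intro dd_bounded_linear(2)[OF bounded_linear_mult_right] d1)
    have "dd (\<lambda>y. dd time_r y (1, 0)) y = dd (\<lambda>y. 2 * (H (time y) * (time_r y * time_r y)) - f (time y) * f' (time y)) y"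
      by (rule dd_cong(1)[OF patch(1) y _ smooth_on_differentiable[OF smooth_on_dd[OF smooth_time_rv(1)] y]])
         (simp add: null_equations(1) power2_eq_square)
    then show ?thesis
      unfolding dd_diff[OF d1' dF(2)] dd_bounded_linear(1)[OF bounded_linear_mult_right d1]
        dd_mult[OF dH(2) dd_bounded_bilinear(2)[OF bounded_bilinear_mult dr dr]] dd_mult[OF dr dr] dH(1) dF(1)
      by (simp add: a_def h_def power2_eq_square algebra_simps)
  qed
  \<comment> \<open>First evaluation: the transversal derivative of the equation for
    \<open>t_rr\<close>.\<close>
  have L: "dd (\<lambda>y. dd s y (1, 0)) y (1, 0) = 2 * h' * s y * a\<^sup>2 + 4 * h * a * dd s y (1, 0) - g' * s y"
    unfolding dd_dd_s[OF y] A dd_s[OF y] dd_time_rv dd_time_v[OF y] s_def by (simp add: algebra_simps a_def)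
  \<comment> \<open>Second evaluation: the linear equation for \<open>s\<close> differentiated along
    the line, with the Riccati equation for \<open>q\<close>.\<close>
  have R: "dd (\<lambda>y. dd s y (1, 0)) y (1, 0) =
     (2 * h' * a * a + 2 * h * dd time_r y (1, 0) - (q y)\<^sup>2) * s y + (2 * h * a + q y) * dd s y (1, 0)"
  proof -
    have d1: "(\<lambda>y. H (time y) * time_r y) differentiable (at y)"
      by (intro dd_bounded_bilinear(2)[OF bounded_bilinear_mult] dH dr)
    have d2: "(\<lambda>y. 2 * (H (time y) * time_r y)) differentiable (at y)"
      by (intro dd_bounded_linear(2)[OF bounded_linear_mult_right] d1)
    note dq = smooth_on_differentiable[OF smooth_q y] and ds = smooth_on_differentiable[OF smooth_s y]
    have d3: "(\<lambda>y. 2 * (H (time y) * time_r y) + q y) differentiable (at y)"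
      using d2 dq by simp
    have "dd (\<lambda>y. dd s y (1, 0)) y = dd (\<lambda>y. (2 * (H (time y) * time_r y) + q y) * s y) y"
      by (rule dd_cong(1)[OF patch(1) y _ smooth_on_differentiable[OF smooth_on_dd[OF smooth_s] y]])
         (simp add: dd_s_eq)
    then have e: "dd (\<lambda>y. dd s y (1, 0)) y (1, 0) = dd (\<lambda>y. (2 * (H (time y) * time_r y) + q y) * s y) y (1, 0)"
      by (rule fun_cong)
    show ?thesis
      unfolding e dd_mult[OF d3 ds] dd_add[OF d2 dq] dd_bounded_linear(1)[OF bounded_linear_mult_right d1]
        dd_mult[OF dH(2) dr] dH(1) dd_q[OF y] dd_time_rv
      by (simp add: a_def h_def algebra_simps)
  qed
  have S: "dd s y (1, 0) = (2 * h * a + q y) * s y" unfolding dd_s_eq[OF y] by (simp add: h_def a_def)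
  \<comment> \<open>All terms containing \<open>time_r\<close> or \<open>q\<close> agree on both
    sides; the remaining factor depends on the time alone and equals
    \<open>f'^2 - f f''\<close>.\<close>
  have "(2 * h * g - g') * s y = 0"
    using L R unfolding S r by (auto simp: algebra_simps power2_eq_square)
  moreover have "2 * h * g - g' = - ((f ?t)\<^sup>2 * (deriv f' ?t / f ?t - (f' ?t)\<^sup>2 / (f ?t)\<^sup>2))"
    unfolding h_def g_def g'_def H_def using f0 by (simp add: field_simps power2_eq_square)
  ultimately show ?thesis using curvature[OF tI] f0 by simp
qed

section \<open>The time function along the null lines\<close>

lemma time_v_eq: "y \<in> A \<times> B \<Longrightarrow> time_v y = c (snd y) * time_r y"
  using s_zero[of y] by (simp add: s_def)

lemma time_r_nonzero: assumes y: "y \<in> A \<times> B" shows "time_r y \<noteq> 0"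
proof
  assume "time_r y = 0"
  then have "fst (dd X y w) = 0" for w
    unfolding plane_linear_apply[OF smooth_on_linear[OF patch(2) y], of w] dd_X[OF y]
    using time_v_eq[OF y] by simp
  then show False using time_nonconstant[OF y] by simp
qed

lemma time_r_bound: assumes y: "y \<in> A \<times> B" shows "(time_r y)\<^sup>2 < (f (time y))\<^sup>2"
  using time_less_space[OF y, of "(1, 0)"] \<zeta>_orth(1)[of "snd y"] y
  by (auto simp: dd_X[OF y] zero_prod_def time_def)

text \<open>With \<open>g = 1 / f^2\<close>, the square of \<open>time_r * g\<close> and
  \<open>g\<close> have equal derivatives along a line. The bound on \<open>time_r\<close> from the
  space-like condition makes the constant negative, and convexity of the domain makes it the same
  for all lines.\<close>

lemma energy_constant:
  obtains K where "K < 0" "\<And>y. y \<in> A \<times> B \<Longrightarrow> (time_r y)\<^sup>2 = (f (time y))\<^sup>2 + K * (f (time y))^4"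
proof -
  define g where "g t = inverse ((f t)\<^sup>2)" for t
  have g': "(g has_real_derivative - 2 * f' t * f t * (g t)\<^sup>2) (at t)" if "t \<in> I" for t
    unfolding g_def using nonzero[OF that]
    by (auto intro!: derivative_eq_intros f_deriv[OF that] simp: power2_eq_square)
  define E where "E y = (time_r y * g (time y))\<^sup>2 - g (time y)" for y
  have dE: "(E has_derivative (\<lambda>h. 0)) (at y)" if y: "y \<in> A \<times> B" for y
  proof -
    let ?t = "time y"
    have tI: "?t \<in> I" by (rule time_I[OF y])
    note f0 = nonzero[OF tI]
    have gd: "((\<lambda>y. g (time y)) has_derivative (\<lambda>w. - 2 * f' ?t * f ?t * (g ?t)\<^sup>2 * dd time y w)) (at y)"
      using has_derivative_compose[OF dd_works[OF smooth_on_differentiable[OF smooth_time y]] g'[OF tI, unfolded has_field_derivative_def]] .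
    note rd = dd_works[OF smooth_on_differentiable[OF smooth_time_rv(1) y]]
    define P where "P w = 2 * (time_r y * g ?t) * (dd time_r y w * g ?t + time_r y * (- 2 * f' ?t * f ?t * (g ?t)\<^sup>2 * dd time y w))
       + 2 * f' ?t * f ?t * (g ?t)\<^sup>2 * dd time y w" for w
    have "(E has_derivative P) (at y)"
      unfolding E_def[abs_def] P_def[abs_def] power2_eq_square
      by (rule derivative_eq_intros gd[unfolded power2_eq_square] rd refl)+ (simp add: fun_eq_iff algebra_simps)
    moreover have "P w = 0" for w
    proof -
      have r1: "dd time_r y (1, 0) = 2 * H ?t * (time_r y)\<^sup>2 - f ?t * f' ?t" by (rule null_equations(1)[OF y])
      have hf: "H ?t = f' ?t * f ?t * g ?t" using f0 by (simp add: H_def g_def power2_eq_square field_simps)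
      have p1: "P (1, 0) = 0"
        unfolding P_def r1 hf dd_time_rv by (simp add: algebra_simps power2_eq_square)
      have "dd time_v y (1, 0) = c (snd y) * dd time_r y (1, 0)"
      proof -
        note dc = snd_fun_differentiable[OF smooth_c y] and dr = smooth_on_differentiable[OF smooth_time_rv(1) y]
        have "dd time_v y = dd (\<lambda>y. c (snd y) * time_r y) y"
          by (rule dd_cong(1)[OF patch(1) y time_v_eq smooth_on_differentiable[OF smooth_time_rv(2) y]])
        then show ?thesis unfolding dd_mult[OF dc dr] dd_snd_fun[OF smooth_c y]
          using dd_mult[OF dc dr, of "(1, 0)"] dd_snd_fun[OF smooth_c y, of "(1, 0)"] by simp
      qed
      \<comment> \<open>By \<open>time_v_eq\<close>, the v-derivatives of both \<open>time\<close>
        and \<open>time_r\<close> are \<open>c\<close> times their r-derivatives, so constancy along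
        the lines implies constancy across them.\<close>
      then have "P (0, 1) = c (snd y) * P (1, 0)"
        unfolding P_def dd_time_rv dd_time_v[OF y] time_v_eq[OF y] by (simp add: algebra_simps)
      then have p2: "P (0, 1) = 0" using p1 by simp
      have "linear P" using \<open>(E has_derivative P) (at y)\<close> by (rule has_derivative_linear)
      then show ?thesis using plane_linear_apply[of P w] p1 p2 by simp
    qed
    then have "P = (\<lambda>h. 0)" by (simp add: fun_eq_iff)
    ultimately show ?thesis by simp
  qed
  have "\<exists>K. \<forall>y\<in>A \<times> B. E y = K"
  proof (rule has_derivative_zero_constant)
    show "convex (A \<times> B)"
      using A B by (intro convex_Times) (simp_all add: open_interval_def is_interval_convex_1)
  qed (rule has_derivative_at_withinI[OF dE])
  then obtain K where K: "\<And>y. y \<in> A \<times> B \<Longrightarrow> E y = K" by blast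
  have eq: "(time_r y)\<^sup>2 = (f (time y))\<^sup>2 + K * (f (time y))^4" if y: "y \<in> A \<times> B" for y
  proof -
    have f0: "f (time y) \<noteq> 0" by (rule nonzero[OF time_I[OF y]])
    have "(time_r y)\<^sup>2 = (f (time y))^4 * (E y + g (time y))"
      unfolding E_def g_def using f0 by (simp add: field_simps power2_eq_square power4_eq_xxxx)
    also have "\<dots> = (f (time y))\<^sup>2 + K * (f (time y))^4"
      unfolding K[OF y] g_def using f0 by (simp add: field_simps power2_eq_square power4_eq_xxxx)
    finally show ?thesis .
  qed
  obtain y where y: "y \<in> A \<times> B" using A B by (auto simp: open_interval_def)
  have "K * (f (time y))^4 < 0" using eq[OF y] time_r_bound[OF y] by simp
  then have "K < 0" by (simp add: mult_less_0_iff)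
  then show thesis using that eq by blast
qed

end

section \<open>The adapted frame and the characterization\<close>

lemma smooth_on_has_vector_derivative:
  fixes g :: "real \<Rightarrow> 'z::real_normed_vector"
  assumes "smooth_on J g" "v \<in> J"
  shows "(g has_vector_derivative dd g v 1) (at v)"
proof -
  note d = smooth_on_differentiable[OF assms]
  have "dd g v = (\<lambda>h. h *\<^sub>R dd g v 1)"
  proof
    fix h show "dd g v h = h *\<^sub>R dd g v 1"
      using linear_cmul[OF dd_linear[OF d], of h 1] by simp
  qed
  then show ?thesis
    unfolding has_vector_derivative_def by (rule has_derivative_eq_rhs[OF dd_works[OF d]])
qed

unbundle cross3_syntax

text \<open>The curve \<open>b\<close> is orthogonal to the line directions, and \<zeta> changes
  only in the direction of \<open>b\<close>. With the unit tangent as \<alpha>1 and \<zeta> as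
  second vector, the second and third vector do not rotate into each other, so two functions
  describe the frame. The \<phi>i are the components of \<open>b\<close>.\<close>

lemma adapted_frame:
  fixes \<zeta> b :: "real \<Rightarrow> real^3"
  assumes J: "open J" and sm: "smooth_on J \<zeta>" "smooth_on J b"
    and \<zeta>1: "\<And>v. v \<in> J \<Longrightarrow> norm (\<zeta> v) = 1" and b0: "\<And>v. v \<in> J \<Longrightarrow> dd b v 1 \<noteq> 0"
    and b\<zeta>: "\<And>v. v \<in> J \<Longrightarrow> dd b v 1 \<bullet> \<zeta> v = 0" and par: "\<And>v. v \<in> J \<Longrightarrow> dd \<zeta> v 1 = l v *\<^sub>R dd b v 1"
  obtains a1 a2 \<phi>1 \<phi>2 \<phi>3 \<alpha>1 \<alpha>3 where
    "smooth_on J a1" "smooth_on J a2" "smooth_on J \<phi>1" "smooth_on J \<phi>2" "smooth_on J \<phi>3"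
    "smooth_on J \<alpha>1" "smooth_on J \<alpha>3"
    "\<forall>v\<in>J. (\<phi>2 has_real_derivative - a1 v * \<phi>1 v) (at v)"
    "\<forall>v\<in>J. (\<phi>3 has_real_derivative - a2 v * \<phi>1 v) (at v)"
    "\<forall>v\<in>J. (\<alpha>1 has_vector_derivative a1 v *\<^sub>R \<zeta> v + a2 v *\<^sub>R \<alpha>3 v) (at v)"
    "\<forall>v\<in>J. (\<zeta> has_vector_derivative - a1 v *\<^sub>R \<alpha>1 v) (at v)"
    "\<forall>v\<in>J. (\<alpha>3 has_vector_derivative - a2 v *\<^sub>R \<alpha>1 v) (at v)"
    "\<And>v. v \<in> J \<Longrightarrow> norm (\<alpha>1 v) = 1" "\<And>v. v \<in> J \<Longrightarrow> norm (\<alpha>3 v) = 1"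
    "\<And>v. v \<in> J \<Longrightarrow> \<alpha>1 v \<bullet> \<zeta> v = 0" "\<And>v. v \<in> J \<Longrightarrow> \<alpha>1 v \<bullet> \<alpha>3 v = 0" "\<And>v. v \<in> J \<Longrightarrow> \<zeta> v \<bullet> \<alpha>3 v = 0"
    "\<And>v. v \<in> J \<Longrightarrow> \<phi>1 v *\<^sub>R \<alpha>1 v + \<phi>2 v *\<^sub>R \<zeta> v + \<phi>3 v *\<^sub>R \<alpha>3 v = b v"
proof -
  define w where "w v = dd b v 1" for v
  define \<alpha>1 where "\<alpha>1 v = inverse (norm (w v)) *\<^sub>R w v" for v
  define \<alpha>3 where "\<alpha>3 v = \<alpha>1 v \<times> \<zeta> v" for v
  define a1 where "a1 v = - (dd \<zeta> v 1 \<bullet> \<alpha>1 v)" for v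
  define a2 where "a2 v = dd \<alpha>1 v 1 \<bullet> \<alpha>3 v" for v
  define \<phi>1 where "\<phi>1 v = b v \<bullet> \<alpha>1 v" for v
  define \<phi>2 where "\<phi>2 v = b v \<bullet> \<zeta> v" for v
  define \<phi>3 where "\<phi>3 v = b v \<bullet> \<alpha>3 v" for v
  have sw: "smooth_on J w" unfolding w_def[abs_def] by (rule smooth_on_dd[OF sm(2)])
  have s1: "smooth_on J \<alpha>1"
    unfolding \<alpha>1_def[abs_def] using b0 by (intro smooth_on_scaleR smooth_on_inverse smooth_on_norm J sw) (auto simp: w_def)
  have s3: "smooth_on J \<alpha>3" unfolding \<alpha>3_def[abs_def] by (intro smooth_on_cross3 J s1 sm)
  have sa: "smooth_on J a1" "smooth_on J a2"
    unfolding a1_def[abs_def] a2_def[abs_def] by (intro smooth_on_minus smooth_on_inner smooth_on_dd J sm s1 s3)+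
  have s\<phi>: "smooth_on J \<phi>1" "smooth_on J \<phi>2" "smooth_on J \<phi>3"
    unfolding \<phi>1_def[abs_def] \<phi>2_def[abs_def] \<phi>3_def[abs_def] by (intro smooth_on_inner J sm s1 s3)+
  have main: "dd \<phi>2 v 1 = - a1 v * \<phi>1 v \<and> dd \<phi>3 v 1 = - a2 v * \<phi>1 v \<and>
      dd \<alpha>1 v 1 = a1 v *\<^sub>R \<zeta> v + a2 v *\<^sub>R \<alpha>3 v \<and> dd \<zeta> v 1 = - a1 v *\<^sub>R \<alpha>1 v \<and> dd \<alpha>3 v 1 = - a2 v *\<^sub>R \<alpha>1 v \<and>
      norm (\<alpha>1 v) = 1 \<and> norm (\<alpha>3 v) = 1 \<and> \<alpha>1 v \<bullet> \<zeta> v = 0 \<and> \<alpha>1 v \<bullet> \<alpha>3 v = 0 \<and> \<zeta> v \<bullet> \<alpha>3 v = 0 \<and>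
      \<phi>1 v *\<^sub>R \<alpha>1 v + \<phi>2 v *\<^sub>R \<zeta> v + \<phi>3 v *\<^sub>R \<alpha>3 v = b v" if v: "v \<in> J" for v
  proof -
    have w0: "norm (w v) \<noteq> 0" using b0[OF v] by (simp add: w_def)
    have n1: "norm (\<alpha>1 u) = 1" and o12: "\<alpha>1 u \<bullet> \<zeta> u = 0" if u: "u \<in> J" for u
      using b0[OF u] b\<zeta>[OF u] by (simp_all add: \<alpha>1_def w_def)
    note fr = orthonormal_frame_expansion[OF n1[OF v] \<zeta>1[OF v] o12[OF v], folded \<alpha>3_def]
    have o13: "\<alpha>1 v \<bullet> \<alpha>3 v = 0" and o23: "\<zeta> v \<bullet> \<alpha>3 v = 0" by (simp_all add: \<alpha>3_def dot_cross_self)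
    have wa: "w v = norm (w v) *\<^sub>R \<alpha>1 v" using w0 by (simp add: \<alpha>1_def)
    have n11: "\<alpha>1 v \<bullet> \<alpha>1 v = 1" using n1[OF v] by (simp add: dot_square_norm)
    note d1 = smooth_on_differentiable[OF s1 v] and d2 = smooth_on_differentiable[OF sm(1) v]
      and d3 = smooth_on_differentiable[OF s3 v] and db = smooth_on_differentiable[OF sm(2) v]
    have \<zeta>': "dd \<zeta> v 1 = - a1 v *\<^sub>R \<alpha>1 v"
    proof -
      have "dd \<zeta> v 1 = (l v * norm (w v)) *\<^sub>R \<alpha>1 v" using par[OF v] wa by (metis scaleR_scaleR w_def)
      then show ?thesis using n11 by (simp add: a1_def)
    qed
    have "dd (\<lambda>v. \<alpha>1 v \<bullet> \<alpha>1 v) v 1 = 0"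
      by (rule dd_eq_0[OF J v, of _ 1]) (simp add: n1 dot_square_norm)
    then have e11: "dd \<alpha>1 v 1 \<bullet> \<alpha>1 v = 0" using dd_inner[OF d1 d1] by (simp add: inner_commute)
    have "dd (\<lambda>v. \<alpha>1 v \<bullet> \<zeta> v) v 1 = 0"
      by (rule dd_eq_0[OF J v, of _ 0]) (simp add: o12)
    then have e12: "dd \<alpha>1 v 1 \<bullet> \<zeta> v = a1 v" using dd_inner[OF d1 d2] n11 by (simp add: \<zeta>')
    have \<alpha>1': "dd \<alpha>1 v 1 = a1 v *\<^sub>R \<zeta> v + a2 v *\<^sub>R \<alpha>3 v"
      using fr(1)[of "dd \<alpha>1 v 1"] e11 e12 by (simp add: a2_def inner_commute)
    have bb: "bounded_bilinear cross3" by (simp add: bilinear_conv_bounded_bilinear[symmetric] bilinear_cross)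
    have "dd \<alpha>3 v 1 = \<alpha>1 v \<times> dd \<zeta> v 1 + dd \<alpha>1 v 1 \<times> \<zeta> v"
      unfolding \<alpha>3_def[abs_def] by (simp add: dd_bounded_bilinear(1)[OF bb d1 d2])
    \<comment> \<open>The product with \<zeta>' vanishes because \<zeta>' is parallel to \<alpha>1,
      and the \<open>a1\<close> part of \<alpha>1' is parallel to \<zeta>.\<close>
    also have "\<dots> = a2 v *\<^sub>R (\<alpha>3 v \<times> \<zeta> v)"
      unfolding \<zeta>' \<alpha>1' by (simp add: cross_mult_right cross_add_left cross_mult_left)
    also have "\<alpha>3 v \<times> \<zeta> v = - \<alpha>1 v" using fr(3) cross_skew[of "\<alpha>3 v" "\<zeta> v"] by simp
    finally have \<alpha>3': "dd \<alpha>3 v 1 = - a2 v *\<^sub>R \<alpha>1 v" by simp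
    have b': "dd b v 1 = norm (w v) *\<^sub>R \<alpha>1 v" using wa by (simp add: w_def)
    have p2: "dd \<phi>2 v 1 = - a1 v * \<phi>1 v"
      unfolding \<phi>2_def[abs_def] dd_inner[OF db d2] \<zeta>' b' using o12[OF v] by (simp add: \<phi>1_def)
    have p3: "dd \<phi>3 v 1 = - a2 v * \<phi>1 v"
      unfolding \<phi>3_def[abs_def] dd_inner[OF db d3] \<alpha>3' b' using o13 by (simp add: \<phi>1_def)
    have "\<phi>1 v *\<^sub>R \<alpha>1 v + \<phi>2 v *\<^sub>R \<zeta> v + \<phi>3 v *\<^sub>R \<alpha>3 v = b v"
      using fr(1)[of "b v"] by (simp add: \<phi>1_def \<phi>2_def \<phi>3_def inner_commute)
    then show ?thesis
      using p2 p3 \<alpha>1' \<zeta>' \<alpha>3' n1[OF v] fr(2) o12[OF v] o13 o23 by blast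
  qed
  note vd = smooth_on_has_vector_derivative
  show thesis
  proof (rule that[of a1 a2 \<phi>1 \<phi>2 \<phi>3 \<alpha>1 \<alpha>3])
    show "\<forall>v\<in>J. (\<phi>2 has_real_derivative - a1 v * \<phi>1 v) (at v)" "\<forall>v\<in>J. (\<phi>3 has_real_derivative - a2 v * \<phi>1 v) (at v)"
      unfolding has_real_derivative_iff_has_vector_derivative
      using vd[OF s\<phi>(2)] vd[OF s\<phi>(3)] main by metis+
    show "\<forall>v\<in>J. (\<alpha>1 has_vector_derivative a1 v *\<^sub>R \<zeta> v + a2 v *\<^sub>R \<alpha>3 v) (at v)"
      using vd[OF s1] main by metis
    show "\<forall>v\<in>J. (\<zeta> has_vector_derivative - a1 v *\<^sub>R \<alpha>1 v) (at v)"
      using vd[OF sm(1)] main by metis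
    show "\<forall>v\<in>J. (\<alpha>3 has_vector_derivative - a2 v *\<^sub>R \<alpha>1 v) (at v)"
      using vd[OF s3] main by metis
  qed (use s1 s3 sa s\<phi> main in blast)+
qed

unbundle no cross3_syntax

lemma isometry_of_ident:
  assumes "open L"
  shows "isometry_of g L (\<lambda>x. x)"
proof -
  have "inv_into L (\<lambda>x. x) x = x" if "x \<in> L" for x
    using inv_into_f_f[of "\<lambda>x. x" L x] that by simp
  then have "smooth_on L (inv_into L (\<lambda>x. x))"
    using smooth_on_cong[OF assms _ smooth_on_ident, of "inv_into L (\<lambda>x. x)"] by simp
  moreover have "dd (\<lambda>x. x) p = (\<lambda>v. v)" for p :: 'a by (rule dd_eqI) (rule has_derivative_ident)
  ultimately show ?thesis
    by (simp add: isometry_of_def bij_betw_def smooth_on_ident)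
qed

context robertson_walker
begin

text \<open>If the time differential vanishes on the tangent plane, then \<open>time_field\<close>
  is orthogonal to that plane and its tangential part is zero.\<close>

lemma time_nonconstant_if_time_tangential_nonzero:
  fixes M :: "'m::topological_space set" and W :: "(real \<times> real) set"
  assumes sp: "spacelike_surface (rw_metric f) (rw_space I) M \<psi>" and lp: "local_param M \<psi> W \<sigma>"
    and y: "y \<in> W" and T: "time_tangential f M \<psi> (\<sigma> y) \<noteq> 0"
  shows "\<exists>w. fst (dd (\<psi> \<circ> \<sigma>) y w) \<noteq> 0"
proof (rule ccontr)
  interpret spacelike_patch I f W "\<psi> \<circ> \<sigma>" by (rule local_param_spacelike[OF sp lp])
  assume "\<not> (\<exists>w. fst (dd (\<psi> \<circ> \<sigma>) y w) \<noteq> 0)"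
  then have z: "fst (dd (\<psi> \<circ> \<sigma>) y w) = 0" for w by blast
  have sub: "subspace (range (dd (\<psi> \<circ> \<sigma>) y))"
    using smooth_on_linear[OF patch(2) y] by (simp add: linear_subspace_image)
  have "tangential_part (rw_metric f ((\<psi> \<circ> \<sigma>) y)) (range (dd (\<psi> \<circ> \<sigma>) y)) time_field = 0"
  proof (rule tangential_part_eqI[OF bilinear_rw_metric sub pos_def_on_imp_nondegenerate_on[OF pos_def[OF y]] subspace_0[OF sub]])
    fix q assume "q \<in> range (dd (\<psi> \<circ> \<sigma>) y)"
    then have "fst q = 0" using z by blast
    then show "rw_metric f ((\<psi> \<circ> \<sigma>) y) (time_field - 0) q = 0" by (simp add: rw_metric_def time_field_def)
  qed
  then show False using T by (simp add: time_tangential_def tangent_plane_eq[OF lp y])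
qed

text \<open>Since \<open>time_r\<close> has no zeros, time can replace \<open>r\<close> as first
  coordinate. Then \<open>r\<close> is a function \<rho> of time and \<open>v\<close>: its time
  derivative is the integrand of the parametrization, and its value at the fixed time
  \<open>u0\<close> enters the curve \<open>b\<close>.\<close>

lemma local_nullity_surface:
  fixes M :: "'m::topological_space set"
  assumes sp: "spacelike_surface (rw_metric f) (rw_space I) M \<psi>"
    and sld: "smooth_line_distribution M \<psi> (relative_null_space (rw_metric f) M \<psi>)"
    and ntg: "\<not> (\<exists>U H. openin (top_of_set M) U \<and> U \<noteq> {} \<and> \<psi> ` U \<subseteq> H \<and>
              totally_geodesic_hypersurface (rw_metric f) (rw_space I) H)"
    and T: "\<forall>p\<in>M. time_tangential f M \<psi> p \<noteq> 0"
    and curv: "\<forall>t\<in>I. deriv (deriv f) t / f t - (deriv f t)\<^sup>2 / (f t)\<^sup>2 \<noteq> 0"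
    and p: "p \<in> M"
  obtains D \<sigma> where "local_param M \<psi> D \<sigma>" "p \<in> \<sigma> ` D" "nullity_surface f I D (\<psi> \<circ> \<sigma>)"
proof -
  obtain A B \<sigma> \<zeta> \<beta> where AB: "open_interval A" "open_interval B" and lp: "local_param M \<psi> (A \<times> B) \<sigma>" "p \<in> \<sigma> ` (A \<times> B)"
    and sm: "smooth_on B \<zeta>" "smooth_on B \<beta>" and \<zeta>: "\<And>v. v \<in> B \<Longrightarrow> norm (\<zeta> v) = 1" "\<And>v. v \<in> B \<Longrightarrow> \<zeta> v \<bullet> \<beta> v = 0"
    and ruled: "\<And>r v. r \<in> A \<Longrightarrow> v \<in> B \<Longrightarrow> snd ((\<psi> \<circ> \<sigma>) (r, v)) = r *\<^sub>R \<zeta> v + \<beta> v"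
    and null: "\<And>y. y \<in> A \<times> B \<Longrightarrow> null_dir (rw_metric f) (\<psi> \<circ> \<sigma>) y (1, 0)"
    by (rule ruled_coordinates[OF sp sld ntg p]; rule that; assumption)
  let ?X = "\<psi> \<circ> \<sigma>"
  interpret spacelike_patch I f "A \<times> B" ?X by (rule local_param_spacelike[OF sp lp(1)])
  interpret ruled_patch I f A B ?X \<zeta> \<beta>
  proof
    fix y assume y: "y \<in> A \<times> B"
    have "\<sigma> y \<in> M" using lp(1) y openin_imp_subset unfolding local_param_def by blast
    then show "\<exists>w. fst (dd ?X y w) \<noteq> 0"
      using time_nonconstant_if_time_tangential_nonzero[OF sp lp(1) y] T by blast
  qed (use AB sm \<zeta> ruled null curv in auto)
  obtain K where K: "K < 0" "\<And>y. y \<in> A \<times> B \<Longrightarrow> (time_r y)\<^sup>2 = (f (time y))\<^sup>2 + K * (f (time y))^4"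
    by (rule energy_constant; (rule that)?; assumption)
  obtain y0 where y0: "y0 \<in> A \<times> B" "p = \<sigma> y0" using lp(2) by blast
  define \<Phi> where "\<Phi> y = (time y, snd y)" for y
  have s\<Phi>: "smooth_on (A \<times> B) \<Phi>"
    unfolding \<Phi>_def[abs_def] by (intro smooth_on_Pair smooth_on_snd[OF patch(1) smooth_on_ident] smooth_time patch(1))
  have d\<Phi>: "dd \<Phi> y h = (fst h * time_r y + snd h * time_v y, snd h)" if y: "y \<in> A \<times> B" for y h
  proof -
    have "(\<Phi> has_derivative (\<lambda>h. (dd time y h, snd h))) (at y)"
      unfolding \<Phi>_def[abs_def]
      by (intro has_derivative_Pair dd_works smooth_on_differentiable[OF smooth_time y]
          bounded_linear_imp_has_derivative bounded_linear_snd)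
    from dd_eqI[OF this] show ?thesis
      using plane_linear_apply[OF smooth_on_linear[OF smooth_time y], of h] by (simp add: dd_time_rv)
  qed
  have inj: "inj (dd \<Phi> y0)"
    unfolding linear_injective_0[OF smooth_on_linear[OF s\<Phi> y0(1)]] d\<Phi>[OF y0(1)]
    using time_r_nonzero[OF y0(1)] by (auto simp: zero_prod_def)
  obtain J L G where JL: "open_interval J" "open_interval L" "\<Phi> y0 \<in> J \<times> L" and lp': "local_param M \<psi> (J \<times> L) (\<sigma> \<circ> G)"
    and sG: "smooth_on (J \<times> L) G" "G ` (J \<times> L) \<subseteq> A \<times> B" "G (\<Phi> y0) = y0" and \<Phi>G: "\<And>y. y \<in> J \<times> L \<Longrightarrow> \<Phi> (G y) = y"
    and dG: "\<And>y v. y \<in> J \<times> L \<Longrightarrow> dd \<Phi> (G y) (dd G y v) = v"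
    by (rule local_param_coordinates[OF lp(1) s\<Phi> y0(1) inj]; rule that; assumption)
  have oJL: "open J" "open L" "open (J \<times> L)" using JL by (auto simp: open_interval_def open_Times)
  have GA: "G y \<in> A \<times> B" if "y \<in> J \<times> L" for y using sG(2) that by blast
  have Gs: "snd (G y) = snd y" "time (G y) = fst y" if "y \<in> J \<times> L" for y
    using \<Phi>G[OF that] by (auto simp: \<Phi>_def prod_eq_iff)
  define u0 where "u0 = fst (\<Phi> y0)"
  define v0 where "v0 = snd (\<Phi> y0)"
  have u0: "u0 \<in> J" and v0: "v0 \<in> L" using JL(3) by (auto simp: u0_def v0_def)
  have JI: "J \<subseteq> I"
    using Gs(2)[of "(_, v0)"] time_I[OF GA, of "(_, v0)"] v0 by fastforce
  have LB: "L \<subseteq> B"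
    using Gs(1)[of "(u0, _)"] GA[of "(u0, _)"] u0 by fastforce
  define \<rho> where "\<rho> y = fst (G y)" for y
  have s\<rho>: "smooth_on (J \<times> L) \<rho>" unfolding \<rho>_def[abs_def] by (rule smooth_on_fst[OF oJL(3) sG(1)])
  have d\<rho>: "dd \<rho> y w = fst w / time_r (G y) - c (snd y) * snd w" if y: "y \<in> J \<times> L" for y w
  proof -
    have "dd \<rho> y w = fst (dd G y w)"
      unfolding \<rho>_def[abs_def] using dd_bounded_linear(1)[OF bounded_linear_fst smooth_on_differentiable[OF sG(1) y]] by simp
    moreover have "fst (dd G y w) * time_r (G y) + snd (dd G y w) * time_v (G y) = fst w" "snd (dd G y w) = snd w"
      using dG[OF y, of w] unfolding d\<Phi>[OF GA[OF y]] by (auto simp: prod_eq_iff)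
    ultimately show ?thesis
      using time_r_nonzero[OF GA[OF y]] time_v_eq[OF GA[OF y]] Gs(1)[OF y] by (simp add: field_simps)
  qed
  \<comment> \<open>Chosen so that \<open>K = - 1 / a0^2\<close>; the first integral then becomes
    \<open>tr2\<close>.\<close>
  define a0 where "a0 = sqrt (- 1 / K)"
  have a0: "a0 > 0" "a0\<^sup>2 = - 1 / K" using K(1) by (simp_all add: a0_def)
  have tr2: "(time_r (G y))\<^sup>2 * a0\<^sup>2 = (f (fst y))\<^sup>2 * (a0\<^sup>2 - (f (fst y))\<^sup>2)" if y: "y \<in> J \<times> L" for y
    unfolding K(2)[OF GA[OF y]] Gs(2)[OF y] a0(2) using K(1) by (simp add: field_simps power2_eq_square power4_eq_xxxx)
  have af: "a0\<^sup>2 - (f u)\<^sup>2 > 0" if u: "u \<in> J" for u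
  proof -
    have y: "(u, v0) \<in> J \<times> L" using u v0 by simp
    have "0 < (time_r (G (u, v0)))\<^sup>2 * a0\<^sup>2" using time_r_nonzero[OF GA[OF y]] a0(1) by simp
    then have "0 < (f u)\<^sup>2 * (a0\<^sup>2 - (f u)\<^sup>2)" using tr2[OF y] by simp
    then show ?thesis by (simp add: zero_less_mult_iff)
  qed
  \<comment> \<open>By \<open>tr2\<close> this quotient is 1 or -1. It records the sign that is lost
    on taking the square root.\<close>
  define e where "e y = time_r (G y) * a0 / (f (fst y) * sqrt (a0\<^sup>2 - (f (fst y))\<^sup>2))" for y
  have nz: "f u * sqrt (a0\<^sup>2 - (f u)\<^sup>2) \<noteq> 0" if "u \<in> J" for u
    using af[OF that] nonzero JI that by auto
  have e2: "(e y)\<^sup>2 = 1" if y: "y \<in> J \<times> L" for y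
  proof -
    have u: "fst y \<in> J" using y by auto
    have "(f (fst y) * sqrt (a0\<^sup>2 - (f (fst y))\<^sup>2))\<^sup>2 = (time_r (G y) * a0)\<^sup>2"
      using af[OF u] tr2[OF y] by (simp add: power_mult_distrib)
    then show ?thesis unfolding e_def power_divide using nz[OF u] by (metis divide_self_if power_not_zero)
  qed
  have cont_f: "continuous_on J (\<lambda>u. f u * sqrt (a0\<^sup>2 - (f u)\<^sup>2))"
    using smooth_on_continuous[OF smooth_on_subset[OF smooth JI]] by (intro continuous_intros)
  have "continuous_on (J \<times> L) e"
    unfolding e_def
  proof (intro continuous_on_divide continuous_on_mult continuous_on_const)
    show "continuous_on (J \<times> L) (\<lambda>y. time_r (G y))"
      by (rule smooth_on_continuous[OF smooth_on_compose[OF oJL(3) sG(2,1) smooth_time_rv(1)]])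
    have cf: "continuous_on (J \<times> L) (\<lambda>y. f (fst y))"
      by (rule continuous_on_compose2[OF smooth_on_continuous[OF smooth_on_subset[OF smooth JI]]])
         (auto intro: continuous_intros)
    then show "continuous_on (J \<times> L) (\<lambda>y. f (fst y))" .
    show "continuous_on (J \<times> L) (\<lambda>y. sqrt (a0\<^sup>2 - (f (fst y))\<^sup>2))"
      by (intro continuous_intros cf)
    show "\<forall>y\<in>J \<times> L. f (fst y) * sqrt (a0\<^sup>2 - (f (fst y))\<^sup>2) \<noteq> 0" using nz by auto
  qed
  moreover have "connected (J \<times> L)"
    using JL by (intro connected_Times) (simp_all add: open_interval_def is_interval_connected_1)
  \<comment> \<open>A continuous function with finitely many values on a connected set is constant,
    so one sign serves the whole patch.\<close>
  moreover have "finite (e ` (J \<times> L))"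
    by (rule finite_subset[of _ "{1, -1}"]) (use e2 in \<open>auto simp: power2_eq_1_iff\<close>)
  ultimately have "e constant_on (J \<times> L)"
    using continuous_finite_range_constant by blast
  then obtain \<epsilon> where \<epsilon>: "\<And>y. y \<in> J \<times> L \<Longrightarrow> e y = \<epsilon>" unfolding constant_on_def by blast
  have \<epsilon>2: "\<epsilon>\<^sup>2 = 1" using e2 \<epsilon> u0 v0 by (metis SigmaI)
  \<comment> \<open>The sign goes into the constant, so that \<open>h\<close> equals
    \<open>1 / time_r\<close> and not merely its absolute value.\<close>
  define a where "a = \<epsilon> * a0"
  have a2: "a\<^sup>2 = a0\<^sup>2" by (simp add: a_def power_mult_distrib \<epsilon>2)
  define h where "h s = a / (f s * sqrt (a\<^sup>2 - (f s)\<^sup>2))" for s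
  have hr: "1 / time_r (G y) = h (fst y)" if y: "y \<in> J \<times> L" for y
  proof -
    have u: "fst y \<in> J" using y by auto
    have "\<epsilon> * (f (fst y) * sqrt (a0\<^sup>2 - (f (fst y))\<^sup>2)) = time_r (G y) * a0"
      using \<epsilon>[OF y] nz[OF u] unfolding e_def by (simp add: field_simps)
    then have "\<epsilon> * \<epsilon> * (f (fst y) * sqrt (a0\<^sup>2 - (f (fst y))\<^sup>2)) = time_r (G y) * a"
      unfolding a_def by (metis mult.assoc mult.left_commute)
    then have "f (fst y) * sqrt (a0\<^sup>2 - (f (fst y))\<^sup>2) = time_r (G y) * a"
      using \<epsilon>2 by (simp add: power2_eq_square)
    then show ?thesis
      unfolding h_def a2 using nz[OF u] time_r_nonzero[OF GA[OF y]] by (simp add: divide_simps)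
  qed
  \<comment> \<open>For fixed \<open>v\<close> the function \<rho> is an antiderivative of
    \<open>h\<close>; the endpoints are ordered by \<open>min\<close> and \<open>max\<close> because
    \<open>u\<close> may precede \<open>u0\<close>.\<close>
  have int: "(LBINT s=ereal u0..ereal u. h s) = \<rho> (u, v) - \<rho> (u0, v)" if u: "u \<in> J" and v: "v \<in> L" for u v
  proof (rule interval_integral_FTC_finite)
    have "{min u0 u..max u0 u} \<subseteq> J"
    proof
      fix s assume "s \<in> {min u0 u..max u0 u}"
      then show "s \<in> J"
        using mem_is_interval_1_I[of J u0 u s] mem_is_interval_1_I[of J u u0 s] u u0 JL(1)
        by (auto simp: open_interval_def min_def max_def split: if_splits)
    qed
    note sub = this
    have "continuous_on J h"
      unfolding h_def a2 using nz by (intro continuous_on_divide continuous_on_const cont_f) auto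
    then show "continuous_on {min u0 u..max u0 u} h" using sub by (rule continuous_on_subset)
    fix s assume "min u0 u \<le> s" "s \<le> max u0 u"
    then have s: "s \<in> J" using sub by auto
    then have sv: "(s, v) \<in> J \<times> L" using v by simp
    have 1: "((\<lambda>s. (s, v)) has_derivative (\<lambda>k. (k, 0))) (at s)"
      by (auto intro!: derivative_eq_intros)
    have "((\<lambda>s. \<rho> (s, v)) has_derivative (\<lambda>k. dd \<rho> (s, v) (k, 0))) (at s)"
      using has_derivative_compose[OF 1 dd_works[OF smooth_on_differentiable[OF s\<rho> sv]]] .
    moreover have "dd \<rho> (s, v) (k, 0) = k *\<^sub>R h s" for k
      using hr[OF sv] by (simp add: d\<rho>[OF sv] divide_inverse)
    ultimately have "((\<lambda>s. \<rho> (s, v)) has_vector_derivative h s) (at s)"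
      by (simp add: has_vector_derivative_def)
    then show "((\<lambda>s. \<rho> (s, v)) has_vector_derivative h s) (at s within {min u0 u..max u0 u})"
      by (rule has_vector_derivative_at_within)
  qed
  define \<gamma> where "\<gamma> v = \<rho> (u0, v)" for v
  \<comment> \<open>The spatial curve in which the surface meets the time slice \<open>u0\<close>.
    As \<gamma> has derivative \<open>- c\<close>, its velocity is \<omega>, which is nonzero and
    orthogonal to the null lines, as \<open>adapted_frame\<close> requires.\<close>
  define b where "b v = \<gamma> v *\<^sub>R \<zeta> v + \<beta> v" for v
  have sL: "smooth_on L \<zeta>" "smooth_on L \<beta>" using sm LB smooth_on_subset by blast+
  have s\<gamma>: "smooth_on L \<gamma>"
    unfolding \<gamma>_def[abs_def]
    by (rule smooth_on_compose[OF oJL(2), of "\<lambda>v. (u0, v)" "J \<times> L"])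
       (use u0 s\<rho> in \<open>auto intro!: smooth_on_Pair smooth_on_const smooth_on_ident oJL(2)\<close>)
  have sb: "smooth_on L b"
    unfolding b_def[abs_def] by (intro smooth_on_add smooth_on_scaleR oJL(2) s\<gamma> sL)
  have d\<gamma>: "dd \<gamma> v 1 = - c v" if v: "v \<in> L" for v
  proof -
    have uv: "(u0, v) \<in> J \<times> L" using u0 v by simp
    have 1: "((\<lambda>v. (u0, v)) has_derivative (\<lambda>k. (0, k))) (at v)"
      by (auto intro!: derivative_eq_intros)
    have "(\<gamma> has_derivative (\<lambda>k. dd \<rho> (u0, v) (0, k))) (at v)"
      unfolding \<gamma>_def[abs_def] using has_derivative_compose[OF 1 dd_works[OF smooth_on_differentiable[OF s\<rho> uv]]] .
    from dd_eqI[OF this] show ?thesis by (simp add: d\<rho>[OF uv])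
  qed
  have db: "dd b v 1 = \<omega> (G (u0, v))" and G0: "(u0, v) \<in> J \<times> L" "snd (G (u0, v)) = v" if v: "v \<in> L" for v
  proof -
    show uv: "(u0, v) \<in> J \<times> L" using u0 v by simp
    show sv: "snd (G (u0, v)) = v" using Gs(1)[OF uv] by simp
    note d = smooth_on_differentiable[OF s\<gamma> v] smooth_on_differentiable[OF sL(1) v] smooth_on_differentiable[OF sL(2) v]
    show "dd b v 1 = \<omega> (G (u0, v))"
      unfolding b_def[abs_def] dd_add[OF dd_bounded_bilinear(2)[OF bounded_bilinear_scaleR d(1,2)] d(3)] dd_scaleR[OF d(1,2)]
        d\<gamma>[OF v] \<omega>_def sv \<zeta>'_def by (simp add: \<gamma>_def \<rho>_def)
  qed
  have fr1: "norm (\<zeta> v) = 1" "dd b v 1 \<noteq> 0" "dd b v 1 \<bullet> \<zeta> v = 0" "dd \<zeta> v 1 = q (G (u0, v)) *\<^sub>R dd b v 1" if v: "v \<in> L" for v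
    unfolding db[OF v] using \<zeta>(1) LB v \<omega>_nonzero[OF GA[OF G0(1)[OF v]]] \<omega>_\<zeta>[OF GA[OF G0(1)[OF v]]]
      null_equations(2)[OF GA[OF G0(1)[OF v]]] G0(2)[OF v] by (auto simp: \<zeta>'_def)
  obtain a1 a2 \<phi>1 \<phi>2 \<phi>3 \<alpha>1 \<alpha>3 where fr:
    "smooth_on L a1" "smooth_on L a2" "smooth_on L \<phi>1" "smooth_on L \<phi>2" "smooth_on L \<phi>3"
    "smooth_on L \<alpha>1" "smooth_on L \<alpha>3"
    "\<forall>v\<in>L. (\<phi>2 has_real_derivative - a1 v * \<phi>1 v) (at v)"
    "\<forall>v\<in>L. (\<phi>3 has_real_derivative - a2 v * \<phi>1 v) (at v)"
    "\<forall>v\<in>L. (\<alpha>1 has_vector_derivative a1 v *\<^sub>R \<zeta> v + a2 v *\<^sub>R \<alpha>3 v) (at v)"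
    "\<forall>v\<in>L. (\<zeta> has_vector_derivative - a1 v *\<^sub>R \<alpha>1 v) (at v)"
    "\<forall>v\<in>L. (\<alpha>3 has_vector_derivative - a2 v *\<^sub>R \<alpha>1 v) (at v)"
    and on: "\<And>v. v \<in> L \<Longrightarrow> norm (\<alpha>1 v) = 1" "\<And>v. v \<in> L \<Longrightarrow> norm (\<alpha>3 v) = 1"
    "\<And>v. v \<in> L \<Longrightarrow> \<alpha>1 v \<bullet> \<zeta> v = 0" "\<And>v. v \<in> L \<Longrightarrow> \<alpha>1 v \<bullet> \<alpha>3 v = 0" "\<And>v. v \<in> L \<Longrightarrow> \<zeta> v \<bullet> \<alpha>3 v = 0"
    and bsum: "\<And>v. v \<in> L \<Longrightarrow> \<phi>1 v *\<^sub>R \<alpha>1 v + \<phi>2 v *\<^sub>R \<zeta> v + \<phi>3 v *\<^sub>R \<alpha>3 v = b v"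
    by (rule adapted_frame[OF oJL(2) sL(1) sb fr1]; (rule that)?; assumption)
  interpret P': spacelike_patch I f "J \<times> L" "\<psi> \<circ> (\<sigma> \<circ> G)" by (rule local_param_spacelike[OF sp lp'])
  have form: "(\<psi> \<circ> (\<sigma> \<circ> G)) (u, v) = (u, \<phi>1 v *\<^sub>R \<alpha>1 v
              + ((LBINT s=u0..u. a / (f s * sqrt (a\<^sup>2 - (f s)\<^sup>2))) + \<phi>2 v) *\<^sub>R \<zeta> v + \<phi>3 v *\<^sub>R \<alpha>3 v)"
    if u: "u \<in> J" and v: "v \<in> L" for u v
  proof -
    have uv: "(u, v) \<in> J \<times> L" using u v by simp
    have Guv: "G (u, v) = (\<rho> (u, v), v)" using Gs(1)[OF uv] by (simp add: \<rho>_def prod_eq_iff)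
    have r: "\<rho> (u, v) \<in> A" "v \<in> B" using GA[OF uv] unfolding Guv by auto
    have "snd (?X (G (u, v))) = \<rho> (u, v) *\<^sub>R \<zeta> v + \<beta> v" unfolding Guv by (rule ruled[OF r])
    also have "\<dots> = (\<rho> (u, v) - \<rho> (u0, v)) *\<^sub>R \<zeta> v + b v" by (simp add: b_def \<gamma>_def algebra_simps)
    also have "\<dots> = \<phi>1 v *\<^sub>R \<alpha>1 v + ((\<rho> (u, v) - \<rho> (u0, v)) + \<phi>2 v) *\<^sub>R \<zeta> v + \<phi>3 v *\<^sub>R \<alpha>3 v"
      unfolding bsum[OF v, symmetric] by (simp add: algebra_simps)
    finally have "snd (?X (G (u, v))) = \<phi>1 v *\<^sub>R \<alpha>1 v + ((LBINT s=u0..u. h s) + \<phi>2 v) *\<^sub>R \<zeta> v + \<phi>3 v *\<^sub>R \<alpha>3 v"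
      unfolding int[OF u v] .
    moreover have "fst (?X (G (u, v))) = u" using Gs(2)[OF uv] by (simp add: time_def)
    ultimately show ?thesis by (simp add: prod_eq_iff h_def)
  qed
  have "nullity_surface f I (J \<times> L) (\<psi> \<circ> (\<sigma> \<circ> G))"
    unfolding nullity_surface_def
  proof (intro exI conjI)
    show "open_interval J" "J \<subseteq> I" "open_interval L" "u0 \<in> J" "v0 \<in> L" by fact+
    show "\<forall>u\<in>J. a\<^sup>2 - (f u)\<^sup>2 > 0" using af unfolding a2 by blast
    show "\<alpha>1 v0 = \<alpha>1 v0" "\<zeta> v0 = \<zeta> v0" "\<alpha>3 v0 = \<alpha>3 v0" by (rule refl)+
    show "norm (\<alpha>1 v0) = 1" "norm (\<zeta> v0) = 1" "norm (\<alpha>3 v0) = 1" "\<alpha>1 v0 \<bullet> \<zeta> v0 = 0" "\<alpha>1 v0 \<bullet> \<alpha>3 v0 = 0" "\<zeta> v0 \<bullet> \<alpha>3 v0 = 0"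
      using on v0 fr1(1) by blast+
    show "\<forall>(u, v)\<in>J \<times> L. (\<psi> \<circ> (\<sigma> \<circ> G)) (u, v) = (u, \<phi>1 v *\<^sub>R \<alpha>1 v
              + ((LBINT s=u0..u. a / (f s * sqrt (a\<^sup>2 - (f s)\<^sup>2))) + \<phi>2 v) *\<^sub>R \<zeta> v + \<phi>3 v *\<^sub>R \<alpha>3 v)"
      using form by blast
    show "\<forall>x\<in>J \<times> L. pos_def_on (rw_metric f ((\<psi> \<circ> (\<sigma> \<circ> G)) x)) (range (dd (\<psi> \<circ> (\<sigma> \<circ> G)) x))"
      using P'.pos_def by blast
  qed (fact fr sL(1) P'.immersion order_refl)+
  moreover have "p \<in> (\<sigma> \<circ> G) ` (J \<times> L)"
    using JL(3) sG(3) y0(2) by (metis comp_apply imageI)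
  ultimately show thesis using that lp' by blast
qed

end

theorem theorem4p2:
  fixes I :: "real set" and f :: "real \<Rightarrow> real"
    and M :: "'m::{t2_space, second_countable_topology} set"
    and \<psi> :: "'m \<Rightarrow> spacetime"
  assumes "open_interval I" and "smooth_on I f" and "\<forall>t\<in>I. f t \<noteq> 0"
    and "spacelike_surface (rw_metric f) (rw_space I) M \<psi>"
    and "\<forall>t\<in>I. deriv (deriv f) t / f t - (deriv f t)\<^sup>2 / (f t)\<^sup>2 \<noteq> 0"
    and "\<forall>p\<in>M. time_tangential f M \<psi> p \<noteq> 0"
    and "positive_relative_nullity (rw_metric f) M \<psi> \<Longrightarrow>
         smooth_line_distribution M \<psi> (relative_null_space (rw_metric f) M \<psi>)"
    and "connected M"
    and "\<not> (\<exists>U H. openin (top_of_set M) U \<and> U \<noteq> {} \<and> \<psi> ` U \<subseteq> H \<and>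
              totally_geodesic_hypersurface (rw_metric f) (rw_space I) H)"
  shows "positive_relative_nullity (rw_metric f) M \<psi> \<longleftrightarrow>
         locally_congruent (rw_metric f) (rw_space I) M \<psi> (nullity_surface f I)"
proof
  interpret robertson_walker I f using assms(1-3) by unfold_locales auto
  assume "positive_relative_nullity (rw_metric f) M \<psi>"
  note sld = assms(7)[OF this]
  show "locally_congruent (rw_metric f) (rw_space I) M \<psi> (nullity_surface f I)"
    unfolding locally_congruent_def
  proof
    fix p assume p: "p \<in> M"
    obtain D \<sigma> where D: "local_param M \<psi> D \<sigma>" "p \<in> \<sigma> ` D" "nullity_surface f I D (\<psi> \<circ> \<sigma>)"
      by (rule local_nullity_surface[OF assms(4) sld assms(9,6,5) p])
    obtain \<tau> where "openin (top_of_set M) (\<sigma> ` D)" "homeomorphism D (\<sigma> ` D) \<sigma> \<tau>" "open D"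
      using D(1) by (auto simp: local_param_def immersion_on_def)
    moreover have "isometry_of (rw_metric f) (rw_space I) (\<lambda>x. x)"
      by (rule isometry_of_ident[OF open_rw_space])
    ultimately show "\<exists>U F D \<phi> W \<sigma> \<tau>.
        openin (top_of_set M) U \<and> p \<in> U \<and> isometry_of (rw_metric f) (rw_space I) F \<and>
        nullity_surface f I D \<phi> \<and> open W \<and> W \<subseteq> D \<and>
        homeomorphism W U \<sigma> \<tau> \<and> (\<forall>x\<in>W. F (\<psi> (\<sigma> x)) = \<phi> x)"
      using D(2,3) by (intro exI[of _ "\<sigma> ` D"] exI[of _ "\<lambda>x. x"] exI[of _ D] exI[of _ "\<psi> \<circ> \<sigma>"] exI[of _ \<sigma>] exI[of _ \<tau>]) auto
  qed
next
  interpret robertson_walker I f using assms(1-3) by unfold_locales auto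
  show "locally_congruent (rw_metric f) (rw_space I) M \<psi> (nullity_surface f I) \<Longrightarrow>
      positive_relative_nullity (rw_metric f) M \<psi>"
    by (rule locally_congruent_imp_positive_relative_nullity[OF assms(4)])
qed

end
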